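(* Let $0<p_1\le p_2<\infty$, $-1<\alpha_1,\alpha_2,\xi<\infty$ and $\mu\in\mathcal{M}_+$. Suppose that $$n+1+\xi>n\max\left(1,\frac1{p_i}\right)+\frac{1+\alpha_i}{p_i},\qquad i=1,2.$$ Let $$\lambda=1+\frac1{p_1}-\frac1{p_2},\qquad \gamma=\frac1\lambda\left(\xi+\frac{\alpha_1}{p_1}-\frac{\alpha_2}{p_2}\right).$$ Then the following statements are equivalent: (1) $B_\mu^\xi$ is bounded from $A^{p_1}_{\alpha_1}(T_B)$ to $L^{p_2}_{\alpha_2}(T_B)$. (2) $T_\mu^\xi$ is bounded from $A^{p_1}_{\alpha_1}(T_B)$ to $A^{p_2}_{\alpha_2}(T_B)$. (3) $\mu$ is a $(\lambda,\gamma)$-Carleson measure. Moreover, $$\|B_\mu^\xi\|_{A^{p_1}_{\alpha_1}\to L^{p_2}_{\alpha_2}}\simeq\|T_\mu^\xi\|_{A^{p_1}_{\alpha_1}\to A^{p_2}_{\alpha_2}}\simeq\|\mu\|_{\lambda,\gamma},$$ where the implied constants do not depend on $\mu$.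
   Context: Let $n\ge 1$. Write $z=(z',z_n)\in\mathbb{C}^n$ with $z'=(z_1,\dots,z_{n-1})$, and $u^2:=u\cdot u=\sum_j u_j^2$ for a vector $u$ (no conjugation). The tubular domain is $T_B=\{z=x+iy\in\mathbb{C}^n: x\in\mathbb{R}^n,\ y\in B\}$ with $B=\{(y',y_n)\in\mathbb{R}^n: |y'|^2=y_1^2+\cdots+y_{n-1}^2<y_n\}$. For $z,w\in T_B$ put $$\rho(z,w)=\tfrac14\left((z'-\overline{w'})^2-2i(z_n-\overline{w_n})\right),\qquad \rho(z)=\rho(z,z)=y_n-|y'|^2 .$$ One has $\operatorname{Re}\rho(z,w)>0$, and non-integer powers of $\rho(z,w)$ are taken with the principal branch. Let $\mathbf{i}=(0',i)\in T_B$. For $\alpha>-1$ let $dV_\alpha(z)=\rho(z)^\alpha dV(z)$, with $dV$ Lebesgue measure on $\mathbb{C}^n$. For $0<p<\infty$, $L^p_\alpha(T_B)$ is the space of Lebesgue measurable $f$ on $T_B$ with $\|f\|_{p,\alpha}=\left(\int_{T_B}|f|^p\,dV_\alpha\right)^{1/p}<\infty$, and the Bergman space $A^p_\alpha(T_B)$ is the set of holomorphic functions in $L^p_\alpha(T_B)$. $\mathcal{M}_+$ is the set of positive Borel measures $\mu$ on $T_B$ with $\int_{T_B}|\rho(z,\mathbf{i})|^{-t}\,d\mu(z)<\infty$ for some $t>0$. For $\xi>-1$, $\mu\in\mathcal{M}_+$ and $f$ holomorphic on $T_B$, the Berezin-type operator (sublinear) and the Toeplitz operator are $$B_\mu^\xi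 f(z)=\int_{T_B}\frac{|f(w)|}{|\rho(z,w)|^{n+1+\xi}}\,d\mu(w),\qquad T_\mu^\xi f(z)=\int_{T_B}\frac{f(w)}{\rho(z,w)^{n+1+\xi}}\,d\mu(w),\qquad z\in T_B.$$ An operator $S$ (linear or sublinear) is bounded from $X$ to $Y$ if it is well defined from $X$ to $Y$ (for $T_\mu^\xi$, the defining integral converges absolutely for every $f\in X$ and $z\in T_B$) and there is $C$ with $\|Sf\|_Y\le C\|f\|_X$ for all $f\in X$; $\|S\|_{X\to Y}$ is the least such $C$. For $\lambda>0$ and $\alpha>-1$, a positive Borel measure $\mu$ on $T_B$ is a $(\lambda,\alpha)$-Carleson measure if for all positive numbers $p,q$ with $q/p=\lambda$ there is $C>0$ such that $\int_{T_B}|f|^q\,d\mu\le C\|f\|_{p,\alpha}^q$ for all $f\in A^p_\alpha(T_B)$. Also (for fixed $p,q$ with $q/p=\lambda$) $$\|\mu\|_{\lambda,\alpha}=\sup\left\{\int_{T_B}|f|^q\,d\mu : f\in A^p_\alpha(T_B),\ \|f\|_{p,\alpha}\le1\right\}.$$ $A\simeq B$ means that each of $A,B$ is at most a positive constant times the other. *)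

theory Defs
  imports "HOL-Analysis.Analysis"
begin

text \<open>Points of \<open>\<complex>\<^sup>n\<close> are vectors indexed by a finite linearly ordered type \<open>'n\<close>, so that
  \<open>n = CARD('n)\<close> is an arbitrary integer \<open>\<ge> 1\<close>; \<open>z\<^sub>n\<close> is the component at the largest index and \<open>z'\<close>
  consists of all the others.\<close>

type_synonym 'n cspace = "(complex, 'n) vec"

definition last_ix :: "'n::{finite,linorder}" where
  "last_ix = Max UNIV"

definition rho_diag :: "('n::{finite,linorder}) cspace \<Rightarrow> real" where
  "rho_diag z = Im (z $ last_ix) - (\<Sum>j\<in>UNIV - {last_ix}. (Im (z $ j))\<^sup>2)"

definition T_B :: "('n::{finite,linorder}) cspace set" where
  "T_B = {z. (\<Sum>j\<in>UNIV - {last_ix}. (Im (z $ j))\<^sup>2) < Im (z $ last_ix)}"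

definition rho :: "('n::{finite,linorder}) cspace \<Rightarrow> 'n cspace \<Rightarrow> complex" where
  "rho z w = 1/4 * ((\<Sum>j\<in>UNIV - {last_ix}. (z $ j - cnj (w $ j))\<^sup>2)
                     - 2 * \<i> * (z $ last_ix - cnj (w $ last_ix)))"

lemma rho_same: "rho z z = of_real (rho_diag z)"
proof -
  have "(z $ j - cnj (z $ j))\<^sup>2 = - 4 * of_real ((Im (z $ j))\<^sup>2)" for j
    by (simp add: complex_diff_cnj power_mult_distrib)
  then show ?thesis
    by (simp add: rho_def rho_diag_def complex_diff_cnj sum_negf algebra_simps flip: sum_distrib_left)
qed

lemma Re_rho_pos:
  assumes "z \<in> T_B" "w \<in> T_B"
  shows "Re (rho z w) > 0"
proof -
  have "- (2 * (Im (z $ j))\<^sup>2 + 2 * (Im (w $ j))\<^sup>2) \<le> Re ((z $ j - cnj (w $ j))\<^sup>2)" for j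
  proof -
    have "2 * (Im (z $ j))\<^sup>2 + 2 * (Im (w $ j))\<^sup>2 - (Im (z $ j) + Im (w $ j))\<^sup>2
            = (Im (z $ j) - Im (w $ j))\<^sup>2"
      by (simp add: power2_eq_square algebra_simps)
    moreover have "Re ((z $ j - cnj (w $ j))\<^sup>2)
        = (Re (z $ j) - Re (w $ j))\<^sup>2 - (Im (z $ j) + Im (w $ j))\<^sup>2"
      by (simp add: power2_eq_square)
    ultimately show ?thesis
      using zero_le_power2[of "Im (z $ j) - Im (w $ j)"] zero_le_power2[of "Re (z $ j) - Re (w $ j)"]
      by linarith
  qed
  then have "(\<Sum>j\<in>UNIV - {last_ix}. - (2 * (Im (z $ j))\<^sup>2 + 2 * (Im (w $ j))\<^sup>2))
      \<le> (\<Sum>j\<in>UNIV - {last_ix}. Re ((z $ j - cnj (w $ j))\<^sup>2))"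
    by (rule sum_mono)
  then have "- 2 * (\<Sum>j\<in>UNIV - {last_ix}. (Im (z $ j))\<^sup>2) - 2 * (\<Sum>j\<in>UNIV - {last_ix}. (Im (w $ j))\<^sup>2)
      \<le> (\<Sum>j\<in>UNIV - {last_ix}. Re ((z $ j - cnj (w $ j))\<^sup>2))"
    by (simp add: sum_negf sum.distrib sum_distrib_left sum_subtractf)
  moreover have "Re (rho z w) = 1/4 * ((\<Sum>j\<in>UNIV - {last_ix}. Re ((z $ j - cnj (w $ j))\<^sup>2))
      + 2 * (Im (z $ last_ix) + Im (w $ last_ix)))"
    by (simp add: rho_def algebra_simps)
  ultimately show ?thesis using assms by (simp add: T_B_def)
qed

definition base_pt :: "('n::{finite,linorder}) cspace" where
  "base_pt = (\<chi> j. if j = last_ix then \<i> else 0)"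

definition dV :: "real \<Rightarrow> ('n::{finite,linorder}) cspace measure" where
  "dV \<alpha> = density (lebesgue_on T_B) (\<lambda>z. ennreal (rho_diag z powr \<alpha>))"

definition ennpowr :: "ennreal \<Rightarrow> real \<Rightarrow> ennreal" where
  \<comment> \<open>powers with positive exponent on \<open>[0,\<infinity>]\<close>\<close>
  "ennpowr x p = (if x = \<infinity> then \<infinity> else ennreal (enn2real x powr p))"

text \<open>The \<open>L\<^sup>p\<^sub>\<alpha>\<close> norm is defined for functions with values in \<open>[0,\<infinity>]\<close>, since the Berezin-type
  operator produces such functions; for complex functions it is applied to the modulus.
  Only the values on \<open>T_B\<close> matter.\<close>

definition Lnorm_ext :: "real \<Rightarrow> real \<Rightarrow> (('n::{finite,linorder}) cspace \<Rightarrow> ennreal) \<Rightarrow> ennreal" where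
  "Lnorm_ext p \<alpha> g = ennpowr (\<integral>\<^sup>+ z. ennpowr (g z) p \<partial>dV \<alpha>) (1/p)"

definition Lp_ext :: "real \<Rightarrow> real \<Rightarrow> (('n::{finite,linorder}) cspace \<Rightarrow> ennreal) set" where
  "Lp_ext p \<alpha> = {g \<in> borel_measurable (lebesgue_on T_B). Lnorm_ext p \<alpha> g < \<infinity>}"

definition Lnorm :: "real \<Rightarrow> real \<Rightarrow> (('n::{finite,linorder}) cspace \<Rightarrow> complex) \<Rightarrow> ennreal" where
  "Lnorm p \<alpha> f = Lnorm_ext p \<alpha> (\<lambda>z. ennreal (cmod (f z)))"

definition Lp :: "real \<Rightarrow> real \<Rightarrow> (('n::{finite,linorder}) cspace \<Rightarrow> complex) set" where
  "Lp p \<alpha> = {f \<in> borel_measurable (lebesgue_on T_B). Lnorm p \<alpha> f < \<infinity>}"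

text \<open>Holomorphy in several variables (on an open set): complex differentiability, i.e. a real
  Frechet derivative that is complex linear.\<close>

definition holomorphic_multi :: "(('n::finite) cspace \<Rightarrow> complex) \<Rightarrow> 'n cspace set \<Rightarrow> bool" where
  "holomorphic_multi f S \<longleftrightarrow>
     (\<forall>z\<in>S. \<exists>D. (f has_derivative D) (at z) \<and> (\<forall>c v. D (c *s v) = c * D v))"

definition Bergman :: "real \<Rightarrow> real \<Rightarrow> (('n::{finite,linorder}) cspace \<Rightarrow> complex) set" where
  "Bergman p \<alpha> = {f \<in> Lp p \<alpha>. holomorphic_multi f T_B}"

definition borel_measure_TB :: "('n::{finite,linorder}) cspace measure \<Rightarrow> bool" where
  "borel_measure_TB \<mu> \<longleftrightarrow> space \<mu> = T_B \<and> sets \<mu> = sets (restrict_space borel T_B)"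

definition M_plus :: "('n::{finite,linorder}) cspace measure set" where
  "M_plus = {\<mu>. borel_measure_TB \<mu> \<and>
     (\<exists>t>0. (\<integral>\<^sup>+ z. ennreal (cmod (rho z base_pt) powr (-t)) \<partial>\<mu>) < \<infinity>)}"

definition berezin :: "('n::{finite,linorder}) cspace measure \<Rightarrow> real
    \<Rightarrow> ('n cspace \<Rightarrow> complex) \<Rightarrow> 'n cspace \<Rightarrow> ennreal" where
  "berezin \<mu> \<xi> f z =
     (\<integral>\<^sup>+ w. ennreal (cmod (f w) / cmod (rho z w) powr (real CARD('n) + 1 + \<xi>)) \<partial>\<mu>)"

definition toeplitz :: "('n::{finite,linorder}) cspace measure \<Rightarrow> real
    \<Rightarrow> ('n cspace \<Rightarrow> complex) \<Rightarrow> 'n cspace \<Rightarrow> complex" where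
  "toeplitz \<mu> \<xi> f z =
     (LINT w|\<mu>. f w / rho z w powr complex_of_real (real CARD('n) + 1 + \<xi>))"

definition bounded_op :: "'f set \<Rightarrow> ('f \<Rightarrow> ennreal) \<Rightarrow> 'g set \<Rightarrow> ('g \<Rightarrow> ennreal) \<Rightarrow> ('f \<Rightarrow> 'g) \<Rightarrow> bool" where
  "bounded_op X normX Y normY S \<longleftrightarrow>
     (\<forall>f\<in>X. S f \<in> Y) \<and> (\<exists>C::real. C \<ge> 0 \<and> (\<forall>f\<in>X. normY (S f) \<le> ennreal C * normX f))"

definition op_norm :: "'f set \<Rightarrow> ('f \<Rightarrow> ennreal) \<Rightarrow> ('g \<Rightarrow> ennreal) \<Rightarrow> ('f \<Rightarrow> 'g) \<Rightarrow> ennreal" where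
  "op_norm X normX normY S = Inf {C. \<forall>f\<in>X. normY (S f) \<le> C * normX f}"

definition berezin_bounded :: "('n::{finite,linorder}) cspace measure \<Rightarrow> real
    \<Rightarrow> real \<Rightarrow> real \<Rightarrow> real \<Rightarrow> real \<Rightarrow> bool" where
  "berezin_bounded \<mu> \<xi> p1 \<alpha>1 p2 \<alpha>2 \<longleftrightarrow>
     bounded_op (Bergman p1 \<alpha>1) (Lnorm p1 \<alpha>1) (Lp_ext p2 \<alpha>2) (Lnorm_ext p2 \<alpha>2) (berezin \<mu> \<xi>)"

definition toeplitz_bounded :: "('n::{finite,linorder}) cspace measure \<Rightarrow> real
    \<Rightarrow> real \<Rightarrow> real \<Rightarrow> real \<Rightarrow> real \<Rightarrow> bool" where
  "toeplitz_bounded \<mu> \<xi> p1 \<alpha>1 p2 \<alpha>2 \<longleftrightarrow>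
     (\<forall>f\<in>Bergman p1 \<alpha>1. \<forall>z\<in>T_B.
        integrable \<mu> (\<lambda>w. f w / rho z w powr complex_of_real (real CARD('n) + 1 + \<xi>))) \<and>
     bounded_op (Bergman p1 \<alpha>1) (Lnorm p1 \<alpha>1) (Bergman p2 \<alpha>2) (Lnorm p2 \<alpha>2) (toeplitz \<mu> \<xi>)"

definition berezin_norm :: "('n::{finite,linorder}) cspace measure \<Rightarrow> real
    \<Rightarrow> real \<Rightarrow> real \<Rightarrow> real \<Rightarrow> real \<Rightarrow> ennreal" where
  "berezin_norm \<mu> \<xi> p1 \<alpha>1 p2 \<alpha>2 =
     op_norm (Bergman p1 \<alpha>1) (Lnorm p1 \<alpha>1) (Lnorm_ext p2 \<alpha>2) (berezin \<mu> \<xi>)"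

definition toeplitz_norm :: "('n::{finite,linorder}) cspace measure \<Rightarrow> real
    \<Rightarrow> real \<Rightarrow> real \<Rightarrow> real \<Rightarrow> real \<Rightarrow> ennreal" where
  "toeplitz_norm \<mu> \<xi> p1 \<alpha>1 p2 \<alpha>2 =
     op_norm (Bergman p1 \<alpha>1) (Lnorm p1 \<alpha>1) (Lnorm p2 \<alpha>2) (toeplitz \<mu> \<xi>)"

definition carleson :: "real \<Rightarrow> real \<Rightarrow> ('n::{finite,linorder}) cspace measure \<Rightarrow> bool" where
  "carleson lam \<alpha> \<mu> \<longleftrightarrow> borel_measure_TB \<mu> \<and>
     (\<forall>p q. p > 0 \<and> q > 0 \<and> q / p = lam \<longrightarrow>
        (\<exists>C::real. C > 0 \<and> (\<forall>f\<in>Bergman p \<alpha>.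
           (\<integral>\<^sup>+ z. ennreal (cmod (f z) powr q) \<partial>\<mu>) \<le> ennreal C * ennpowr (Lnorm p \<alpha> f) q)))"

text \<open>The quantity \<open>\<parallel>\<mu>\<parallel>\<^bsub>q/p,\<alpha>\<^esub>\<close>, computed with the chosen pair \<open>p, q\<close>.\<close>

definition carleson_norm :: "real \<Rightarrow> real \<Rightarrow> real \<Rightarrow> ('n::{finite,linorder}) cspace measure \<Rightarrow> ennreal" where
  "carleson_norm p q \<alpha> \<mu> =
     (SUP f\<in>{f \<in> Bergman p \<alpha>. Lnorm p \<alpha> f \<le> 1}. \<integral>\<^sup>+ z. ennreal (cmod (f z) powr q) \<partial>\<mu>)"

definition comparable :: "real \<Rightarrow> ennreal \<Rightarrow> ennreal \<Rightarrow> bool" where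
  "comparable C a b \<longleftrightarrow> a \<le> ennreal C * b \<and> b \<le> ennreal C * a"

end

theory Submission
  imports Defs "HOL-Complex_Analysis.Cauchy_Integral_Formula"
begin

text \<open>
  All three conditions are equivalent to the geometric condition \<open>\<mu>(E(z)) \<le> K \<rho>(z)\<^bsup>\<kappa>\<^esup>\<close> on the Bergman
  balls \<open>E(z) = {w. |\<rho>(z,w)|\<^sup>2 < 2 \<rho>(z) \<rho>(w)}\<close>, where \<open>\<kappa> = \<lambda> (n + 1 + \<gamma>)\<close>. The domain has a simply transitive
  group of affine automorphisms, under which \<open>\<rho>\<close> and Lebesgue measure are multiplied by constants; on Bergman
  balls \<open>|\<rho>(\<cdot>,u)|\<close> is constant up to a fixed factor, and \<open>|f|\<^sup>p\<close> satisfies a mean value inequality there. This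
  turns integrals against \<open>\<mu>\<close> of holomorphic functions into weighted volume integrals (the Carleson embedding
  for exponents \<open>p \<le> q\<close>). Applied to \<open>f \<rho>(\<cdot>,z)\<^bsup>-s\<^esup>\<close>, \<open>s = n + 1 + \<xi>\<close>, followed by Jensen's inequality and the
  Forelli--Rudin estimate for \<open>\<integral> \<rho>(w)\<^sup>\<alpha> |\<rho>(z,w)|\<^bsup>-\<sigma>\<^esup> dV(w)\<close>, it bounds the Berezin-type operator, which
  dominates the Toeplitz operator. Conversely, testing on \<open>f\<^sub>z = \<rho>(\<cdot>,z)\<^bsup>-s\<^esup>\<close> gives
  \<open>T f\<^sub>z(z) = \<integral> |\<rho>(z,w)|\<^bsup>-2s\<^esup> d\<mu>(w)\<close>, which controls \<open>\<mu>(E(z))\<close>.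
\<close>

subsection \<open>Linear changes of variables\<close>

text \<open>The exponent is dictated by scaling: with N = n + 1 and s = N + \<xi>, the definition of
  \<gamma> gives \<kappa> = s + (N + \<alpha>1)/p1 - (N + \<alpha>2)/p2. The exponents p, q of the
  Carleson norm have dropped out, so all pairs with q/p = \<lambda> give comparable norms. The
  assumption p1 <= p2 means \<lambda> >= 1, the range in which the ball condition yields the
  embedding: the excess power of a local mean is absorbed by the global norm, and Fubini with the
  symmetric relation w in E(z) takes the place of a covering by balls. The inequality for i = 1 puts
  the kernels of order s into the source space; the one for i = 2 leaves room for the exponents of
  the upper estimate and gives \<gamma> > -1. The obstacle in that estimate is p1 > 1, where the
  embedding cannot go from exponent p1 down to 1: it is applied with p = q = 1, and a first Jensen
  step with a weight tuned to the kernel is inserted. Membership in \<open>M_plus\<close> makes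
  \<mu> sigma-finite, as Fubini demands. Since norms are compared, every constant is fixed before
  \<mu>, and all bounds are linear in K.\<close>

lemma nn_integral_lborel_shift:
  fixes F :: "'a::euclidean_space \<Rightarrow> ennreal"
  assumes [measurable]: "F \<in> borel_measurable borel"
  shows "(\<integral>\<^sup>+x. F (a + x) \<partial>lborel) = (\<integral>\<^sup>+x. F x \<partial>lborel)"
proof -
  have "(\<integral>\<^sup>+x. F x \<partial>lborel) = (\<integral>\<^sup>+x. F x \<partial>distr lborel borel ((+) a))"
    by (simp add: lborel_distr_plus)
  also have "\<dots> = (\<integral>\<^sup>+x. F (a + x) \<partial>lborel)"
    by (subst nn_integral_distr) auto
  finally show ?thesis by simp
qed

lemma nn_integral_lborel_reflect:
  fixes F :: "'a::euclidean_space \<Rightarrow> ennreal"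
  assumes [measurable]: "F \<in> borel_measurable borel"
  shows "(\<integral>\<^sup>+x. F (a - x) \<partial>lborel) = (\<integral>\<^sup>+x. F x \<partial>lborel)"
proof -
  have "(\<integral>\<^sup>+x. F x \<partial>lborel)
      = (\<integral>\<^sup>+x. F x \<partial>density (distr lborel borel (\<lambda>x. a + (-1) *\<^sub>R x)) (\<lambda>_. 1))"
    using lborel_affine[of "-1" a] by simp
  also have "\<dots> = (\<integral>\<^sup>+x. F (a - x) \<partial>lborel)"
    by (simp add: density_1 nn_integral_distr)
  finally show ?thesis by simp
qed

text \<open>Uniqueness of Haar measure by Fubini: the integral of
  \<open>indicator A y * indicator B (x + y)\<close>, with y under \<open>\<nu>\<close> and x under
  \<open>lborel\<close>, is evaluated in both orders. Invariance of \<open>lborel\<close> settles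
  one order; in the other, y is replaced by y - x under \<open>\<nu>\<close>, and
  \<open>lborel\<close> is reflected and translated.\<close>

lemma translation_invariant_measure_unique:
  fixes \<nu> :: "'a::euclidean_space measure"
  assumes sets[measurable_cong]: "sets \<nu> = sets borel" and "sigma_finite_measure \<nu>"
    and inv: "\<And>F a. F \<in> borel_measurable borel \<Longrightarrow> (\<integral>\<^sup>+x. F (a + x) \<partial>\<nu>) = (\<integral>\<^sup>+x. F x \<partial>\<nu>)"
    and A[measurable]: "A \<in> sets borel" and B[measurable]: "B \<in> sets borel"
  shows "emeasure \<nu> A * emeasure lborel B = emeasure \<nu> B * emeasure lborel A"
proof -
  interpret \<nu>: sigma_finite_measure \<nu> by fact
  interpret P: pair_sigma_finite \<nu> "lborel :: 'a measure" ..
  have "emeasure \<nu> A * emeasure lborel B = (\<integral>\<^sup>+y. \<integral>\<^sup>+x. indicator A y * indicator B (x + y) \<partial>lborel \<partial>\<nu>)"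
  proof -
    have "(\<integral>\<^sup>+x. indicator A y * indicator B (x + y) \<partial>lborel) = indicator A y * emeasure lborel B" for y
      using nn_integral_lborel_shift[of "\<lambda>x. indicator B x" y]
      by (simp add: nn_integral_cmult add.commute)
    then show ?thesis by (simp add: nn_integral_multc)
  qed
  also have "\<dots> = (\<integral>\<^sup>+x. \<integral>\<^sup>+y. indicator A y * indicator B (x + y) \<partial>\<nu> \<partial>lborel)"
    by (rule P.Fubini'[symmetric]) measurable
  also have "\<dots> = (\<integral>\<^sup>+x. \<integral>\<^sup>+y. indicator A (y - x) * indicator B y \<partial>\<nu> \<partial>lborel)"
    using inv[of "\<lambda>y. indicator A (y - x) * indicator B y" x for x] by simp
  also have "\<dots> = (\<integral>\<^sup>+y. \<integral>\<^sup>+x. indicator A (y - x) * indicator B y \<partial>lborel \<partial>\<nu>)"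
    by (rule P.Fubini') measurable
  also have "\<dots> = (\<integral>\<^sup>+y. emeasure lborel A * indicator B y \<partial>\<nu>)"
    using nn_integral_lborel_reflect[of "indicator A"] by (simp add: nn_integral_multc)
  also have "\<dots> = emeasure \<nu> B * emeasure lborel A"
    by (subst nn_integral_cmult) (auto simp: mult.commute)
  finally show ?thesis .
qed

text \<open>For injective L this is 1/|det L|. As a ratio of volumes it makes sense without choosing
  real coordinates on a complex vector space.\<close>

definition lin_scale :: "('a::euclidean_space \<Rightarrow> 'a) \<Rightarrow> real" where
  "lin_scale L = measure lborel (L -` ball 0 1) / measure lborel (ball (0::'a) 1)"

lemma measure_lborel_ball_pos: "r > 0 \<Longrightarrow> measure lborel (ball (c::'a::euclidean_space) r) > 0"
  using content_ball_pos[of r c] by simp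

text \<open>The image of \<open>lborel\<close> under L is translation invariant, because translation
  by \<open>a = L b\<close> comes from translation by b, and it is finite on balls, because L is
  bounded below. By uniqueness it is a multiple of \<open>lborel\<close>, and the unit ball
  determines the factor.\<close>

lemma lin_scale:
  fixes L :: "'a::euclidean_space \<Rightarrow> 'a"
  assumes L: "linear L" and inj: "inj L"
  shows lin_scale_pos: "lin_scale L > 0"
    and nn_integral_linear: "\<And>F. F \<in> borel_measurable borel \<Longrightarrow>
          (\<integral>\<^sup>+x. F (L x) \<partial>lborel) = ennreal (lin_scale L) * (\<integral>\<^sup>+x. F x \<partial>lborel)"
proof -
  have surj: "surj L" using L inj by (rule linear_inj_imp_surj)
  have cont: "continuous_on UNIV L" using L by (simp add: linear_continuous_on linear_conv_bounded_linear)
  have L_meas[measurable]: "L \<in> borel_measurable borel"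
    using cont by (rule borel_measurable_continuous_onI)
  obtain c where c: "c > 0" "\<And>x. norm x * c \<le> norm (L x)"
    using linear_inj_bounded_below_pos[OF L inj] by (metis mult.commute)
  have bdd: "bounded (L -` ball 0 r)" for r
  proof (rule boundedI)
    fix x assume "x \<in> L -` ball 0 r"
    then have "norm x * c < r" using c(2)[of x] by (simp add: less_le_trans le_less_trans)
    then show "norm x \<le> r / c" using c(1) by (simp add: field_simps)
  qed
  have meas: "L -` ball 0 r \<in> sets borel" for r
    using measurable_sets[OF L_meas, of "ball 0 r"] by simp
  have fin: "emeasure lborel (L -` ball 0 r) < \<infinity>" for r
    using bdd by (rule emeasure_bounded_finite)
  have "open (L -` ball 0 1)" using cont by (simp add: open_vimage)
  moreover have "0 \<in> L -` ball 0 1" using linear_0[OF L] by simp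
  ultimately obtain e where e: "e > 0" "ball 0 e \<subseteq> L -` ball 0 1" by (meson open_contains_ball)
  have "0 < measure lborel (ball (0::'a) e)" using e(1) by (rule measure_lborel_ball_pos)
  also have "\<dots> \<le> measure lborel (L -` ball 0 1)"
    by (rule measure_mono_fmeasurable) (use e meas fin in \<open>auto intro: fmeasurableI\<close>)
  finally have pos: "measure lborel (L -` ball 0 1) > 0" .
  then show "lin_scale L > 0" by (simp add: lin_scale_def measure_lborel_ball_pos del: content_ball)
  define \<nu> where "\<nu> = distr lborel borel L"
  have sets_nu[measurable_cong]: "sets \<nu> = sets borel" by (simp add: \<nu>_def)
  have space_nu: "space \<nu> = UNIV" by (simp add: \<nu>_def)
  have nu_ball: "emeasure \<nu> (ball 0 r) = emeasure lborel (L -` ball 0 r)" for r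
    by (simp add: \<nu>_def emeasure_distr)
  have sf: "sigma_finite_measure \<nu>"
  proof
    have "(\<Union>n. ball 0 (real n)) = (UNIV :: 'a set)"
      using reals_Archimedean2 by (auto simp: mem_ball)
    then show "\<exists>A. countable A \<and> A \<subseteq> sets \<nu> \<and> \<Union>A = space \<nu> \<and> (\<forall>a\<in>A. emeasure \<nu> a \<noteq> \<infinity>)"
      using fin by (intro exI[of _ "range (\<lambda>n. ball 0 (real n))"]) (auto simp: nu_ball less_top sets_nu space_nu)
  qed
  have inv: "(\<integral>\<^sup>+x. F (a + x) \<partial>\<nu>) = (\<integral>\<^sup>+x. F x \<partial>\<nu>)" if [measurable]: "F \<in> borel_measurable borel" for F a
  proof -
    obtain b where b: "a = L b" using surj by (metis surjD)
    have "(\<integral>\<^sup>+x. F (a + x) \<partial>\<nu>) = (\<integral>\<^sup>+x. F (L (b + x)) \<partial>lborel)"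
      by (simp add: \<nu>_def nn_integral_distr b linear_add[OF L])
    also have "\<dots> = (\<integral>\<^sup>+x. F (L x) \<partial>lborel)"
      by (rule nn_integral_lborel_shift) measurable
    finally show ?thesis by (simp add: \<nu>_def nn_integral_distr)
  qed
  have "\<nu> = density lborel (\<lambda>_. ennreal (lin_scale L))"
  proof (rule measure_eqI)
    fix A assume "A \<in> sets \<nu>"
    then have A[measurable]: "A \<in> sets borel" by (simp add: sets_nu)
    have 1: "emeasure lborel (ball (0::'a) 1) = ennreal (measure lborel (ball (0::'a) 1))"
      using emeasure_bounded_finite[of "ball (0::'a) 1"] by (simp add: emeasure_eq_ennreal_measure)
    have 2: "emeasure \<nu> (ball 0 1) = ennreal (measure lborel (L -` ball 0 1))"
      using fin[of 1] unfolding nu_ball by (simp add: emeasure_eq_ennreal_measure)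
    have "emeasure \<nu> A * emeasure lborel (ball (0::'a) 1) = emeasure \<nu> (ball 0 1) * emeasure lborel A"
      by (rule translation_invariant_measure_unique[OF sets_nu sf inv]) auto
    then have "emeasure \<nu> A * ennreal (measure lborel (ball (0::'a) 1)) / ennreal (measure lborel (ball (0::'a) 1))
       = ennreal (measure lborel (L -` ball 0 1)) * emeasure lborel A / ennreal (measure lborel (ball (0::'a) 1))"
      by (simp only: 1 2)
    moreover have "emeasure \<nu> A * ennreal v / ennreal v = emeasure \<nu> A" if "v > 0" for v
      using that by (simp add: ennreal_mult_divide_eq)
    moreover have "ennreal u * x / ennreal v = ennreal (u / v) * x" if "u > 0" "v > 0" for u v x
      using that by (simp add: divide_ennreal[symmetric] ennreal_divide_times ennreal_times_divide mult.commute)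
    ultimately have "emeasure \<nu> A = ennreal (lin_scale L) * emeasure lborel A"
      using pos measure_lborel_ball_pos[of 1 "0::'a"] by (simp add: lin_scale_def del: content_ball)
    then show "emeasure \<nu> A = emeasure (density lborel (\<lambda>_. ennreal (lin_scale L))) A"
      by (simp add: emeasure_density_const)
  qed (simp add: sets_nu)
  then show "(\<integral>\<^sup>+x. F (L x) \<partial>lborel) = ennreal (lin_scale L) * (\<integral>\<^sup>+x. F x \<partial>lborel)"
    if [measurable]: "F \<in> borel_measurable borel" for F
  proof -
    assume nu: "\<nu> = density lborel (\<lambda>_. ennreal (lin_scale L))"
    have "(\<integral>\<^sup>+x. F (L x) \<partial>lborel) = (\<integral>\<^sup>+x. F x \<partial>\<nu>)" by (simp add: \<nu>_def nn_integral_distr)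
    also have "\<dots> = ennreal (lin_scale L) * (\<integral>\<^sup>+x. F x \<partial>lborel)"
      by (simp add: nu nn_integral_density nn_integral_cmult)
    finally show ?thesis .
  qed
qed

lemma lin_scale_unique:
  fixes L :: "'a::euclidean_space \<Rightarrow> 'a"
  assumes "linear L" "c \<ge> 0"
    and "\<And>F. F \<in> borel_measurable borel \<Longrightarrow>
          (\<integral>\<^sup>+x. F (L x) \<partial>lborel) = ennreal c * (\<integral>\<^sup>+x. F x \<partial>lborel)"
  shows "lin_scale L = c"
proof -
  have [measurable]: "L \<in> borel_measurable borel"
    using assms(1) by (intro borel_measurable_continuous_onI) (simp add: linear_continuous_on linear_conv_bounded_linear)
  have "emeasure lborel (L -` ball 0 1) = (\<integral>\<^sup>+x. indicator (ball 0 1) (L x) \<partial>lborel)"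
  proof -
    have "(\<integral>\<^sup>+x. indicator (ball 0 1) (L x) \<partial>lborel) = (\<integral>\<^sup>+x. indicator (L -` ball 0 1) x \<partial>lborel)"
      by (rule nn_integral_cong) (simp add: indicator_def)
    moreover have "L -` ball 0 1 \<in> sets lborel"
      using measurable_sets[of L borel borel "ball 0 1"] by simp
    ultimately show ?thesis by simp
  qed
  also have "\<dots> = ennreal c * emeasure lborel (ball (0::'a) 1)"
    by (subst assms(3)[of "indicator (ball 0 1)"]) (auto intro: borel_measurable_indicator)
  finally have "measure lborel (L -` ball 0 1) = c * measure lborel (ball (0::'a) 1)"
    using assms(2) by (simp add: measure_def enn2real_mult del: content_ball)
  then show ?thesis
    using measure_lborel_ball_pos[of 1 "0::'a"] by (simp add: lin_scale_def del: content_ball)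
qed

lemma lin_scale_compose:
  fixes L M :: "'a::euclidean_space \<Rightarrow> 'a"
  assumes "linear L" "inj L" "linear M" "inj M"
  shows "lin_scale (L \<circ> M) = lin_scale L * lin_scale M"
proof (rule lin_scale_unique)
  show "linear (L \<circ> M)" using assms by (simp add: linear_compose)
  show "0 \<le> lin_scale L * lin_scale M"
    using lin_scale_pos[OF assms(1,2)] lin_scale_pos[OF assms(3,4)] by simp
  fix F :: "'a \<Rightarrow> ennreal" assume F[measurable]: "F \<in> borel_measurable borel"
  have [measurable]: "L \<in> borel_measurable borel"
    using assms(1) by (intro borel_measurable_continuous_onI) (simp add: linear_continuous_on linear_conv_bounded_linear)
  show "(\<integral>\<^sup>+x. F ((L \<circ> M) x) \<partial>lborel) = ennreal (lin_scale L * lin_scale M) * (\<integral>\<^sup>+x. F x \<partial>lborel)"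
    using nn_integral_linear[OF assms(3,4), of "\<lambda>x. F (L x)"] nn_integral_linear[OF assms(1,2) F]
      lin_scale_pos[OF assms(1,2)] lin_scale_pos[OF assms(3,4)]
    by (simp add: ennreal_mult mult_ac)
qed

lemma lin_scale_isometry:
  fixes L :: "'a::euclidean_space \<Rightarrow> 'a"
  assumes "\<And>x. norm (L x) = norm x"
  shows "lin_scale L = 1"
proof -
  have "L -` ball 0 1 = ball 0 1" using assms by auto
  then show ?thesis using measure_lborel_ball_pos[of 1 "0::'a"] by (simp add: lin_scale_def del: content_ball)
qed

subsection \<open>The kernel and the affine automorphisms of the domain\<close>

lemma T_B_iff: "z \<in> T_B \<longleftrightarrow> rho_diag z > 0"
  by (simp add: T_B_def rho_diag_def)

lemma rho_cnj: "cnj (rho z w) = rho w z"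
proof -
  have "(\<Sum>j\<in>UNIV - {last_ix}. (cnj (z $ j) - w $ j)\<^sup>2) = (\<Sum>j\<in>UNIV - {last_ix}. (w $ j - cnj (z $ j))\<^sup>2)"
    by (simp add: power2_commute)
  then show ?thesis by (simp add: rho_def complex_diff_cnj algebra_simps)
qed

lemma cmod_rho_commute: "cmod (rho z w) = cmod (rho w z)"
  by (metis complex_mod_cnj rho_cnj)

text \<open>The parallelogram identity for Im z and Im w turns Re rho into a sum of terms that are
  nonnegative on \<open>T_B\<close>. Both the bound of \<open>rho_diag\<close> by |rho| and the
  quasi-triangle inequality rest on this.\<close>

lemma Re_rho:
  fixes z w :: "('n::{finite,linorder}) cspace"
  shows "Re (rho z w) = 1/4 * ((\<Sum>j\<in>UNIV - {last_ix}. (cmod (z $ j - w $ j))\<^sup>2) + 2 * rho_diag z + 2 * rho_diag w)"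
proof -
  have "Re ((z $ j - cnj (w $ j))\<^sup>2)
      = (cmod (z $ j - w $ j))\<^sup>2 - 2 * (Im (z $ j))\<^sup>2 - 2 * (Im (w $ j))\<^sup>2" for j
    unfolding cmod_power2 by (simp add: power2_eq_square algebra_simps)
  then have "(\<Sum>j\<in>UNIV - {last_ix}. Re ((z $ j - cnj (w $ j))\<^sup>2))
      = (\<Sum>j\<in>UNIV - {last_ix}. (cmod (z $ j - w $ j))\<^sup>2)
        - 2 * (\<Sum>j\<in>UNIV - {last_ix}. (Im (z $ j))\<^sup>2) - 2 * (\<Sum>j\<in>UNIV - {last_ix}. (Im (w $ j))\<^sup>2)"
    by (simp only: sum_subtractf sum_distrib_left)
  then show ?thesis
    by (simp add: rho_def rho_diag_def)
qed

lemma rho_diag_le: "z \<in> T_B \<Longrightarrow> w \<in> T_B \<Longrightarrow> rho_diag z \<le> 2 * cmod (rho z w)"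
proof -
  assume "z \<in> T_B" "w \<in> T_B"
  then have "rho_diag z \<le> 2 * Re (rho z w)"
    using sum_nonneg[of "UNIV - {last_ix}" "\<lambda>j. (cmod (z $ j - w $ j))\<^sup>2"]
    by (simp add: Re_rho T_B_iff)
  then show ?thesis using complex_Re_le_cmod[of "rho z w"] by linarith
qed

lemma cmod_rho_pos: "z \<in> T_B \<Longrightarrow> w \<in> T_B \<Longrightarrow> cmod (rho z w) > 0"
  using Re_rho_pos[of z w] complex_Re_le_cmod[of "rho z w"] by linarith

text \<open>In each coordinate w - cnj u = A + B - C with A = w - cnj z, B = z - cnj u, C = z - cnj
  z, and (A + B - C)^2 = A^2 + B^2 - C^2 + 2 (A - C)(B - C). The last coordinate enters
  \<open>rho\<close> linearly and leaves no remainder.\<close>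

lemma rho_polarization:
  fixes z w u :: "('n::{finite,linorder}) cspace"
  shows "rho w u = rho w z + rho z u - rho z z
           + 1/2 * (\<Sum>j\<in>UNIV - {last_ix}. (w $ j - z $ j) * cnj (z $ j - u $ j))"
proof -
  have "(\<Sum>j\<in>UNIV - {last_ix}. (w $ j - cnj (u $ j))\<^sup>2)
      = (\<Sum>j\<in>UNIV - {last_ix}. (w $ j - cnj (z $ j))\<^sup>2) + (\<Sum>j\<in>UNIV - {last_ix}. (z $ j - cnj (u $ j))\<^sup>2)
        - (\<Sum>j\<in>UNIV - {last_ix}. (z $ j - cnj (z $ j))\<^sup>2)
        + 2 * (\<Sum>j\<in>UNIV - {last_ix}. (w $ j - z $ j) * cnj (z $ j - u $ j))"
    unfolding sum_distrib_left sum.distrib[symmetric] sum_subtractf[symmetric]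
    by (rule sum.cong) (simp_all add: power2_eq_square algebra_simps)
  then show ?thesis unfolding rho_def by algebra
qed

text \<open>By the arithmetic-geometric mean inequality and \<open>Re_rho\<close>, the mixed term of
  the polarization is at most |rho(w,z)| + |rho(z,u)|, and |rho(z,z)| <= 2 |rho(z,u)|. Adding up
  gives 1 + 1 = 2 and 1 + 2 + 1 = 4.\<close>

lemma rho_quasi_triangle:
  fixes z w u :: "('n::{finite,linorder}) cspace"
  assumes "z \<in> T_B" "w \<in> T_B" "u \<in> T_B"
  shows "cmod (rho w u) \<le> 2 * cmod (rho w z) + 4 * cmod (rho z u)"
proof -
  let ?S = "UNIV - {last_ix::'n}"
  have "cmod (1/2 * (\<Sum>j\<in>?S. (w $ j - z $ j) * cnj (z $ j - u $ j)))
      \<le> 1/2 * (\<Sum>j\<in>?S. cmod (w $ j - z $ j) * cmod (z $ j - u $ j))"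
    using norm_sum[of "\<lambda>j. (w $ j - z $ j) * cnj (z $ j - u $ j)" ?S]
    by (simp add: norm_mult del: complex_cnj_diff)
  also have "\<dots> \<le> 1/2 * (\<Sum>j\<in>?S. 1/2 * (cmod (w $ j - z $ j))\<^sup>2 + 1/2 * (cmod (z $ j - u $ j))\<^sup>2)"
  proof (intro mult_left_mono sum_mono)
    fix j
    show "cmod (w $ j - z $ j) * cmod (z $ j - u $ j)
        \<le> 1/2 * (cmod (w $ j - z $ j))\<^sup>2 + 1/2 * (cmod (z $ j - u $ j))\<^sup>2"
      using sum_squares_bound[of "cmod (w $ j - z $ j)" "cmod (z $ j - u $ j)"] by simp
  qed simp
  also have "\<dots> = 1/4 * (\<Sum>j\<in>?S. (cmod (w $ j - z $ j))\<^sup>2) + 1/4 * (\<Sum>j\<in>?S. (cmod (z $ j - u $ j))\<^sup>2)"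
    by (simp add: sum.distrib flip: sum_divide_distrib)
  also have "\<dots> \<le> Re (rho w z) + Re (rho z u)"
    using assms unfolding Re_rho T_B_iff by (intro add_mono mult_left_mono) auto
  also have "\<dots> \<le> cmod (rho w z) + cmod (rho z u)"
    by (intro add_mono complex_Re_le_cmod)
  finally have "cmod (1/2 * (\<Sum>j\<in>?S. (w $ j - z $ j) * cnj (z $ j - u $ j))) \<le> cmod (rho w z) + cmod (rho z u)" .
  moreover have "cmod (rho z z) \<le> 2 * cmod (rho z u)"
    using rho_diag_le[OF assms(1,3)] assms(1) by (simp add: rho_same T_B_iff)
  moreover have "cmod (a + b - c + d) \<le> cmod a + cmod b + cmod c + cmod d" for a b c d
    using norm_triangle_ineq[of "a + b - c" d] norm_triangle_ineq4[of "a + b" c] norm_triangle_ineq[of a b]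
    by linarith
  ultimately show ?thesis
    unfolding rho_polarization[of w u z] by (smt (verit))
qed

text \<open>The quotient |rho(z,w)|^2 / (rho(z) rho(w)) is symmetric, invariant under the
  automorphisms and equal to 1 for w = z; the bound 2 makes the set an open neighbourhood of z.
  Symmetry is what Fubini exploits in the Carleson embedding.\<close>

definition bergman_ball :: "('n::{finite,linorder}) cspace \<Rightarrow> 'n cspace set" where
  "bergman_ball z = {w \<in> T_B. (cmod (rho z w))\<^sup>2 < 2 * rho_diag z * rho_diag w}"

lemma bergman_ball_sym: "z \<in> T_B \<Longrightarrow> w \<in> bergman_ball z \<longleftrightarrow> w \<in> T_B \<and> z \<in> bergman_ball w"
  by (auto simp: bergman_ball_def cmod_rho_commute mult.commute mult.left_commute)

lemma bergman_ball_subset: "bergman_ball z \<subseteq> T_B"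
  by (auto simp: bergman_ball_def)

lemma center_in_bergman_ball: "z \<in> T_B \<Longrightarrow> z \<in> bergman_ball z"
  by (simp add: bergman_ball_def rho_same T_B_iff power2_eq_square)

text \<open>Squaring rho(w) <= 2 |rho(w,z)| and inserting the definition of the ball gives rho(w)^2
  <= 8 rho(z) rho(w).\<close>

lemma bergman_ball_rho_diag_le:
  assumes "z \<in> T_B" "w \<in> bergman_ball z"
  shows "rho_diag w \<le> 8 * rho_diag z"
proof -
  have w: "w \<in> T_B" "(cmod (rho z w))\<^sup>2 < 2 * rho_diag z * rho_diag w"
    using assms by (auto simp: bergman_ball_def)
  have pos: "rho_diag z > 0" "rho_diag w > 0" using assms w by (auto simp: T_B_iff)
  have "rho_diag w \<le> 2 * cmod (rho z w)"
    using rho_diag_le[OF w(1) assms(1)] by (simp add: cmod_rho_commute)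
  then have "(rho_diag w)\<^sup>2 \<le> (2 * cmod (rho z w))\<^sup>2" using pos by (intro power_mono) auto
  also have "\<dots> \<le> 4 * (2 * rho_diag z * rho_diag w)" using w(2) by (simp add: power_mult_distrib mult_ac)
  finally have "rho_diag w * rho_diag w \<le> 8 * rho_diag z * rho_diag w" by (simp add: power2_eq_square)
  then show ?thesis using pos by simp
qed

lemma bergman_ball_rho_diag_ge:
  assumes "z \<in> T_B" "w \<in> bergman_ball z"
  shows "rho_diag z \<le> 8 * rho_diag w"
  using assms bergman_ball_rho_diag_le[of w z] bergman_ball_sym[of z w] by blast

text \<open>On the ball |rho(w,z)| <= 4 rho(z) <= 8 |rho(z,u)|, so the quasi-triangle inequality
  yields 2 * 8 + 4 = 20.\<close>

lemma bergman_ball_rho_le: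
  assumes "z \<in> T_B" "w \<in> bergman_ball z" "u \<in> T_B"
  shows "cmod (rho w u) \<le> 20 * cmod (rho z u)"
proof -
  have w: "w \<in> T_B" "(cmod (rho z w))\<^sup>2 < 2 * rho_diag z * rho_diag w"
    using assms by (auto simp: bergman_ball_def)
  have pos: "rho_diag z > 0" using assms by (auto simp: T_B_iff)
  have "2 * rho_diag z * rho_diag w \<le> 2 * rho_diag z * (8 * rho_diag z)"
    using bergman_ball_rho_diag_le[OF assms(1,2)] pos by (intro mult_left_mono) auto
  with w(2) have "(cmod (rho z w))\<^sup>2 \<le> 2 * rho_diag z * (8 * rho_diag z)" by linarith
  also have "\<dots> = (4 * rho_diag z)\<^sup>2" by (simp add: power2_eq_square)
  finally have "cmod (rho z w) \<le> 4 * rho_diag z" using pos by - (rule power2_le_imp_le, auto)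
  then have "cmod (rho w z) \<le> 4 * rho_diag z" by (metis cmod_rho_commute)
  then show ?thesis
    using rho_quasi_triangle[OF assms(1) w(1) assms(3)] rho_diag_le[OF assms(1,3)] by linarith
qed

lemma continuous_on_rho_diag [continuous_intros]: "continuous_on S rho_diag"
  unfolding rho_diag_def by (intro continuous_intros)

lemma continuous_on_rho [continuous_intros]:
  "continuous_on S f \<Longrightarrow> continuous_on S g \<Longrightarrow> continuous_on S (\<lambda>x. rho (f x) (g x))"
  unfolding rho_def by (intro continuous_intros)

lemma open_T_B: "open (T_B :: ('n::{finite,linorder}) cspace set)"
proof -
  have "T_B = {z :: 'n cspace. 0 < rho_diag z}" by (auto simp: T_B_iff)
  moreover have "open {z :: 'n cspace. 0 < rho_diag z}"
    by (rule open_Collect_less[OF continuous_on_const continuous_on_rho_diag])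
  ultimately show ?thesis by simp
qed

lemma open_bergman_ball: "open (bergman_ball z)"
proof -
  have "bergman_ball z = T_B \<inter> {w. (cmod (rho z w))\<^sup>2 < 2 * rho_diag z * rho_diag w}"
    by (auto simp: bergman_ball_def)
  then show ?thesis by (auto intro!: open_Int open_T_B open_Collect_less continuous_intros)
qed

section \<open>Affine automorphisms: dilations, shears and their Jacobians\<close>

lemma base_pt_nth: "base_pt $ last_ix = \<i>" "j \<noteq> last_ix \<Longrightarrow> base_pt $ j = 0"
  by (simp_all add: base_pt_def)

lemma rho_diag_base_pt [simp]: "rho_diag (base_pt :: ('n::{finite,linorder}) cspace) = 1"
  by (simp add: rho_diag_def base_pt_nth)

lemma base_pt_in_T_B [simp]: "base_pt \<in> T_B"
  by (simp add: T_B_iff)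

text \<open>A nonisotropic dilation, by d in z' and by d^2 in the last coordinate, followed by the
  shear that compensates a shift of Im z' by b. The map is linear over the complex numbers, so
  composition with it preserves holomorphy.\<close>

definition glin :: "real \<Rightarrow> ('n::{finite,linorder} \<Rightarrow> real) \<Rightarrow> 'n cspace \<Rightarrow> 'n cspace" where
  "glin d b v = (\<chi> j. if j = last_ix
      then of_real (d\<^sup>2) * v $ j + 2 * of_real d * (\<Sum>k\<in>UNIV - {last_ix}. of_real (b k) * v $ k)
      else of_real d * v $ j)"

lemma glin_nth:
  "glin d b v $ last_ix = of_real (d\<^sup>2) * v $ last_ix + 2 * of_real d * (\<Sum>k\<in>UNIV - {last_ix}. of_real (b k) * v $ k)"
  "j \<noteq> last_ix \<Longrightarrow> glin d b v $ j = of_real d * v $ j"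
  by (simp_all add: glin_def)

lemma glin_add: "glin d b (v + w) = glin d b v + glin d b w"
  by (vector glin_def sum.distrib algebra_simps)

lemma glin_cmult: "glin d b (c *s v) = c *s glin d b v"
  by (vector glin_def sum_distrib_left algebra_simps)

lemma scaleR_eq_of_real_vec: "r *\<^sub>R (v :: complex ^ 'n) = of_real r *s v"
  by (simp only: vec_eq_iff vector_scaleR_component vector_smult_component) (simp add: scaleR_conv_of_real)

lemma linear_glin: "linear (glin d b)"
  by (rule linearI) (simp_all add: glin_add glin_cmult scaleR_eq_of_real_vec)

lemma glin_0 [simp]: "glin d b 0 = 0"
  by (rule linear_0[OF linear_glin])

lemma continuous_on_glin [continuous_intros]: "continuous_on S f \<Longrightarrow> continuous_on S (\<lambda>x. glin d b (f x))"
  using linear_glin[of d b] unfolding linear_conv_bounded_linear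
  by (intro continuous_on_compose2[OF linear_continuous_on[of "glin d b" UNIV]]) auto

lemma borel_measurable_glin [measurable]: "glin d b \<in> borel_measurable borel"
  by (intro borel_measurable_continuous_onI continuous_on_glin continuous_on_id)

lemma inj_glin:
  assumes "d \<noteq> 0" shows "inj (glin d b)"
proof -
  have "v = 0" if v: "glin d b v = 0" for v
  proof -
    have 1: "v $ j = 0" if "j \<noteq> last_ix" for j
      using v assms that by (metis glin_nth(2) mult_eq_0_iff of_real_eq_0_iff zero_index)
    then have "glin d b v $ last_ix = of_real (d\<^sup>2) * v $ last_ix" by (simp add: glin_nth)
    then have "v $ last_ix = 0" using v assms by simp
    then show ?thesis using 1 by (metis vec_eq_iff zero_index)
  qed
  then show ?thesis unfolding linear_injective_0[OF linear_glin] by blast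
qed

text \<open>In the real standard basis the map is diagonal. The two basis vectors in
  \<open>?S\<close>, which span the last complex coordinate, are scaled by d^2 and the other 2n - 2
  by d, so the determinant is d^(2n + 2).\<close>

lemma lin_scale_glin_dilation:
  fixes d :: real
  assumes d: "d > 0"
  shows "lin_scale (glin d (\<lambda>_. 0) :: ('n::{finite,linorder}) cspace \<Rightarrow> 'n cspace) = 1 / d ^ (2 * CARD('n) + 2)"
proof (rule lin_scale_unique)
  let ?D = "glin d (\<lambda>_. 0) :: 'n cspace \<Rightarrow> 'n cspace"
  let ?S = "{axis last_ix 1, axis last_ix \<i>} :: 'n cspace set"
  define c :: "'n cspace \<Rightarrow> real" where "c j = d * (if j \<in> ?S then d else 1)" for j
  have S: "?S \<subseteq> Basis" by (auto simp: axis_in_Basis_iff Basis_complex_def)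
  have S2: "card ?S = 2" by (simp add: axis_eq_axis)
  have "(\<Prod>j\<in>Basis. c j) = d ^ DIM('n cspace) * (\<Prod>j\<in>Basis. if j \<in> ?S then d else 1)"
    by (simp add: c_def prod.distrib)
  also have "(\<Prod>j\<in>Basis. if j \<in> ?S then d else 1) = (\<Prod>j\<in>Basis \<inter> ?S. d)"
    by (rule prod.inter_restrict[symmetric]) simp
  also have "Basis \<inter> ?S = ?S" using S by blast
  also have "(\<Prod>j\<in>?S. d) = d ^ 2" using S2 by (simp only: prod_constant)
  finally have prod: "(\<Prod>j\<in>Basis. c j) = d ^ (2 * CARD('n) + 2)"
    by (simp add: power_add mult_ac power2_eq_square)
  have cpos: "c j > 0" for j using d by (simp add: c_def)
  have D: "(\<Sum>j\<in>Basis. (c j * (x \<bullet> j)) *\<^sub>R j) = ?D x" for x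
  proof (rule euclidean_eqI)
    fix e :: "'n cspace" assume e: "e \<in> Basis"
    then obtain i u where iu: "e = axis i u" "u \<in> Basis" by (auto simp: Basis_vec_def)
    have "(\<Sum>j\<in>Basis. (c j * (x \<bullet> j)) *\<^sub>R j) \<bullet> e = c e * (x \<bullet> e)"
      using e by simp
    also have "\<dots> = ?D x \<bullet> e"
    proof (cases "i = last_ix")
      case True
      then have "e \<in> ?S" using iu by (auto simp: Basis_complex_def)
      then have "c e = d\<^sup>2" by (simp add: c_def power2_eq_square)
      moreover have "?D x \<bullet> e = (of_real (d\<^sup>2) * x $ i) \<bullet> u"
        using True by (simp add: iu inner_axis glin_nth)
      moreover have "(of_real (d\<^sup>2) * x $ i) \<bullet> u = d\<^sup>2 * (x $ i \<bullet> u)"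
        by (metis inner_scaleR_left scaleR_conv_of_real)
      ultimately show ?thesis by (simp add: iu inner_axis)
    next
      case False
      then have "e \<notin> ?S" using iu by (auto simp: axis_eq_axis)
      then have "c e = d" by (simp add: c_def)
      moreover have "?D x \<bullet> e = (of_real d * x $ i) \<bullet> u"
        using False by (simp add: iu inner_axis glin_nth)
      moreover have "(of_real d * x $ i) \<bullet> u = d * (x $ i \<bullet> u)"
        by (metis inner_scaleR_left scaleR_conv_of_real)
      ultimately show ?thesis by (simp add: iu inner_axis)
    qed
    finally show "(\<Sum>j\<in>Basis. (c j * (x \<bullet> j)) *\<^sub>R j) \<bullet> e = ?D x \<bullet> e" .
  qed
  have "lborel = density (distr lborel borel (\<lambda>x. 0 + (\<Sum>j\<in>Basis. (c j * (x \<bullet> j)) *\<^sub>R j))) (\<lambda>_. (\<Prod>j\<in>Basis. \<bar>c j\<bar>))"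
    by (rule lborel_affine_euclidean) (use cpos in \<open>auto simp: less_le\<close>)
  then have lb: "lborel = density (distr lborel borel ?D) (\<lambda>_. ennreal (d ^ (2 * CARD('n) + 2)))"
    using cpos by (simp only: D prod abs_of_pos add_0_left)
  show "linear ?D" by (rule linear_glin)
  show "0 \<le> 1 / d ^ (2 * CARD('n) + 2)" using d by simp
  fix F :: "'n cspace \<Rightarrow> ennreal" assume F[measurable]: "F \<in> borel_measurable borel"
  have "(\<integral>\<^sup>+x. F x \<partial>lborel) = ennreal (d ^ (2 * CARD('n) + 2)) * (\<integral>\<^sup>+x. F (?D x) \<partial>lborel)"
    by (subst lb) (simp add: nn_integral_density nn_integral_distr nn_integral_cmult)
  then have "ennreal (1 / d ^ (2 * CARD('n) + 2)) * (\<integral>\<^sup>+x. F x \<partial>lborel)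
      = ennreal (1 / d ^ (2 * CARD('n) + 2) * d ^ (2 * CARD('n) + 2)) * (\<integral>\<^sup>+x. F (?D x) \<partial>lborel)"
    using d by (subst ennreal_mult) (auto simp: mult.assoc)
  then show "(\<integral>\<^sup>+x. F (?D x) \<partial>lborel) = ennreal (1 / d ^ (2 * CARD('n) + 2)) * (\<integral>\<^sup>+x. F x \<partial>lborel)"
    using d by simp
qed

text \<open>A shear is conjugate to its inverse by the isometry \<open>(v', v\<^sub>n) \<mapsto> (- v', v\<^sub>n)\<close>, so its Jacobian \<open>c\<close>
  satisfies \<open>c\<^sup>2 = 1\<close>.\<close>

lemma lin_scale_glin_shear:
  "lin_scale (glin 1 b :: ('n::{finite,linorder}) cspace \<Rightarrow> 'n cspace) = 1"
proof -
  define R :: "'n cspace \<Rightarrow> 'n cspace" where "R v = (\<chi> j. if j = last_ix then v $ j else - v $ j)" for v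
  let ?S = "glin 1 b :: 'n cspace \<Rightarrow> 'n cspace" and ?S' = "glin 1 (\<lambda>k. - b k) :: 'n cspace \<Rightarrow> 'n cspace"
  have R_lin: "linear R" by (rule linearI) (simp_all add: R_def vec_eq_iff)
  have R_iso: "norm (R v) = norm v" for v
    unfolding norm_vec_def by (rule arg_cong[where f="\<lambda>f. L2_set f UNIV"]) (auto simp: R_def fun_eq_iff)
  have R_inj: "inj R"
    using R_iso by (metis R_lin linear_injective_0 norm_eq_zero)
  have conj: "?S' = R \<circ> ?S \<circ> R"
    by (auto simp: fun_eq_iff vec_eq_iff R_def glin_def sum_negf)
  have inv: "?S \<circ> ?S' = id"
    by (auto simp: fun_eq_iff vec_eq_iff glin_def sum_negf)
  have inj: "inj ?S" "inj ?S'" by (simp_all add: inj_glin)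
  have "lin_scale ?S' = lin_scale ?S"
    unfolding conj using R_lin R_inj inj linear_glin lin_scale_isometry[OF R_iso]
    by (subst lin_scale_compose, auto intro: linear_compose inj_compose)+
  moreover have "lin_scale ?S * lin_scale ?S' = 1"
    using lin_scale_compose[OF linear_glin inj(1) linear_glin inj(2)] lin_scale_isometry[of "id :: 'n cspace \<Rightarrow> _"]
    by (simp add: inv)
  ultimately show ?thesis
    using lin_scale_pos[OF linear_glin inj(1)] by (simp add: power2_eq_1_iff flip: power2_eq_square)
qed

lemma lin_scale_glin:
  assumes d: "d > 0"
  shows "lin_scale (glin d b :: ('n::{finite,linorder}) cspace \<Rightarrow> 'n cspace) = 1 / d ^ (2 * CARD('n) + 2)"
proof -
  have "(glin d b :: 'n cspace \<Rightarrow> 'n cspace) = glin 1 b \<circ> glin d (\<lambda>_. 0)"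
    by (auto simp: fun_eq_iff vec_eq_iff glin_def sum_distrib_left intro!: sum.cong)
  then show ?thesis
    using d by (simp add: lin_scale_compose linear_glin inj_glin lin_scale_glin_shear lin_scale_glin_dilation)
qed

text \<open>The automorphism that carries \<open>base_pt\<close> to a. The factor
  \<open>sqrt (rho_diag a)\<close> is forced: a dilation by d multiplies \<open>rho_diag\<close> by
  d^2, and \<open>rho_diag base_pt = 1\<close>.\<close>

definition aut :: "('n::{finite,linorder}) cspace \<Rightarrow> 'n cspace \<Rightarrow> 'n cspace" where
  "aut a z = a + glin (sqrt (rho_diag a)) (\<lambda>k. Im (a $ k)) (z - base_pt)"

lemma aut_base_pt [simp]: "aut a base_pt = a"
  by (simp add: aut_def)

text \<open>The shift turns D_j = z_j - cnj w_j into 2 i b_j + d D_j. The cross terms 4 i d b_j D_j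
  of the squares cancel against the shear in the last coordinate, and the constants cancel because
  d^2 = rho(a).\<close>

lemma rho_aut:
  fixes a z w :: "('n::{finite,linorder}) cspace"
  assumes a: "a \<in> T_B"
  shows "rho (aut a z) (aut a w) = of_real (rho_diag a) * rho z w"
proof -
  define d where "d = sqrt (rho_diag a)"
  have d2: "d\<^sup>2 = rho_diag a" using a by (simp add: d_def T_B_iff)
  let ?S = "UNIV - {last_ix::'n}"
  define b where "b j = complex_of_real (Im (a $ j))" for j
  define D where "D j = z $ j - cnj (w $ j)" for j
  have ab: "a $ j = cnj (a $ j) + 2 * \<i> * b j" for j by (simp add: b_def complex_eq_iff)
  have 1: "aut a z $ j - cnj (aut a w $ j) = 2 * \<i> * b j + of_real d * D j" if "j \<in> ?S" for j
    using that ab[of j] by (simp add: aut_def glin_nth base_pt_nth D_def d_def algebra_simps)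
  have 2: "aut a z $ last_ix - cnj (aut a w $ last_ix)
      = 2 * \<i> * b last_ix + of_real (d\<^sup>2) * (D last_ix - 2 * \<i>) + 2 * of_real d * (\<Sum>k\<in>?S. b k * D k)"
  proof -
    have "(\<Sum>k\<in>?S. b k * D k) = (\<Sum>k\<in>?S. b k * z $ k) - (\<Sum>k\<in>?S. b k * cnj (w $ k))"
      by (simp add: D_def sum_subtractf algebra_simps)
    then show ?thesis
      using ab[of last_ix]
      by (simp add: aut_def glin_nth base_pt_nth D_def flip: d_def b_def)
         (simp add: b_def algebra_simps)
  qed
  have 3: "(\<Sum>j\<in>?S. (2 * \<i> * b j + of_real d * D j)\<^sup>2)
      = - 4 * (\<Sum>j\<in>?S. (b j)\<^sup>2) + 4 * \<i> * of_real d * (\<Sum>j\<in>?S. b j * D j) + of_real (d\<^sup>2) * (\<Sum>j\<in>?S. (D j)\<^sup>2)"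
    unfolding sum_distrib_left sum.distrib[symmetric]
    by (rule sum.cong) (simp_all add: power2_eq_square algebra_simps)
  have 4: "b last_ix - (\<Sum>j\<in>?S. (b j)\<^sup>2) = of_real (d\<^sup>2)"
    by (simp add: d2 rho_diag_def b_def)
  have "4 * rho (aut a z) (aut a w) = (\<Sum>j\<in>?S. (2 * \<i> * b j + of_real d * D j)\<^sup>2)
      - 2 * \<i> * (2 * \<i> * b last_ix + of_real (d\<^sup>2) * (D last_ix - 2 * \<i>) + 2 * of_real d * (\<Sum>k\<in>?S. b k * D k))"
    unfolding rho_def 2[symmetric] using 1 by simp
  also have "\<dots> = 4 * (b last_ix - (\<Sum>j\<in>?S. (b j)\<^sup>2) - of_real (d\<^sup>2))
      + of_real (d\<^sup>2) * ((\<Sum>j\<in>?S. (D j)\<^sup>2) - 2 * \<i> * D last_ix)"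
    unfolding 3 by (simp add: algebra_simps)
  also have "\<dots> = 4 * (of_real (rho_diag a) * rho z w)"
    unfolding 4 by (simp add: rho_def D_def d2)
  finally show ?thesis by simp
qed

lemma rho_diag_aut: "a \<in> T_B \<Longrightarrow> rho_diag (aut a z) = rho_diag a * rho_diag z"
  using rho_aut[of a z z] by (simp add: rho_same flip: of_real_mult)

lemma aut_in_T_B: "a \<in> T_B \<Longrightarrow> aut a z \<in> T_B \<longleftrightarrow> z \<in> T_B"
  by (simp add: T_B_iff rho_diag_aut zero_less_mult_iff)

lemma cmod_rho_aut: "a \<in> T_B \<Longrightarrow> cmod (rho (aut a z) (aut a w)) = rho_diag a * cmod (rho z w)"
  by (simp add: rho_aut norm_mult T_B_iff)

lemma aut_in_bergman_ball:
  assumes "a \<in> T_B" shows "aut a w \<in> bergman_ball (aut a z) \<longleftrightarrow> w \<in> bergman_ball z"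
proof -
  have "(rho_diag a * cmod (rho z w))\<^sup>2 < 2 * (rho_diag a * rho_diag z) * (rho_diag a * rho_diag w)
     \<longleftrightarrow> (rho_diag a)\<^sup>2 * (cmod (rho z w))\<^sup>2 < (rho_diag a)\<^sup>2 * (2 * rho_diag z * rho_diag w)"
    by (simp add: power2_eq_square mult_ac)
  also have "\<dots> \<longleftrightarrow> (cmod (rho z w))\<^sup>2 < 2 * rho_diag z * rho_diag w"
    using assms by (simp add: T_B_iff mult.assoc)
  finally show ?thesis
    using assms by (simp add: bergman_ball_def aut_in_T_B cmod_rho_aut rho_diag_aut)
qed

lemma continuous_on_aut: "continuous_on S (aut a)"
  unfolding aut_def by (intro continuous_intros)

lemma nn_integral_aut:
  fixes F :: "('n::{finite,linorder}) cspace \<Rightarrow> ennreal"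
  assumes [measurable]: "F \<in> borel_measurable borel" and a: "a \<in> T_B"
  shows "(\<integral>\<^sup>+z. F (aut a z) \<partial>lborel) = ennreal (rho_diag a powr - (real CARD('n) + 1)) * (\<integral>\<^sup>+z. F z \<partial>lborel)"
proof -
  define d where "d = sqrt (rho_diag a)"
  have d: "d > 0" "d\<^sup>2 = rho_diag a" using a by (simp_all add: d_def T_B_iff)
  let ?L = "glin d (\<lambda>k. Im (a $ k)) :: 'n cspace \<Rightarrow> _"
  have "(\<integral>\<^sup>+z. F (aut a z) \<partial>lborel) = (\<integral>\<^sup>+z. F (a + ?L (- base_pt + z)) \<partial>lborel)"
    by (simp add: aut_def d_def)
  also have "\<dots> = (\<integral>\<^sup>+z. F (a + ?L z) \<partial>lborel)"
    by (rule nn_integral_lborel_shift) measurable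
  also have "\<dots> = ennreal (lin_scale ?L) * (\<integral>\<^sup>+z. F (a + z) \<partial>lborel)"
    using d by (intro nn_integral_linear linear_glin inj_glin) auto
  also have "(\<integral>\<^sup>+z. F (a + z) \<partial>lborel) = (\<integral>\<^sup>+z. F z \<partial>lborel)"
    by (rule nn_integral_lborel_shift) measurable
  also have "lin_scale ?L = rho_diag a powr - (real CARD('n) + 1)"
  proof -
    have "d ^ (2 * CARD('n) + 2) = (d\<^sup>2) ^ (CARD('n) + 1)"
      unfolding power_mult[symmetric] by simp
    also have "\<dots> = rho_diag a powr (real CARD('n) + 1)"
      using powr_realpow[of "rho_diag a" "CARD('n) + 1"] d a by (simp add: T_B_iff add.commute del: power_Suc)
    finally have e: "d ^ (2 * CARD('n) + 2) = rho_diag a powr (real CARD('n) + 1)" .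
    show ?thesis unfolding lin_scale_glin[OF d(1)] e powr_minus_divide by (rule refl)
  qed
  finally show ?thesis .
qed

subsection \<open>Borel measures on the domain and the Forelli--Rudin integral\<close>

text \<open>Both \<mu> and the volume are handled on the Borel sets of the domain, where kernels are
  jointly measurable and Fubini applies. \<open>nn_integral_dV\<close> provides the passage to the
  completed measure used in the norms.\<close>

definition TB_space :: "('n::{finite,linorder}) cspace measure" where
  "TB_space = restrict_space borel T_B"

definition vol_TB :: "('n::{finite,linorder}) cspace measure" where
  "vol_TB = restrict_space lborel T_B"

lemma space_TB_space: "space TB_space = T_B"
  by (simp add: TB_space_def space_restrict_space)

lemma space_eq_T_B: "sets \<mu> = sets TB_space \<Longrightarrow> space \<mu> = T_B"
  using sets_eq_imp_space_eq[of \<mu> TB_space] by (simp add: space_TB_space)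

lemma sets_vol_TB [measurable_cong]: "sets vol_TB = sets TB_space"
  by (simp add: TB_space_def vol_TB_def sets_restrict_space)

lemma space_vol_TB: "space vol_TB = T_B"
  by (simp add: vol_TB_def space_restrict_space)

lemma borel_T_B [measurable]: "T_B \<in> sets borel"
  by (simp add: open_T_B)

lemma sigma_finite_vol_TB: "sigma_finite_measure vol_TB"
  unfolding vol_TB_def by (rule sigma_finite_measure_restrict_space) (simp_all add: sigma_finite_lborel)

lemma nn_integral_vol_TB: "(\<integral>\<^sup>+z. F z \<partial>vol_TB) = (\<integral>\<^sup>+z. F z * indicator T_B z \<partial>lborel)"
  unfolding vol_TB_def by (rule nn_integral_restrict_space) simp

lemma measurable_TB_space_borel: "f \<in> M \<rightarrow>\<^sub>M TB_space \<Longrightarrow> f \<in> M \<rightarrow>\<^sub>M borel"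
  by (simp add: TB_space_def measurable_restrict_space2_iff)

lemma measurable_continuous_TB_space: "continuous_on T_B f \<Longrightarrow> f \<in> borel_measurable TB_space"
  unfolding TB_space_def by (rule borel_measurable_continuous_on_restrict)

lemma measurable_rho_diag [measurable (raw)]:
  assumes "f \<in> M \<rightarrow>\<^sub>M TB_space" shows "(\<lambda>x. rho_diag (f x)) \<in> borel_measurable M"
  using measurable_TB_space_borel[OF assms] borel_measurable_continuous_onI[OF continuous_on_rho_diag]
  by (rule measurable_compose)

lemma measurable_rho [measurable (raw)]:
  assumes "f \<in> M \<rightarrow>\<^sub>M TB_space" "g \<in> M \<rightarrow>\<^sub>M TB_space"
  shows "(\<lambda>x. rho (f x) (g x)) \<in> borel_measurable M"
  using measurable_TB_space_borel[OF assms(1)] measurable_TB_space_borel[OF assms(2)]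
  by (rule borel_measurable_continuous_Pair) (intro continuous_intros)

lemma measurable_rho_right [measurable (raw)]:
  assumes "g \<in> M \<rightarrow>\<^sub>M TB_space" shows "(\<lambda>x. rho z (g x)) \<in> borel_measurable M"
  using borel_measurable_const measurable_TB_space_borel[OF assms]
  by (rule borel_measurable_continuous_Pair) (intro continuous_intros)

lemma measurable_rho_left [measurable (raw)]:
  assumes "g \<in> M \<rightarrow>\<^sub>M TB_space" shows "(\<lambda>x. rho (g x) z) \<in> borel_measurable M"
  using measurable_TB_space_borel[OF assms] borel_measurable_const
  by (rule borel_measurable_continuous_Pair) (intro continuous_intros)

lemma measurable_bergman_ball [measurable (raw)]:
  assumes [measurable]: "f \<in> M \<rightarrow>\<^sub>M TB_space" "g \<in> M \<rightarrow>\<^sub>M TB_space"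
  shows "Measurable.pred M (\<lambda>x. g x \<in> bergman_ball (f x))"
proof -
  have "Measurable.pred M (\<lambda>x. (cmod (rho (f x) (g x)))\<^sup>2 < 2 * rho_diag (f x) * rho_diag (g x))"
    by measurable
  also have "?this \<longleftrightarrow> ?thesis"
    using measurable_space[OF assms(2)]
    by (intro measurable_cong) (auto simp: bergman_ball_def space_TB_space)
  finally show ?thesis .
qed

lemma bergman_ball_sets [measurable]: "bergman_ball z \<in> sets TB_space"
  using open_bergman_ball[of z] bergman_ball_subset[of z]
  by (auto simp: TB_space_def sets_restrict_space)

lemma measurable_aut [measurable]:
  assumes "a \<in> T_B" shows "aut a \<in> TB_space \<rightarrow>\<^sub>M TB_space"
  unfolding TB_space_def using assms
  by (intro measurable_restrict_space3 borel_measurable_continuous_onI continuous_on_aut) (simp add: aut_in_T_B)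

lemma nn_integral_vol_TB_aut:
  fixes F :: "('n::{finite,linorder}) cspace \<Rightarrow> ennreal"
  assumes [measurable]: "F \<in> borel_measurable TB_space" and a: "a \<in> T_B"
  shows "(\<integral>\<^sup>+z. F z \<partial>vol_TB) = ennreal (rho_diag a powr (real CARD('n) + 1)) * (\<integral>\<^sup>+z. F (aut a z) \<partial>vol_TB)"
proof -
  define G where "G = (\<lambda>z. F z * indicator T_B z)"
  have G[measurable]: "G \<in> borel_measurable borel"
    using assms(1) unfolding G_def TB_space_def by (subst (asm) borel_measurable_restrict_space_iff_ennreal) auto
  have pos: "rho_diag a > 0" using a by (simp add: T_B_iff)
  have "(\<integral>\<^sup>+z. F (aut a z) \<partial>vol_TB) = (\<integral>\<^sup>+z. G (aut a z) \<partial>lborel)"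
    unfolding nn_integral_vol_TB using a
    by (intro nn_integral_cong) (simp add: G_def aut_in_T_B indicator_def)
  also have "\<dots> = ennreal (rho_diag a powr - (real CARD('n) + 1)) * (\<integral>\<^sup>+z. F z \<partial>vol_TB)"
    unfolding nn_integral_aut[OF G a] by (simp add: nn_integral_vol_TB G_def)
  finally show ?thesis
    using pos by (simp add: mult.assoc[symmetric] ennreal_mult[symmetric] powr_add[symmetric])
qed

section \<open>Local integrability of powers of \<open>rho_diag\<close> and the Forelli--Rudin
  estimate\<close>

lemma continuous_bounded_on_cball:
  fixes f :: "'a::euclidean_space \<Rightarrow> real"
  assumes "continuous_on UNIV f"
  obtains M where "M > 0" "\<And>x. norm x \<le> R \<Longrightarrow> \<bar>f x\<bar> \<le> M"
proof -
  have "compact (f ` cball 0 R)"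
    by (rule compact_continuous_image) (use assms continuous_on_subset in \<open>auto intro: continuous_on_subset\<close>)
  then obtain M where "M > 0" "\<forall>y\<in>f ` cball 0 R. norm y \<le> M"
    using compact_imp_bounded bounded_pos by metis
  then show ?thesis using that by auto
qed

text \<open>Averaging over the translations \<open>w \<mapsto> w + i t e\<^sub>n\<close>, which shift \<open>\<rho>\<close> by \<open>t\<close>, reduces the claim to the
  convergence of \<open>\<integral>\<^sub>0\<^sup>M u\<^sup>\<alpha> du\<close>.\<close>

lemma nn_integral_rho_diag_bounded:
  fixes R \<alpha> :: real
  assumes \<alpha>: "\<alpha> > -1"
  shows "(\<integral>\<^sup>+w. ennreal (rho_diag w powr \<alpha>) * indicator (ball 0 R) w \<partial>(vol_TB :: ('n::{finite,linorder}) cspace measure)) < \<infinity>"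
proof -
  define e :: "'n cspace" where "e = axis last_ix \<i>"
  have rho_e: "rho_diag (w + t *\<^sub>R e) = rho_diag w + t" for w t
    by (simp add: rho_diag_def e_def axis_def)
  have norm_e: "norm e = 1" by (simp add: e_def)
  obtain M where M: "M > 0" "\<And>x :: 'n cspace. norm x \<le> R \<Longrightarrow> \<bar>rho_diag x\<bar> \<le> M"
    using continuous_bounded_on_cball[OF continuous_on_rho_diag, of R] by blast
  \<comment> \<open>Cutting off at M loses nothing, since M bounds \<open>rho_diag\<close> on the
    ball; the condition \<alpha> > -1 is what makes this one-variable integral finite.\<close>
  define p where "p u = ennreal (u powr \<alpha>) * indicator {0<..M} u" for u :: real
  have [measurable]: "p \<in> borel_measurable borel" unfolding p_def by measurable
  note measurable_rho_diag [measurable del]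
  have [measurable]: "ball (0 :: 'n cspace) r \<in> sets borel" for r by simp
  have [measurable]: "(rho_diag :: 'n cspace \<Rightarrow> real) \<in> borel_measurable borel"
    by (rule borel_measurable_continuous_onI[OF continuous_on_rho_diag])
  have "(\<integral>\<^sup>+u. p u \<partial>lborel) \<le> (\<integral>\<^sup>+u. ennreal (u powr \<alpha>) * indicator {0..M} u \<partial>lborel)"
    by (rule nn_integral_mono) (auto simp: p_def indicator_def)
  also have "\<dots> = ennreal (M powr (\<alpha>+1) / (\<alpha>+1))"
    by (rule nn_integral_has_integral_lebesgue') (use \<alpha> M in \<open>auto intro: has_integral_powr_from_0\<close>)
  also have "\<dots> < \<infinity>" by simp
  finally have J: "(\<integral>\<^sup>+u. p u \<partial>lborel) < \<infinity>" .
  define h where "h w = p (rho_diag w) * indicator (ball 0 R) w" for w :: "'n cspace"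
  have [measurable]: "h \<in> borel_measurable borel" unfolding h_def by measurable
  have "(\<integral>\<^sup>+w. ennreal (rho_diag w powr \<alpha>) * indicator (ball 0 R) w \<partial>(vol_TB :: 'n cspace measure))
      = (\<integral>\<^sup>+w. h w \<partial>lborel)"
    unfolding nn_integral_vol_TB
  proof (rule nn_integral_cong)
    fix w :: "'n cspace"
    show "ennreal (rho_diag w powr \<alpha>) * indicator (ball 0 R) w * indicator T_B w = h w"
      using M(2)[of w] by (auto simp: h_def p_def indicator_def T_B_iff)
  qed
  also have "\<dots> = (\<integral>\<^sup>+t. (\<integral>\<^sup>+w. h w \<partial>lborel) * indicator {0..1::real} t \<partial>lborel)"
    by (simp add: nn_integral_cmult)
  also have "\<dots> = (\<integral>\<^sup>+t. (\<integral>\<^sup>+w. h (w + t *\<^sub>R e) * indicator {0..1::real} t \<partial>lborel) \<partial>lborel)"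
  proof (rule nn_integral_cong)
    fix t :: real
    have "(\<integral>\<^sup>+w. h (w + t *\<^sub>R e) \<partial>lborel) = (\<integral>\<^sup>+w. h w \<partial>lborel)"
      using nn_integral_lborel_shift[of h "t *\<^sub>R e"] by (simp add: add.commute)
    then show "(\<integral>\<^sup>+w. h w \<partial>lborel) * indicator {0..1} t = (\<integral>\<^sup>+w. h (w + t *\<^sub>R e) * indicator {0..1} t \<partial>lborel)"
      by (simp add: nn_integral_multc)
  qed
  also have "\<dots> = (\<integral>\<^sup>+w. (\<integral>\<^sup>+t. h (w + t *\<^sub>R e) * indicator {0..1::real} t \<partial>lborel) \<partial>lborel)"
    by (rule lborel_pair.Fubini'[symmetric]) measurable
  also have "\<dots> \<le> (\<integral>\<^sup>+w. (\<integral>\<^sup>+u. p u \<partial>lborel) * indicator (ball 0 (R + 1)) w \<partial>(lborel :: 'n cspace measure))"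
  proof (rule nn_integral_mono)
    fix w :: "'n cspace"
    have "(\<integral>\<^sup>+t. h (w + t *\<^sub>R e) * indicator {0..1::real} t \<partial>lborel)
        \<le> (\<integral>\<^sup>+t. p (rho_diag w + t) * indicator (ball 0 (R + 1)) w \<partial>lborel)"
    proof (rule nn_integral_mono)
      fix t :: real
      have "norm w < R + 1" if "norm (w + t *\<^sub>R e) < R" "0 \<le> t" "t \<le> 1"
        using that norm_triangle_ineq4[of "w + t *\<^sub>R e" "t *\<^sub>R e"] norm_e by simp
      then show "h (w + t *\<^sub>R e) * indicator {0..1::real} t \<le> p (rho_diag w + t) * indicator (ball 0 (R + 1)) w"
        by (auto simp: h_def rho_e indicator_def)
    qed
    also have "\<dots> = (\<integral>\<^sup>+u. p u \<partial>lborel) * indicator (ball 0 (R + 1)) w"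
      using nn_integral_lborel_shift[of p "rho_diag w"] by (simp add: nn_integral_multc)
    finally show "(\<integral>\<^sup>+t. h (w + t *\<^sub>R e) * indicator {0..1::real} t \<partial>lborel)
        \<le> (\<integral>\<^sup>+u. p u \<partial>lborel) * indicator (ball 0 (R + 1)) w" .
  qed
  also have "\<dots> = (\<integral>\<^sup>+u. p u \<partial>lborel) * emeasure lborel (ball (0 :: 'n cspace) (R + 1))"
    by (rule nn_integral_cmult_indicator) simp
  also have "\<dots> < \<infinity>"
    using J emeasure_bounded_finite[of "ball (0 :: 'n cspace) (R + 1)"] by (simp add: ennreal_mult_less_top)
  finally show ?thesis .
qed

text \<open>For c > 0 the automorphism attached to this point is a pure dilation, without shear. It
  maps \<open>axis_pt (1 / c)\<close> to \<open>base_pt\<close>, which is how large values of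
  |rho(base_pt,w)| are scaled down.\<close>

definition axis_pt :: "real \<Rightarrow> ('n::{finite,linorder}) cspace" where
  "axis_pt c = (\<chi> j. if j = last_ix then of_real c * \<i> else 0)"

lemma rho_diag_axis_pt [simp]: "rho_diag (axis_pt c) = c"
  by (simp add: rho_diag_def axis_pt_def)

lemma axis_pt_nth: "axis_pt c $ j = (if j = last_ix then of_real c * \<i> else 0)"
  by (simp add: axis_pt_def)

lemma aut_axis_pt:
  assumes "c > 0" shows "aut (axis_pt c) (axis_pt (1 / c)) = base_pt"
proof -
  have "(complex_of_real (sqrt c))\<^sup>2 = of_real c" using assms by (simp flip: of_real_power)
  then show ?thesis
    using assms by (simp add: aut_def vec_eq_iff glin_def axis_pt_nth base_pt_def right_diff_distrib)
qed

text \<open>\<open>Re_rho\<close> bounds v', and solving the formula for \<open>rho\<close> then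
  bounds the last coordinate: 2 |v_n| <= 4 + 4 + 2, hence 5. The bound is uniform in e, so that all
  dyadic pieces of the Forelli--Rudin integral can be rescaled into one fixed ball.\<close>

lemma norm_le_of_rho_axis_pt:
  fixes v :: "('n::{finite,linorder}) cspace"
  assumes e: "0 < e" "e \<le> 1" and v: "v \<in> T_B" "cmod (rho (axis_pt e) v) < 1"
  shows "norm v \<le> 5 * real CARD('n)"
proof -
  let ?S = "UNIV - {last_ix::'n}"
  have "Re (rho (axis_pt e) v) < 1" using v(2) complex_Re_le_cmod[of "rho (axis_pt e) v"] by linarith
  then have sq: "(\<Sum>j\<in>?S. (cmod (v $ j))\<^sup>2) < 4"
    using e v(1) by (simp add: Re_rho axis_pt_nth T_B_iff)
  have 1: "cmod (v $ j) \<le> 5" if "j \<noteq> last_ix" for j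
  proof -
    have "(cmod (v $ j))\<^sup>2 \<le> (\<Sum>j\<in>?S. (cmod (v $ j))\<^sup>2)"
      using that by (intro member_le_sum) auto
    then have "(cmod (v $ j))\<^sup>2 \<le> 5\<^sup>2" using sq by simp
    then show ?thesis by (rule power2_le_imp_le) simp
  qed
  have 2: "cmod (v $ last_ix) \<le> 5"
  proof -
    have "4 * rho (axis_pt e) v = (\<Sum>j\<in>?S. (cnj (v $ j))\<^sup>2) - 2 * \<i> * (of_real e * \<i> - cnj (v $ last_ix))"
      by (simp add: rho_def axis_pt_nth)
    then have eq: "2 * \<i> * cnj (v $ last_ix) = 4 * rho (axis_pt e) v - (\<Sum>j\<in>?S. (cnj (v $ j))\<^sup>2) - 2 * of_real e"
      by (simp add: algebra_simps)
    have "cmod (x - y - z) \<le> cmod x + cmod y + cmod z" for x y z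
      using norm_triangle_ineq4[of x y] norm_triangle_ineq4[of "x - y" z] by linarith
    then have "cmod (2 * \<i> * cnj (v $ last_ix)) \<le> cmod (4 * rho (axis_pt e) v) + cmod (\<Sum>j\<in>?S. (cnj (v $ j))\<^sup>2) + cmod (2 * of_real e)"
      unfolding eq by blast
    moreover have "cmod (\<Sum>j\<in>?S. (cnj (v $ j))\<^sup>2) \<le> (\<Sum>j\<in>?S. (cmod (v $ j))\<^sup>2)"
      using norm_sum[of "\<lambda>j. (cnj (v $ j))\<^sup>2" ?S] by (simp add: norm_power)
    ultimately show ?thesis using sq v(2) e by (simp add: norm_mult)
  qed
  have "norm v \<le> (\<Sum>j\<in>UNIV. cmod (v $ j))" unfolding norm_vec_def by (rule L2_set_le_sum) simp
  also have "\<dots> \<le> (\<Sum>j\<in>(UNIV::'n set). 5)" using 1 2 by (intro sum_mono) (metis order_refl)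
  finally show ?thesis by (simp add: mult.commute)
qed

text \<open>Dyadic decomposition by the size of |rho(base_pt,w)|. The dilation of size 2^k moves the
  region where it is below 2^k into a fixed ball, so the region has weighted volume at most a
  constant times 2^(k (n + 1 + \<alpha>)). Against the factor 2^(-k s) of the kernel this is a
  convergent geometric series.\<close>

lemma forelli_rudin_base:
  fixes \<alpha> s :: real
  assumes \<alpha>: "\<alpha> > -1" and s: "s > real CARD('n) + 1 + \<alpha>"
  shows "(\<integral>\<^sup>+w. ennreal (rho_diag w powr \<alpha> * cmod (rho base_pt w) powr (-s)) \<partial>(vol_TB :: ('n::{finite,linorder}) cspace measure)) < \<infinity>"
proof -
  let ?V = "vol_TB :: 'n cspace measure"
  define N where "N = real CARD('n) + 1"
  have N: "N \<ge> 2" by (simp add: N_def Suc_leI)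
  have s0: "s > 0" using \<alpha> s N by (simp add: N_def)
  define B where "B = (\<integral>\<^sup>+w. ennreal (rho_diag w powr \<alpha>) * indicator (ball 0 (5 * real CARD('n) + 1)) w \<partial>?V)"
  have B: "B < \<infinity>" unfolding B_def by (rule nn_integral_rho_diag_bounded[OF \<alpha>])
  define h where "h k w = ennreal (rho_diag w powr \<alpha>) * (if cmod (rho base_pt w) < 2 ^ k then 1 else 0)" for k and w :: "'n cspace"
  have [measurable]: "h k \<in> borel_measurable TB_space" for k
    unfolding h_def by measurable
  have shell: "(\<integral>\<^sup>+w. h k w \<partial>?V) \<le> ennreal ((2 powr (N + \<alpha>)) ^ k) * B" for k
  proof -
    let ?c = "2 ^ k :: real"
    let ?a = "axis_pt ?c :: 'n cspace"
    have a: "?a \<in> T_B" by (simp add: T_B_iff)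
    have "(\<integral>\<^sup>+w. h k w \<partial>?V) = ennreal (?c powr N) * (\<integral>\<^sup>+w. h k (aut ?a w) \<partial>?V)"
      using nn_integral_vol_TB_aut[of "h k" ?a] a by (simp add: N_def)
    also have "(\<integral>\<^sup>+w. h k (aut ?a w) \<partial>?V) \<le> (\<integral>\<^sup>+w. ennreal (?c powr \<alpha>) *
        (ennreal (rho_diag w powr \<alpha>) * indicator (ball 0 (5 * real CARD('n) + 1)) w) \<partial>?V)"
    proof (rule nn_integral_mono)
      fix w :: "'n cspace" assume "w \<in> space ?V"
      then have w: "w \<in> T_B" by (simp add: space_vol_TB)
      have "cmod (rho base_pt (aut ?a w)) = ?c * cmod (rho (axis_pt (1 / ?c)) w)"
        using cmod_rho_aut[OF a, of "axis_pt (1 / ?c)" w] by (simp add: aut_axis_pt)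
      then have "norm w < 5 * real CARD('n) + 1" if "cmod (rho base_pt (aut ?a w)) < ?c"
        using that norm_le_of_rho_axis_pt[OF _ _ w, of "1 / ?c"] by simp
      then show "h k (aut ?a w) \<le> ennreal (?c powr \<alpha>) *
        (ennreal (rho_diag w powr \<alpha>) * indicator (ball 0 (5 * real CARD('n) + 1)) w)"
        using w by (auto simp: h_def rho_diag_aut[OF a] powr_mult ennreal_mult T_B_iff)
    qed
    also have "\<dots> = ennreal (?c powr \<alpha>) * B"
    proof -
      have "ball 0 (5 * real CARD('n) + 1) \<inter> T_B \<in> sets (TB_space :: 'n cspace measure)"
        unfolding TB_space_def sets_restrict_space
        by (rule image_eqI[of _ _ "ball 0 (5 * real CARD('n) + 1)"]) auto
      then have [measurable]: "(\<lambda>w. indicator (ball 0 (5 * real CARD('n) + 1)) w :: ennreal) \<in> borel_measurable (TB_space :: 'n cspace measure)"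
        by (subst borel_measurable_indicator_iff) (simp add: space_TB_space)
      show ?thesis unfolding B_def by (rule nn_integral_cmult) measurable
    qed
    finally have "(\<integral>\<^sup>+w. h k w \<partial>?V) \<le> ennreal (?c powr N) * (ennreal (?c powr \<alpha>) * B)"
      by (simp add: mult_left_mono)
    also have "\<dots> = ennreal (?c powr (N + \<alpha>)) * B"
      by (simp add: powr_add ennreal_mult mult.assoc)
    also have "?c powr (N + \<alpha>) = (2 powr (N + \<alpha>)) ^ k"
      by (simp add: powr_power powr_powr mult.commute flip: powr_realpow)
    finally show ?thesis .
  qed
  have "(\<integral>\<^sup>+w. ennreal (rho_diag w powr \<alpha> * cmod (rho base_pt w) powr (-s)) \<partial>?V)
      \<le> (\<integral>\<^sup>+w. (\<Sum>k. ennreal (2 powr s * (2 powr (-s)) ^ k) * h k w) \<partial>?V)"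
  proof (rule nn_integral_mono)
    fix w :: "'n cspace" assume "w \<in> space ?V"
    then have w: "w \<in> T_B" by (simp add: space_vol_TB)
    define r where "r = cmod (rho base_pt w)"
    \<comment> \<open>This lower bound covers the piece k = 0, where minimality of k gives no
      information but 2^(k - 1) <= r is still needed.\<close>
    have r: "r \<ge> 1/2" using rho_diag_le[OF base_pt_in_T_B w] by (simp add: r_def)
    have ex: "\<exists>k. r < 2 ^ k" using real_arch_pow[of 2 r] by simp
    define k where "k = (LEAST k. r < 2 ^ k)"
    have k: "r < 2 ^ k" unfolding k_def using ex by (rule LeastI_ex)
    have "2 powr (real k - 1) \<le> r"
    proof (cases k)
      case 0 then show ?thesis using r by (simp add: powr_minus)
    next
      case (Suc m)
      then have "\<not> r < 2 ^ m" unfolding k_def by (metis lessI not_less_Least)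
      then show ?thesis using Suc by (simp add: powr_realpow)
    qed
    then have "r powr (-s) \<le> (2 powr (real k - 1)) powr (-s)"
      using s0 by (intro powr_mono2') auto
    also have "\<dots> = 2 powr s * (2 powr (-s)) ^ k"
      by (simp add: powr_powr powr_power powr_add[symmetric] algebra_simps)
    finally have "rho_diag w powr \<alpha> * r powr (-s) \<le> rho_diag w powr \<alpha> * (2 powr s * (2 powr (-s)) ^ k)"
      by (intro mult_left_mono) auto
    then have "ennreal (rho_diag w powr \<alpha> * r powr (-s)) \<le> ennreal (2 powr s * (2 powr (-s)) ^ k) * h k w"
      using k by (simp add: h_def r_def[symmetric] ennreal_mult[symmetric] mult.commute ennreal_leI)
    also have "\<dots> \<le> (\<Sum>k. ennreal (2 powr s * (2 powr (-s)) ^ k) * h k w)"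
      using sum_le_suminf[OF summableI, of "{k}" "\<lambda>k. ennreal (2 powr s * (2 powr (-s)) ^ k) * h k w"] by simp
    finally show "ennreal (rho_diag w powr \<alpha> * cmod (rho base_pt w) powr (-s))
        \<le> (\<Sum>k. ennreal (2 powr s * (2 powr (-s)) ^ k) * h k w)" by (simp add: r_def)
  qed
  also have "\<dots> = (\<Sum>k. ennreal (2 powr s * (2 powr (-s)) ^ k) * (\<integral>\<^sup>+w. h k w \<partial>?V))"
    by (subst nn_integral_suminf) (auto simp: nn_integral_cmult)
  also have "\<dots> \<le> (\<Sum>k. ennreal (2 powr s * (2 powr (-s)) ^ k) * (ennreal ((2 powr (N + \<alpha>)) ^ k) * B))"
    by (intro suminf_le mult_left_mono shell) auto
  also have "\<dots> = (\<Sum>k. ennreal (2 powr s * (2 powr (N + \<alpha> - s)) ^ k) * B)"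
  proof (rule arg_cong[where f=suminf], rule ext)
    fix k
    have "2 powr s * (2 powr (-s)) ^ k * (2 powr (N + \<alpha>)) ^ k = 2 powr s * (2 powr (N + \<alpha> - s)) ^ k"
      by (simp add: powr_power powr_add[symmetric] algebra_simps)
    moreover have "ennreal (2 powr s * (2 powr (-s)) ^ k) * (ennreal ((2 powr (N + \<alpha>)) ^ k) * B)
        = ennreal (2 powr s * (2 powr (-s)) ^ k * (2 powr (N + \<alpha>)) ^ k) * B"
      by (simp add: ennreal_mult mult.assoc)
    ultimately show "ennreal (2 powr s * (2 powr (-s)) ^ k) * (ennreal ((2 powr (N + \<alpha>)) ^ k) * B) = ennreal (2 powr s * (2 powr (N + \<alpha> - s)) ^ k) * B"
      by (simp only:)
  qed
  also have "\<dots> = (\<Sum>k. ennreal (2 powr s * (2 powr (N + \<alpha> - s)) ^ k)) * B"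
    by (rule ennreal_suminf_multc)
  also have "\<dots> < \<infinity>"
  proof -
    have "2 powr (N + \<alpha> - s) < 2 powr (0::real)" using s by (intro powr_less_mono) (auto simp: N_def)
    then have "summable (\<lambda>k. 2 powr s * (2 powr (N + \<alpha> - s)) ^ k)"
      by (intro summable_mult summable_geometric) simp
    then have "(\<Sum>k. ennreal (2 powr s * (2 powr (N + \<alpha> - s)) ^ k)) < \<infinity>"
      by (subst suminf_ennreal2) auto
    then show ?thesis using B by (simp add: ennreal_mult_less_top)
  qed
  finally show ?thesis .
qed

text \<open>Homogeneity: \<open>aut z\<close> carries \<open>base_pt\<close> to z, and Jacobian,
  weight and kernel contribute rho(z) to the powers n + 1, \<alpha> and -s.\<close>

lemma forelli_rudin:
  fixes \<alpha> s :: real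
  assumes \<alpha>: "\<alpha> > -1" and s: "s > real CARD('n) + 1 + \<alpha>"
  obtains C where "C > 0"
    "\<And>z. z \<in> T_B \<Longrightarrow> (\<integral>\<^sup>+w. ennreal (rho_diag w powr \<alpha> * cmod (rho z w) powr (-s)) \<partial>(vol_TB :: ('n::{finite,linorder}) cspace measure))
        \<le> ennreal (C * rho_diag z powr (real CARD('n) + 1 + \<alpha> - s))"
proof -
  let ?V = "vol_TB :: 'n cspace measure"
  define I where "I = (\<integral>\<^sup>+w. ennreal (rho_diag w powr \<alpha> * cmod (rho base_pt w) powr (-s)) \<partial>?V)"
  have I: "I < \<infinity>" unfolding I_def by (rule forelli_rudin_base[OF assms])
  define C where "C = enn2real I + 1"
  have C: "C > 0" "I \<le> ennreal C"
    using I by (auto simp: C_def add_nonneg_pos ennreal_plus less_top_ennreal)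
  have "(\<integral>\<^sup>+w. ennreal (rho_diag w powr \<alpha> * cmod (rho z w) powr (-s)) \<partial>?V)
        \<le> ennreal (C * rho_diag z powr (real CARD('n) + 1 + \<alpha> - s))" if z: "z \<in> T_B" for z
  proof -
    have pz: "rho_diag z > 0" using z by (simp add: T_B_iff)
    have "(\<integral>\<^sup>+w. ennreal (rho_diag w powr \<alpha> * cmod (rho z w) powr (-s)) \<partial>?V)
        = ennreal (rho_diag z powr (real CARD('n) + 1)) *
          (\<integral>\<^sup>+w. ennreal (rho_diag (aut z w) powr \<alpha> * cmod (rho z (aut z w)) powr (-s)) \<partial>?V)"
      by (rule nn_integral_vol_TB_aut[OF _ z]) measurable
    also have "(\<integral>\<^sup>+w. ennreal (rho_diag (aut z w) powr \<alpha> * cmod (rho z (aut z w)) powr (-s)) \<partial>?V)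
        = (\<integral>\<^sup>+w. ennreal (rho_diag z powr (\<alpha> - s)) * ennreal (rho_diag w powr \<alpha> * cmod (rho base_pt w) powr (-s)) \<partial>?V)"
    proof (rule nn_integral_cong)
      fix w :: "'n cspace" assume "w \<in> space ?V"
      then have w: "rho_diag w > 0" by (simp add: space_vol_TB T_B_iff)
      have "cmod (rho z (aut z w)) = rho_diag z * cmod (rho base_pt w)"
        using cmod_rho_aut[OF z, of base_pt w] by simp
      then have "rho_diag (aut z w) powr \<alpha> * cmod (rho z (aut z w)) powr (-s)
          = rho_diag z powr (\<alpha> - s) * (rho_diag w powr \<alpha> * cmod (rho base_pt w) powr (-s))"
        using w pz by (simp add: rho_diag_aut[OF z] powr_mult powr_diff powr_minus field_simps)
      then show "ennreal (rho_diag (aut z w) powr \<alpha> * cmod (rho z (aut z w)) powr (-s))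
          = ennreal (rho_diag z powr (\<alpha> - s)) * ennreal (rho_diag w powr \<alpha> * cmod (rho base_pt w) powr (-s))"
        by (simp add: ennreal_mult)
    qed
    also have "\<dots> = ennreal (rho_diag z powr (\<alpha> - s)) * I"
      unfolding I_def by (rule nn_integral_cmult) measurable
    also have "ennreal (rho_diag z powr (real CARD('n) + 1)) * (ennreal (rho_diag z powr (\<alpha> - s)) * I)
        \<le> ennreal (rho_diag z powr (real CARD('n) + 1)) * (ennreal (rho_diag z powr (\<alpha> - s)) * ennreal C)"
      using C(2) by (intro mult_left_mono) auto
    also have "\<dots> = ennreal (C * rho_diag z powr (real CARD('n) + 1 + \<alpha> - s))"
      using C(1) by (simp add: ennreal_mult[symmetric] powr_add powr_diff algebra_simps)
    finally show ?thesis .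
  qed
  with C(1) show ?thesis using that by blast
qed

subsection \<open>Mean value inequalities\<close>

lemma circle_mean_inequality:
  fixes f :: "complex \<Rightarrow> complex"
  assumes f: "f holomorphic_on cball 0 1"
  shows "ennreal (cmod (f 0)) \<le> (\<integral>\<^sup>+t. ennreal (cmod (f (exp (2 * of_real pi * \<i> * of_real t)))) * indicator {0..1} t \<partial>lborel)"
proof -
  define e where "e t = exp (2 * of_real pi * \<i> * of_real t)" for t :: real
  have e_norm: "cmod (e t) = 1" for t by (simp add: e_def norm_exp_eq_Re)
  have e0: "e t \<noteq> 0" for t by (simp add: e_def)
  have "((\<lambda>u. f u / (u - 0)) has_contour_integral (2 * of_real pi * \<i> * f 0)) (circlepath 0 1)"
    by (rule Cauchy_integral_circlepath_simple[OF f]) simp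
  then have "((\<lambda>t. f (e t) / e t * (2 * pi * \<i> * e t)) has_integral (2 * of_real pi * \<i> * f 0)) {0..1}"
    unfolding has_contour_integral_def
    by (rule has_integral_eq[rotated]) (subst vector_derivative_circlepath01, auto simp: circlepath e_def)
  then have "((\<lambda>t. 2 * pi * \<i> * f (e t)) has_integral (2 * of_real pi * \<i> * f 0)) {0..1}"
    by (rule has_integral_eq[rotated]) (simp add: e0)
  from has_integral_mult_right[OF this, of "1 / (2 * pi * \<i>)"]
  have I: "((\<lambda>t. f (e t)) has_integral f 0) {0..1}" by simp
  have cont: "continuous_on {0..1} (\<lambda>t. f (e t))"
    by (rule continuous_on_compose2[OF holomorphic_on_imp_continuous_on[OF f]])
       (auto simp: e_norm e_def[abs_def] intro!: continuous_intros)
  have int: "(\<lambda>t. cmod (f (e t))) integrable_on {0..1}"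
    by (intro integrable_continuous_interval continuous_intros cont)
  have "cmod (f 0) = cmod (integral {0..1} (\<lambda>t. f (e t)))" using I by (simp add: integral_unique)
  also have "\<dots> \<le> integral {0..1} (\<lambda>t. cmod (f (e t)))"
    using I int by (intro integral_norm_bound_integral) (auto simp: integrable_on_def)
  finally have "ennreal (cmod (f 0)) \<le> ennreal (integral {0..1} (\<lambda>t. cmod (f (e t))))" by (rule ennreal_leI)
  also have "\<dots> = (\<integral>\<^sup>+t. ennreal (cmod (f (e t))) * indicator {0..1} t \<partial>lborel)"
    by (rule nn_integral_has_integral_lebesgue'[symmetric]) (use int in \<open>auto simp: integrable_integral\<close>)
  finally show ?thesis by (simp add: e_def)
qed

section \<open>Holomorphic functions of several variables and their mean values over Euclidean
  balls\<close>

lemma holomorphic_multi_imp_continuous_on: "holomorphic_multi f S \<Longrightarrow> continuous_on S f"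
  unfolding holomorphic_multi_def
  by (metis continuous_at_imp_continuous_on has_derivative_continuous)

lemma holomorphic_multi_mult:
  assumes "holomorphic_multi f S" "holomorphic_multi g S"
  shows "holomorphic_multi (\<lambda>z. f z * g z) S"
  unfolding holomorphic_multi_def
proof
  fix z assume z: "z \<in> S"
  obtain D where D: "(f has_derivative D) (at z)" "\<And>c v. D (c *s v) = c * D v"
    using assms(1) z by (auto simp: holomorphic_multi_def)
  obtain D' where D': "(g has_derivative D') (at z)" "\<And>c v. D' (c *s v) = c * D' v"
    using assms(2) z by (auto simp: holomorphic_multi_def)
  show "\<exists>D. ((\<lambda>z. f z * g z) has_derivative D) (at z) \<and> (\<forall>c v. D (c *s v) = c * D v)"
    using has_derivative_mult[OF D(1) D'(1)] D(2) D'(2)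
    by (intro exI[of _ "\<lambda>h. f z * D' h + D h * g z"]) (auto simp: algebra_simps)
qed

lemma holomorphic_multi_power:
  assumes "holomorphic_multi f S"
  shows "holomorphic_multi (\<lambda>z. f z ^ m) S"
proof (induction m)
  case 0
  show ?case unfolding holomorphic_multi_def by (auto intro!: exI[of _ "\<lambda>_. 0"])
next
  case (Suc m)
  then show ?case using holomorphic_multi_mult[OF assms Suc] by simp
qed

lemma norm_smult_vec: "norm (c *s v) = cmod c * norm (v :: complex ^ 'n)"
  by (simp add: norm_vec_def L2_set_def norm_mult power_mult_distrib real_sqrt_mult flip: sum_distrib_left)

lemma linear_smult: "linear (\<lambda>v :: complex ^ 'n. c *s v)"
  by (rule linearI) (simp_all only: vec_eq_iff vector_smult_component vector_scaleR_component
      vector_add_component distrib_left mult_scaleR_right simp_thms)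

lemma has_derivative_smult_left: "((\<lambda>\<zeta>. \<zeta> *s v) has_derivative (\<lambda>h. h *s v)) (at \<zeta>)"
  for v :: "complex ^ 'n"
proof -
  have "linear (\<lambda>\<zeta>. \<zeta> *s v)"
    by (rule linearI) (simp_all only: vec_eq_iff vector_smult_component vector_scaleR_component
        vector_add_component distrib_right mult_scaleR_left simp_thms)
  then show ?thesis by (simp add: linear_conv_bounded_linear bounded_linear_imp_has_derivative)
qed

lemma holomorphic_multi_slice:
  assumes f: "holomorphic_multi f S" and S: "\<And>\<zeta>. \<zeta> \<in> A \<Longrightarrow> c + \<zeta> *s v \<in> S"
  shows "(\<lambda>\<zeta>. f (c + \<zeta> *s v)) holomorphic_on A"
  unfolding holomorphic_on_def
proof
  fix \<zeta> assume "\<zeta> \<in> A"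
  then obtain D where D: "(f has_derivative D) (at (c + \<zeta> *s v))" "\<And>c v. D (c *s v) = c * D v"
    using f S unfolding holomorphic_multi_def by blast
  have "((\<lambda>\<zeta>. c + \<zeta> *s v) has_derivative (\<lambda>h. h *s v)) (at \<zeta>)"
    using has_derivative_add[OF has_derivative_const has_derivative_smult_left, of c v \<zeta>] by simp
  from has_derivative_compose[OF this D(1)]
  have "((\<lambda>\<zeta>. f (c + \<zeta> *s v)) has_derivative (\<lambda>h. h * D v)) (at \<zeta>)" by (simp add: D(2))
  then have "((\<lambda>\<zeta>. f (c + \<zeta> *s v)) has_field_derivative D v) (at \<zeta>)"
    by (simp add: has_field_derivative_def mult_commute_abs)
  then show "(\<lambda>\<zeta>. f (c + \<zeta> *s v)) field_differentiable at \<zeta> within A"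
    using field_differentiable_at_within field_differentiable_def by blast
qed

lemma continuous_on_smult [continuous_intros]:
  fixes g :: "'a::topological_space \<Rightarrow> complex ^ 'n"
  shows "continuous_on S f \<Longrightarrow> continuous_on S g \<Longrightarrow> continuous_on S (\<lambda>x. f x *s g x)"
  unfolding vector_scalar_mult_def by (intro continuous_on_vec_lambda continuous_intros)

text \<open>Averaging the circle mean value inequality over the ball; rotations \<open>v \<mapsto> e\<^sup>i\<^sup>\<theta> v\<close> preserve Lebesgue
  measure.\<close>

lemma ball_mean_inequality:
  fixes f :: "('n::finite) cspace \<Rightarrow> complex"
  assumes f: "holomorphic_multi f S" and S: "ball c r \<subseteq> S"
  shows "ennreal (cmod (f c)) * emeasure lborel (ball (0 :: 'n cspace) r)
    \<le> (\<integral>\<^sup>+x. ennreal (cmod (f x)) * indicator (ball c r) x \<partial>lborel)"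
proof -
  define e where "e t = exp (2 * of_real pi * \<i> * of_real t)" for t :: real
  have e_norm: "cmod (e t) = 1" for t by (simp add: e_def norm_exp_eq_Re)
  define H where "H x = ennreal (cmod (f x)) * indicator (ball c r) x" for x
  have H[measurable]: "H \<in> borel_measurable borel"
  proof -
    have "continuous_on (ball c r) f"
      using holomorphic_multi_imp_continuous_on[OF f] S continuous_on_subset by blast
    then have "f \<in> borel_measurable (restrict_space borel (ball c r))"
      by (rule borel_measurable_continuous_on_restrict)
    then have "(\<lambda>x. ennreal (cmod (f x))) \<in> borel_measurable (restrict_space borel (ball c r))"
      by measurable
    then show ?thesis unfolding H_def
      by (subst (asm) borel_measurable_restrict_space_iff_ennreal) auto
  qed
  define G where "G v = H (c + v)" for v
  have G[measurable]: "G \<in> borel_measurable borel" unfolding G_def by measurable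
  have G_rot: "(\<integral>\<^sup>+v. G (e t *s v) \<partial>lborel) = (\<integral>\<^sup>+v. G v \<partial>lborel)" for t
  proof -
    have iso: "norm (e t *s v) = norm v" for v :: "'n cspace" by (simp add: norm_smult_vec e_norm)
    have inj: "inj (\<lambda>v :: 'n cspace. e t *s v)"
      unfolding linear_injective_0[OF linear_smult] by (metis iso norm_eq_zero)
    show ?thesis
      using nn_integral_linear[OF linear_smult inj G] lin_scale_isometry[of "\<lambda>v. e t *s v", OF iso] by simp
  qed
  have joint[measurable]: "(\<lambda>x. e (fst x) *s snd x) \<in> borel_measurable (lborel \<Otimes>\<^sub>M (lborel :: 'n cspace measure))"
    unfolding e_def by (rule borel_measurable_continuous_Pair[where H="\<lambda>t v. exp (2 * of_real pi * \<i> * of_real t) *s v"])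
      (auto intro!: continuous_intros)
  have "ennreal (cmod (f c)) * emeasure lborel (ball (0 :: 'n cspace) r)
      = (\<integral>\<^sup>+v. ennreal (cmod (f c)) * indicator (ball (0 :: 'n cspace) r) v \<partial>lborel)"
    by (rule nn_integral_cmult_indicator[symmetric]) simp
  also have "\<dots> \<le> (\<integral>\<^sup>+v. (\<integral>\<^sup>+t. G (e t *s v) * indicator {0..1} t \<partial>lborel) \<partial>lborel)"
  proof (rule nn_integral_mono)
    fix v :: "'n cspace"
    show "ennreal (cmod (f c)) * indicator (ball 0 r) v \<le> (\<integral>\<^sup>+t. G (e t *s v) * indicator {0..1} t \<partial>lborel)"
    proof (cases "v \<in> ball 0 r")
      case True
      have *: "c + \<zeta> *s v \<in> ball c r" if "cmod \<zeta> \<le> 1" for \<zeta>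
      proof -
        have "cmod \<zeta> * norm v \<le> 1 * norm v" using that by (intro mult_right_mono) auto
        then show ?thesis using True by (simp add: dist_norm norm_smult_vec)
      qed
      have "(\<lambda>\<zeta>. f (c + \<zeta> *s v)) holomorphic_on cball 0 1"
        by (rule holomorphic_multi_slice[OF f]) (use * S in auto)
      from circle_mean_inequality[OF this]
      have "ennreal (cmod (f c)) \<le> (\<integral>\<^sup>+t. ennreal (cmod (f (c + e t *s v))) * indicator {0..1} t \<partial>lborel)"
        by (simp add: e_def)
      also have "\<dots> = (\<integral>\<^sup>+t. G (e t *s v) * indicator {0..1} t \<partial>lborel)"
        using *[OF order_eq_refl[OF e_norm]] by (simp add: G_def H_def)
      finally show ?thesis using True by simp
    qed simp
  qed
  also have "\<dots> = (\<integral>\<^sup>+t. (\<integral>\<^sup>+v. G (e t *s v) * indicator {0..1} t \<partial>lborel) \<partial>lborel)"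
  proof (rule lborel_pair.Fubini')
    have "(\<lambda>x. G (e (fst x) *s snd x) * indicator {0..1} (fst x)) \<in> borel_measurable (lborel \<Otimes>\<^sub>M (lborel :: 'n cspace measure))"
      by measurable
    then show "(\<lambda>(t, v). G (e t *s v) * indicator {0..1} t) \<in> borel_measurable (lborel \<Otimes>\<^sub>M (lborel :: 'n cspace measure))"
      by (simp add: case_prod_unfold)
  qed
  also have "\<dots> = (\<integral>\<^sup>+t. (\<integral>\<^sup>+v. G v \<partial>lborel) * indicator {0..1::real} t \<partial>lborel)"
  proof (rule nn_integral_cong)
    fix t :: real
    have [measurable]: "(\<lambda>v :: 'n cspace. e t *s v) \<in> borel_measurable borel"
      by (intro borel_measurable_continuous_onI continuous_intros)
    show "(\<integral>\<^sup>+v. G (e t *s v) * indicator {0..1} t \<partial>lborel) = (\<integral>\<^sup>+v. G v \<partial>lborel) * indicator {0..1} t"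
      by (simp add: nn_integral_multc G_rot)
  qed
  also have "\<dots> = (\<integral>\<^sup>+v. G v \<partial>lborel)"
    by (simp add: nn_integral_cmult)
  also have "\<dots> = (\<integral>\<^sup>+x. H x \<partial>lborel)"
    unfolding G_def by (rule nn_integral_lborel_shift) measurable
  finally show ?thesis by (simp add: H_def)
qed

text \<open>The Hardy--Littlewood argument: at a maximum point \<open>z\<^sub>0\<close> of \<open>(R - |z - c|)\<^bsup>d/p\<^esup> u(z)\<close>, where \<open>d\<close> is the
  dimension, the values of \<open>u\<close> on the ball of half the distance to the boundary are at most
  \<open>2\<^bsup>d/p\<^esup> u(z\<^sub>0)\<close>.\<close>

lemma mean_inequality_powr:
  fixes u :: "'a::euclidean_space \<Rightarrow> real"
  assumes cont: "continuous_on (cball c R) u" and nonneg: "\<And>x. 0 \<le> u x" and R: "R > 0"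
    and p: "0 < p" "p \<le> 1"
    and mean: "\<And>z r. ball z r \<subseteq> cball c R \<Longrightarrow> r > 0 \<Longrightarrow>
        ennreal (u z) * emeasure lborel (ball (0::'a) r) \<le> (\<integral>\<^sup>+x. ennreal (u x) * indicator (ball z r) x \<partial>lborel)"
  shows "ennreal (R powr real DIM('a) * 2 powr (- real DIM('a) / p) * measure lborel (ball (0::'a) 1) * u c powr p)
      \<le> (\<integral>\<^sup>+x. ennreal (u x powr p) * indicator (cball c R) x \<partial>lborel)"
proof -
  define d where "d = real DIM('a)"
  define \<omega> where "\<omega> = measure lborel (ball (0::'a) 1)"
  have \<omega>: "\<omega> > 0" unfolding \<omega>_def by (rule measure_lborel_ball_pos) simp
  have d: "d > 0" by (simp add: d_def)
  define I where "I = (\<integral>\<^sup>+x. ennreal (u x powr p) * indicator (cball c R) x \<partial>lborel)"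
  \<comment> \<open>With the exponent d / p, the power \<open>\<phi> z0 powr p\<close> contains
    \<open>\<delta> powr d\<close>, exactly the scaling of the volume of a ball; the distance
    \<open>\<delta>\<close> therefore disappears from the final inequality.\<close>
  define \<phi> where "\<phi> z = (R - dist c z) powr (d / p) * u z" for z
  have "continuous_on (cball c R) \<phi>"
    unfolding \<phi>_def using cont d p by (intro continuous_intros continuous_on_powr') auto
  moreover have "compact (cball c R)" "cball c R \<noteq> {}" using R by auto
  ultimately obtain z0 where z0: "z0 \<in> cball c R" "\<And>z. z \<in> cball c R \<Longrightarrow> \<phi> z \<le> \<phi> z0"
    using continuous_attains_sup[of "cball c R" \<phi>] by blast
  show ?thesis
  proof (cases "u c = 0")
    case True
    then show ?thesis by simp
  next
    case False
    then have uc: "u c > 0" using nonneg[of c] by simp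
    have "0 < \<phi> c" using uc R by (simp add: \<phi>_def)
    then have pos: "0 < \<phi> z0" using z0(2)[of c] R by simp
    define \<delta> where "\<delta> = R - dist c z0"
    have \<delta>: "\<delta> > 0" using pos z0(1) by (cases "\<delta> = 0") (auto simp: \<phi>_def \<delta>_def)
    have uz0: "u z0 > 0" using pos nonneg[of z0] by (cases "u z0 = 0") (auto simp: \<phi>_def)
    define m where "m = u z0 * 2 powr (d / p)"
    have m: "m > 0" using uz0 by (simp add: m_def)
    have sub: "ball z0 (\<delta>/2) \<subseteq> cball c R"
    proof
      fix z assume "z \<in> ball z0 (\<delta>/2)"
      then show "z \<in> cball c R" using dist_triangle[of c z z0] \<delta> by (simp add: \<delta>_def)
    qed
    have um: "u z \<le> m" if z: "z \<in> ball z0 (\<delta>/2)" for z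
    proof -
      have ge: "\<delta>/2 \<le> R - dist c z" using dist_triangle[of c z z0] z by (simp add: \<delta>_def)
      have "(\<delta>/2) powr (d/p) * u z \<le> (R - dist c z) powr (d/p) * u z"
        using ge \<delta> d p nonneg by (intro mult_right_mono powr_mono2) auto
      also have "\<dots> \<le> \<delta> powr (d/p) * u z0"
        using z0(2)[of z] z sub by (auto simp: \<phi>_def \<delta>_def)
      also have "\<dots> = (\<delta>/2) powr (d/p) * m"
        using \<delta> by (simp add: m_def powr_divide)
      finally show ?thesis using \<delta> by (simp add: mult_le_cancel_left)
    qed
    have vol: "emeasure lborel (ball (0::'a) (\<delta>/2)) = ennreal (\<omega> * (\<delta>/2) powr d)"
    proof -
      have "measure lborel (ball (0::'a) (\<delta>/2)) = (\<delta>/2) ^ DIM('a) * \<omega>"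
        using content_ball_conv_unit_ball[of "\<delta>/2" "0::'a"] \<delta> by (simp add: \<omega>_def del: content_ball)
      moreover have "(\<delta>/2) ^ DIM('a) = (\<delta>/2) powr d" using \<delta> by (simp add: d_def powr_realpow)
      moreover have "emeasure lborel (ball (0::'a) (\<delta>/2)) \<noteq> \<infinity>"
        using emeasure_bounded_finite[of "ball (0::'a) (\<delta>/2)"] by simp
      ultimately show ?thesis by (simp add: emeasure_eq_ennreal_measure mult.commute del: content_ball)
    qed
    have "ennreal (u z0 * (\<omega> * (\<delta>/2) powr d)) = ennreal (u z0) * emeasure lborel (ball (0::'a) (\<delta>/2))"
      unfolding vol using \<omega> nonneg by (simp add: ennreal_mult)
    also have "\<dots> \<le> (\<integral>\<^sup>+x. ennreal (u x) * indicator (ball z0 (\<delta>/2)) x \<partial>lborel)"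
      using sub \<delta> by (intro mean) auto
    also have "\<dots> \<le> (\<integral>\<^sup>+x. ennreal (m powr (1 - p)) * (ennreal (u x powr p) * indicator (cball c R) x) \<partial>lborel)"
    proof (rule nn_integral_mono)
      fix x
      show "ennreal (u x) * indicator (ball z0 (\<delta>/2)) x
         \<le> ennreal (m powr (1 - p)) * (ennreal (u x powr p) * indicator (cball c R) x)"
      proof (cases "x \<in> ball z0 (\<delta>/2)")
        case True
        \<comment> \<open>Since p <= 1, the bound u <= m lets the surplus factor u^(1 - p) be
          replaced by a constant, which trades the first power of u for the p-th.\<close>
        have "u x \<le> m powr (1 - p) * u x powr p"
        proof (cases "u x = 0")
          case False
          then have ux: "u x > 0" using nonneg[of x] by simp
          have "u x = u x powr (1 - p) * u x powr p" using ux by (simp flip: powr_add)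
          also have "\<dots> \<le> m powr (1 - p) * u x powr p"
            using um[OF True] ux p by (intro mult_right_mono powr_mono2) auto
          finally show ?thesis .
        qed simp
        then show ?thesis using True sub by (auto simp: ennreal_mult[symmetric] intro!: ennreal_leI)
      qed simp
    qed
    also have "\<dots> = ennreal (m powr (1 - p)) * I"
      unfolding I_def
    proof (rule nn_integral_cmult)
      have "u \<in> borel_measurable (restrict_space borel (cball c R))"
        using cont by (rule borel_measurable_continuous_on_restrict)
      then have "(\<lambda>x. ennreal (u x powr p)) \<in> borel_measurable (restrict_space borel (cball c R))"
        by measurable
      then show "(\<lambda>x. ennreal (u x powr p) * indicator (cball c R) x) \<in> borel_measurable lborel"
        by (subst (asm) borel_measurable_restrict_space_iff_ennreal) auto
    qed
    finally have "ennreal (m powr (p - 1)) * ennreal (u z0 * (\<omega> * (\<delta>/2) powr d))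
        \<le> ennreal (m powr (p - 1)) * (ennreal (m powr (1 - p)) * I)"
      by (rule mult_left_mono) simp
    also have "\<dots> = I"
      using m by (simp add: mult.assoc[symmetric] ennreal_mult[symmetric] powr_add[symmetric])
    finally have "ennreal (m powr (p - 1) * (u z0 * (\<omega> * (\<delta>/2) powr d))) \<le> I"
      using uz0 \<omega> by (simp add: ennreal_mult)
    moreover have "R powr d * 2 powr (- d / p) * \<omega> * u c powr p \<le> m powr (p - 1) * (u z0 * (\<omega> * (\<delta>/2) powr d))"
    proof -
      have "R powr d * u c powr p = \<phi> c powr p"
        using R uc p by (simp add: \<phi>_def powr_mult powr_powr)
      also have "\<dots> \<le> \<phi> z0 powr p"
        using z0(2)[of c] R \<open>0 < \<phi> c\<close> p by (intro powr_mono2) auto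
      also have "\<dots> = \<delta> powr d * u z0 powr p"
        using \<delta> uz0 p by (simp add: \<phi>_def \<delta>_def[symmetric] powr_mult powr_powr)
      finally have "R powr d * u c powr p * (2 powr (- d / p) * \<omega>) \<le> \<delta> powr d * u z0 powr p * (2 powr (- d / p) * \<omega>)"
        using \<omega> by (intro mult_right_mono) auto
      also have "\<dots> = m powr (p - 1) * (u z0 * (\<omega> * (\<delta>/2) powr d))"
      proof -
        have f1: "u z0 powr (p - 1) * u z0 = u z0 powr p"
          using uz0 powr_add[of "u z0" "p - 1" 1] by simp
        have f2: "(2 powr (d / p)) powr (p - 1) * (1 / 2 powr d) = 2 powr (- d / p)"
          using p by (simp add: powr_powr powr_minus_divide[symmetric] powr_add[symmetric] field_simps)
        have f3: "m powr (p - 1) * (u z0 * (\<omega> * (\<delta>/2) powr d))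
           = (u z0 powr (p - 1) * u z0) * ((2 powr (d / p)) powr (p - 1) * (1 / 2 powr d)) * (\<omega> * \<delta> powr d)"
          using \<delta> uz0 by (simp add: m_def powr_mult powr_divide)
        show ?thesis unfolding f3 f1 f2 by (simp only: mult_ac)
      qed
      finally show ?thesis by (simp add: mult_ac)
    qed
    ultimately show ?thesis unfolding d_def[symmetric] \<omega>_def[symmetric] I_def[symmetric]
      by (meson ennreal_leI order_trans)
  qed
qed

text \<open>For large p one writes |f|^p = |f^m|^(p/m) with m the ceiling of p: the exponent p/m is
  at most 1 and f^m is still holomorphic, so the case of small exponents covers all p.\<close>

lemma holomorphic_mean_inequality_powr:
  fixes p R :: real
  assumes p: "p > 0" and R: "R > 0"
  obtains K where "K > 0"
    "\<And>f S c. holomorphic_multi f S \<Longrightarrow> cball (c :: ('n::finite) cspace) R \<subseteq> S \<Longrightarrow>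
      ennreal (K * cmod (f c) powr p) \<le> (\<integral>\<^sup>+x. ennreal (cmod (f x) powr p) * indicator (cball c R) x \<partial>lborel)"
proof -
  define m where "m = nat \<lceil>p\<rceil>"
  have m: "m > 0" "p \<le> real m" using p by (auto simp: m_def)
  define q where "q = p / real m"
  have q: "q > 0" "q \<le> 1" using p m by (auto simp: q_def)
  define K where "K = R powr real DIM('n cspace) * 2 powr (- real DIM('n cspace) / q) * measure lborel (ball (0::'n cspace) 1)"
  have K: "K > 0" using R measure_lborel_ball_pos[of 1 "0::'n cspace"] by (simp add: K_def del: content_ball)
  have "ennreal (K * cmod (f c) powr p) \<le> (\<integral>\<^sup>+x. ennreal (cmod (f x) powr p) * indicator (cball c R) x \<partial>lborel)"
    if f: "holomorphic_multi f S" and S: "cball c R \<subseteq> S" for f S and c :: "'n cspace"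
  proof -
    define u where "u x = cmod (f x ^ m)" for x
    have g: "holomorphic_multi (\<lambda>z. f z ^ m) S" by (rule holomorphic_multi_power[OF f])
    have up: "u x powr q = cmod (f x) powr p" for x
    proof (cases "f x = 0")
      case False
      then show ?thesis using m by (simp add: u_def norm_power q_def powr_powr flip: powr_realpow)
    qed (use m in \<open>simp add: u_def\<close>)
    have "ennreal (K * u c powr q) \<le> (\<integral>\<^sup>+x. ennreal (u x powr q) * indicator (cball c R) x \<partial>lborel)"
      unfolding K_def
    proof (rule mean_inequality_powr)
      show "continuous_on (cball c R) u"
        unfolding u_def using continuous_on_subset[OF holomorphic_multi_imp_continuous_on[OF g] S]
        by (rule continuous_on_norm)
      show "ennreal (u z) * emeasure lborel (ball (0::'n cspace) r) \<le> (\<integral>\<^sup>+x. ennreal (u x) * indicator (ball z r) x \<partial>lborel)"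
        if "ball z r \<subseteq> cball c R" for z r
        unfolding u_def by (rule ball_mean_inequality[OF g]) (use that S in auto)
    qed (use R q in \<open>auto simp: u_def\<close>)
    then show ?thesis by (simp add: up)
  qed
  then show ?thesis using K that by blast
qed

section \<open>Transfer of the mean value inequality to Bergman balls\<close>

lemma powr_comparable:
  fixes x y c b :: real
  assumes "x > 0" "y > 0" "x \<le> c * y" "y \<le> c * x" "c \<ge> 1"
  shows "x powr b \<le> c powr \<bar>b\<bar> * y powr b"
proof (cases "b \<ge> 0")
  case True
  then have "x powr b \<le> (c * y) powr b" using assms by (intro powr_mono2) auto
  then show ?thesis using assms True by (simp add: powr_mult)
next
  case False
  then have "x powr b \<le> (y / c) powr b"
    using assms by (intro powr_mono2') (auto simp: field_simps)
  then show ?thesis using assms False by (simp add: powr_divide powr_minus field_simps)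
qed

lemma has_derivative_aut: "(aut a has_derivative glin (sqrt (rho_diag a)) (\<lambda>k. Im (a $ k))) (at z)"
proof -
  let ?L = "glin (sqrt (rho_diag a)) (\<lambda>k. Im (a $ k))"
  have A: "(?L has_derivative ?L) (at w)" for w
    using linear_glin unfolding linear_conv_bounded_linear by (rule bounded_linear_imp_has_derivative)
  have B: "((\<lambda>z. z - base_pt) has_derivative (\<lambda>h. h)) (at z)"
    by (auto intro!: derivative_eq_intros)
  have "((\<lambda>z. ?L (z - base_pt)) has_derivative (\<lambda>h. ?L h)) (at z)"
    by (rule has_derivative_compose[OF B A])
  from has_derivative_add[OF has_derivative_const this, of a]
  have "((\<lambda>z. a + ?L (z - base_pt)) has_derivative (\<lambda>h. ?L h)) (at z)" by simp
  then show ?thesis by (simp add: aut_def[abs_def])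
qed

lemma holomorphic_multi_aut:
  assumes f: "holomorphic_multi f T_B" and a: "a \<in> T_B"
  shows "holomorphic_multi (\<lambda>z. f (aut a z)) T_B"
  unfolding holomorphic_multi_def
proof
  fix z :: "'a cspace" assume z: "z \<in> T_B"
  then obtain D where D: "(f has_derivative D) (at (aut a z))" "\<And>c v. D (c *s v) = c * D v"
    using f aut_in_T_B[OF a] unfolding holomorphic_multi_def by blast
  show "\<exists>D. ((\<lambda>z. f (aut a z)) has_derivative D) (at z) \<and> (\<forall>c v. D (c *s v) = c * D v)"
    using has_derivative_compose[OF has_derivative_aut D(1)]
    by (intro exI conjI) (auto simp: glin_cmult D(2))
qed

lemma holomorphic_multi_measurable [measurable_dest]: "holomorphic_multi f T_B \<Longrightarrow> f \<in> borel_measurable TB_space"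
  by (intro measurable_continuous_TB_space holomorphic_multi_imp_continuous_on)

lemma ennreal_mult3:
  assumes "0 \<le> x" "0 \<le> y" "0 \<le> z"
  shows "ennreal x * (ennreal y * (ennreal z * J)) = ennreal (x * (y * z)) * J"
  using assms by (simp add: ennreal_mult mult.assoc)

text \<open>A fixed Euclidean ball lies inside the Bergman ball at \<open>base_pt\<close>; composing
  f with \<open>aut a\<close> moves the estimate to a, and the Jacobian supplies the power -(n + 1).
  As \<open>rho_diag\<close> is comparable to rho(a) on the ball, a weight of any real exponent b
  can be inserted at the cost of 8^|b|.\<close>

lemma bergman_mean_inequality:
  fixes p b :: real
  assumes p: "p > 0"
  obtains C where "C > 0"
    "\<And>f a. holomorphic_multi f T_B \<Longrightarrow> a \<in> T_B \<Longrightarrow>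
      ennreal (cmod (f a) powr p) \<le> ennreal (C * rho_diag a powr - (real CARD('n) + 1 + b)) *
        (\<integral>\<^sup>+w. ennreal (cmod (f w) powr p * rho_diag w powr b) * indicator (bergman_ball a) w \<partial>(vol_TB :: ('n::{finite,linorder}) cspace measure))"
proof -
  let ?V = "vol_TB :: 'n cspace measure"
  obtain R where R: "R > 0" "cball (base_pt :: 'n cspace) R \<subseteq> bergman_ball base_pt"
    using open_bergman_ball[of base_pt] center_in_bergman_ball[OF base_pt_in_T_B]
    by (meson open_contains_cball)
  obtain K where K: "K > 0" "\<And>f S c. holomorphic_multi f S \<Longrightarrow> cball (c :: 'n cspace) R \<subseteq> S \<Longrightarrow>
      ennreal (K * cmod (f c) powr p) \<le> (\<integral>\<^sup>+x. ennreal (cmod (f x) powr p) * indicator (cball c R) x \<partial>lborel)"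
    using holomorphic_mean_inequality_powr[OF p R(1)] by blast
  define C where "C = 8 powr \<bar>b\<bar> / K"
  have C: "C > 0" using K by (simp add: C_def)
  have "ennreal (cmod (f a) powr p) \<le> ennreal (C * rho_diag a powr - (real CARD('n) + 1 + b)) *
        (\<integral>\<^sup>+w. ennreal (cmod (f w) powr p * rho_diag w powr b) * indicator (bergman_ball a) w \<partial>?V)"
    if f: "holomorphic_multi f T_B" and a: "a \<in> T_B" for f and a :: "'n cspace"
  proof -
    let ?N = "real CARD('n) + 1"
    let ?r = "rho_diag a"
    have r: "?r > 0" using a by (simp add: T_B_iff)
    have [measurable]: "f \<in> borel_measurable TB_space" using f by (rule holomorphic_multi_measurable)
    have ind[measurable]: "indicator (bergman_ball a) \<in> borel_measurable (TB_space :: 'n cspace measure)"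
      by (rule borel_measurable_indicator[OF bergman_ball_sets])
    define H where "H w = ennreal (cmod (f w) powr p) * indicator (bergman_ball a) w" for w
    have H[measurable]: "H \<in> borel_measurable TB_space" unfolding H_def by measurable
    define J where "J = (\<integral>\<^sup>+w. ennreal (cmod (f w) powr p * rho_diag w powr b) * indicator (bergman_ball a) w \<partial>?V)"
    have "ennreal (K * cmod (f a) powr p) \<le> (\<integral>\<^sup>+x. ennreal (cmod (f (aut a x)) powr p) * indicator (cball base_pt R) x \<partial>lborel)"
      using K(2)[OF holomorphic_multi_aut[OF f a], of base_pt] subset_trans[OF R(2) bergman_ball_subset] by simp
    also have "\<dots> \<le> (\<integral>\<^sup>+x. H (aut a x) \<partial>?V)"
      unfolding nn_integral_vol_TB
    proof (rule nn_integral_mono)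
      fix x :: "'n cspace"
      have "aut a x \<in> bergman_ball a \<and> x \<in> T_B" if "x \<in> cball base_pt R"
        using that R(2) bergman_ball_subset aut_in_bergman_ball[OF a, of x base_pt] by auto
      then show "ennreal (cmod (f (aut a x)) powr p) * indicator (cball base_pt R) x \<le> H (aut a x) * indicator T_B x"
        by (auto simp: H_def indicator_def)
    qed
    also have "\<dots> = ennreal (?r powr - ?N) * (\<integral>\<^sup>+x. H x \<partial>?V)"
      unfolding nn_integral_vol_TB_aut[OF H a] using r
      by (simp add: mult.assoc[symmetric] ennreal_mult[symmetric] powr_add[symmetric])
    also have "(\<integral>\<^sup>+x. H x \<partial>?V) \<le> (\<integral>\<^sup>+x. ennreal (8 powr \<bar>b\<bar> * ?r powr - b) *
        (ennreal (cmod (f x) powr p * rho_diag x powr b) * indicator (bergman_ball a) x) \<partial>?V)"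
    proof (rule nn_integral_mono)
      fix x :: "'n cspace"
      show "H x \<le> ennreal (8 powr \<bar>b\<bar> * ?r powr - b) *
        (ennreal (cmod (f x) powr p * rho_diag x powr b) * indicator (bergman_ball a) x)"
      proof (cases "x \<in> bergman_ball a")
        case True
        then have x: "rho_diag x > 0" using bergman_ball_subset by (auto simp flip: T_B_iff)
        have "?r powr b \<le> 8 powr \<bar>b\<bar> * rho_diag x powr b"
          using r x bergman_ball_rho_diag_le[OF a True] bergman_ball_rho_diag_ge[OF a True]
          by (intro powr_comparable) auto
        then have "1 \<le> 8 powr \<bar>b\<bar> * ?r powr - b * rho_diag x powr b"
          using r by (simp add: powr_minus field_simps)
        then have "cmod (f x) powr p * 1 \<le> cmod (f x) powr p * (8 powr \<bar>b\<bar> * ?r powr - b * rho_diag x powr b)"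
          by (rule mult_left_mono) simp
        then show ?thesis using True by (simp add: H_def ennreal_mult[symmetric] mult_ac)
      qed (simp add: H_def)
    qed
    also have "\<dots> = ennreal (8 powr \<bar>b\<bar> * ?r powr - b) * J"
      unfolding J_def by (rule nn_integral_cmult) measurable
    finally have "ennreal (K * cmod (f a) powr p) \<le> ennreal (?r powr - ?N) * (ennreal (8 powr \<bar>b\<bar> * ?r powr - b) * J)"
      by (simp add: mult_left_mono)
    then have "ennreal (1 / K) * ennreal (K * cmod (f a) powr p)
        \<le> ennreal (1 / K) * (ennreal (?r powr - ?N) * (ennreal (8 powr \<bar>b\<bar> * ?r powr - b) * J))"
      by (rule mult_left_mono) simp
    also have "ennreal (1 / K) * ennreal (K * cmod (f a) powr p) = ennreal (cmod (f a) powr p)"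
      using K(1) by (simp add: ennreal_mult[symmetric])
    also have "ennreal (1 / K) * (ennreal (?r powr - ?N) * (ennreal (8 powr \<bar>b\<bar> * ?r powr - b) * J))
        = ennreal (1 / K * (?r powr - ?N * (8 powr \<bar>b\<bar> * ?r powr - b))) * J"
      using K(1) by (intro ennreal_mult3) auto
    also have "1 / K * (?r powr - ?N * (8 powr \<bar>b\<bar> * ?r powr - b)) = C * ?r powr - (?N + b)"
      using r by (simp add: C_def powr_diff powr_minus field_simps powr_add)
    finally show ?thesis unfolding J_def .
  qed
  then show ?thesis using C that by blast
qed

subsection \<open>Powers on the extended half-line and Jensen's inequality\<close>

lemma ennpowr_ennreal: "x \<ge> 0 \<Longrightarrow> ennpowr (ennreal x) p = ennreal (x powr p)"
  by (simp add: ennpowr_def)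

lemma ennpowr_top [simp]: "ennpowr \<infinity> p = \<infinity>" "ennpowr top p = top"
  by (simp_all add: ennpowr_def)

lemma ennpowr_0 [simp]: "ennpowr 0 p = 0"
  by (simp add: ennpowr_def)

lemma ennreal_infinity_cases: obtains "x = (\<infinity>::ennreal)" | r where "x = ennreal r" "r \<ge> 0"
  by (metis ennreal_cases infinity_ennreal_def)

lemma ennpowr_mono: "x \<le> y \<Longrightarrow> p > 0 \<Longrightarrow> ennpowr x p \<le> ennpowr y p"
  by (cases x rule: ennreal_infinity_cases; cases y rule: ennreal_infinity_cases)
     (auto simp: ennpowr_ennreal powr_mono2 top_unique ennreal_leI)

lemma ennpowr_ennpowr: "ennpowr (ennpowr x p) q = ennpowr x (p * q)"
  by (cases x rule: ennreal_infinity_cases) (auto simp: ennpowr_ennreal powr_powr)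

lemma ennpowr_1 [simp]: "ennpowr x 1 = x"
  by (cases x rule: ennreal_infinity_cases) (auto simp: ennpowr_ennreal)

lemma ennpowr_cmult: "c > 0 \<Longrightarrow> ennpowr (ennreal c * x) p = ennreal (c powr p) * ennpowr x p"
  by (cases x rule: ennreal_infinity_cases)
     (auto simp: ennpowr_ennreal ennreal_mult[symmetric] powr_mult ennreal_mult_top)

lemma ennpowr_less_top: "ennpowr x p < \<infinity> \<longleftrightarrow> x < \<infinity>"
  by (cases x rule: ennreal_infinity_cases) (auto simp: ennpowr_ennreal)

lemma borel_measurable_ennpowr [measurable (raw)]:
  assumes [measurable]: "g \<in> borel_measurable M"
  shows "(\<lambda>x. ennpowr (g x) p) \<in> borel_measurable M"
  unfolding ennpowr_def by measurable

text \<open>Young's inequality x <= (1/r) c^(1-r) x^r + (1 - 1/r) c is integrated against the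
  weight. The choice c^r = b / A, with b the integral on the right, equalizes the two contributions
  and the sum is c A. Only an upper bound A of the total weight enters; b = 0 is treated apart
  because c would vanish.\<close>

lemma nn_integral_jensen_powr:
  fixes w g :: "'a \<Rightarrow> real"
  assumes [measurable]: "w \<in> borel_measurable M" "g \<in> borel_measurable M"
    and w: "\<And>x. w x \<ge> 0" and g: "\<And>x. g x \<ge> 0" and r: "r \<ge> 1"
    and A: "A > 0" "(\<integral>\<^sup>+x. ennreal (w x) \<partial>M) \<le> ennreal A"
  shows "ennpowr (\<integral>\<^sup>+x. ennreal (w x * g x) \<partial>M) r
      \<le> ennreal (A powr (r - 1)) * (\<integral>\<^sup>+x. ennreal (w x * g x powr r) \<partial>M)"
proof (cases "(\<integral>\<^sup>+x. ennreal (w x * g x powr r) \<partial>M)" rule: ennreal_infinity_cases)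
  case 1
  then show ?thesis using A(1) by (simp add: ennreal_mult_top)
next
  case (2 b)
  have r0: "r > 0" using r by simp
  show ?thesis
  proof (cases "b = 0")
    case True
    then have "(\<integral>\<^sup>+x. ennreal (w x * g x powr r) \<partial>M) = 0" using 2 by simp
    then have "AE x in M. ennreal (w x * g x powr r) = 0"
      by (subst (asm) nn_integral_0_iff_AE) auto
    then have "AE x in M. ennreal (w x * g x) = 0"
      by eventually_elim (use w g r0 in \<open>auto simp: ennreal_eq_0_iff mult_le_0_iff dest: antisym\<close>)
    then have "(\<integral>\<^sup>+x. ennreal (w x * g x) \<partial>M) = 0"
      by (subst nn_integral_0_iff_AE) auto
    then show ?thesis by simp
  next
    case False
    then have b: "b > 0" using 2 by simp
    define c where "c = (b / A) powr (1 / r)"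
    have c: "c > 0" using A b by (simp add: c_def)
    have young: "x \<le> (1/r) * c powr (1 - r) * x powr r + (1 - 1/r) * c" if "x \<ge> 0" for x
    proof (cases "x = 0")
      case True
      then show ?thesis using c r by simp
    next
      case False
      then have x: "x > 0" using that by simp
      have "((x / c) powr r) powr (1/r) * 1 powr (1 - 1/r) \<le> (1/r) * (x / c) powr r + (1 - 1/r) * 1"
        using r x c by (intro Youngs_inequality_0) auto
      then have "x / c \<le> (1/r) * (x / c) powr r + (1 - 1/r)"
        using r0 x c by (simp add: powr_powr)
      then have "c * (x / c) \<le> c * ((1/r) * (x / c) powr r + (1 - 1/r))"
        using c by (intro mult_left_mono) auto
      also have "\<dots> = (1/r) * (c * (x / c) powr r) + (1 - 1/r) * c"
        by (simp add: algebra_simps)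
      also have "c * (x / c) powr r = c powr (1 - r) * x powr r"
        using c x by (simp add: powr_divide powr_diff)
      finally show ?thesis using c by (simp add: mult.assoc)
    qed
    have "(\<integral>\<^sup>+x. ennreal (w x * g x) \<partial>M)
        \<le> (\<integral>\<^sup>+x. ennreal ((1/r) * c powr (1 - r)) * ennreal (w x * g x powr r) + ennreal ((1 - 1/r) * c) * ennreal (w x) \<partial>M)"
    proof (rule nn_integral_mono)
      fix x
      have "w x * g x \<le> w x * ((1/r) * c powr (1 - r) * g x powr r + (1 - 1/r) * c)"
        using young[OF g] w by (intro mult_left_mono) auto
      also have "\<dots> = (1/r) * c powr (1 - r) * (w x * g x powr r) + (1 - 1/r) * c * w x"
        by (simp add: algebra_simps)
      finally show "ennreal (w x * g x) \<le> ennreal ((1/r) * c powr (1 - r)) * ennreal (w x * g x powr r) + ennreal ((1 - 1/r) * c) * ennreal (w x)"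
        using w c r by (simp add: ennreal_mult[symmetric] ennreal_plus[symmetric] ennreal_leI del: ennreal_plus)
    qed
    also have "\<dots> = ennreal ((1/r) * c powr (1 - r)) * ennreal b + ennreal ((1 - 1/r) * c) * (\<integral>\<^sup>+x. ennreal (w x) \<partial>M)"
      by (simp add: nn_integral_add nn_integral_cmult 2)
    also have "\<dots> \<le> ennreal ((1/r) * c powr (1 - r)) * ennreal b + ennreal ((1 - 1/r) * c) * ennreal A"
      by (intro add_left_mono mult_left_mono A) simp
    also have "\<dots> = ennreal ((1/r) * c powr (1 - r) * b + (1 - 1/r) * c * A)"
      using c r b A by (simp add: ennreal_mult[symmetric] ennreal_plus[symmetric] del: ennreal_plus)
    also have "(1/r) * c powr (1 - r) * b + (1 - 1/r) * c * A = c * A"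
    proof -
      have "c powr r = b / A" using A b r0 by (simp add: c_def powr_powr)
      then have "c powr (1 - r) * b = c * A" using c A b by (simp add: powr_diff field_simps)
      then show ?thesis using r0 by (simp add: mult.assoc) (simp add: field_simps)
    qed
    finally have "ennpowr (\<integral>\<^sup>+x. ennreal (w x * g x) \<partial>M) r \<le> ennpowr (ennreal (c * A)) r"
      using r0 by (rule ennpowr_mono)
    also have "\<dots> = ennreal (A powr (r - 1)) * ennreal b"
    proof -
      have "(c * A) powr r = b / A * A powr r"
        using A b r0 by (simp add: c_def powr_powr powr_mult)
      also have "\<dots> = A powr (r - 1) * b" using A by (simp add: powr_diff)
      finally have "(c * A) powr r = A powr (r - 1) * b" .
      moreover have "ennpowr (ennreal (c * A)) r = ennreal ((c * A) powr r)"
        using c A by (intro ennpowr_ennreal) simp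
      ultimately show ?thesis using b by (simp only: ennreal_mult powr_ge_zero less_imp_le)
    qed
    finally show ?thesis by (simp add: 2)
  qed
qed

subsection \<open>Norms as integrals over the domain\<close>

lemma measurable_lebesgue_on_T_B:
  assumes "f \<in> borel_measurable TB_space" shows "f \<in> borel_measurable (lebesgue_on T_B)"
proof -
  have "(\<lambda>x. x) \<in> lebesgue_on T_B \<rightarrow>\<^sub>M (TB_space :: 'a cspace measure)"
    unfolding TB_space_def by (rule measurable_restrict_space3) (auto intro: measurable_completion)
  from measurable_compose[OF this assms] show ?thesis .
qed

text \<open>Completion does not change integrals of Borel functions, so the norms of holomorphic
  functions can be computed with \<open>vol_TB\<close>.\<close>

lemma nn_integral_dV:
  fixes g :: "('n::{finite,linorder}) cspace \<Rightarrow> ennreal"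
  assumes g: "g \<in> borel_measurable TB_space"
  shows "(\<integral>\<^sup>+z. g z \<partial>dV \<alpha>) = (\<integral>\<^sup>+z. ennreal (rho_diag z powr \<alpha>) * g z \<partial>vol_TB)"
proof -
  have "(\<lambda>z :: 'n cspace. ennreal (rho_diag z powr \<alpha>)) \<in> borel_measurable TB_space" by measurable
  from measurable_lebesgue_on_T_B[OF this] measurable_lebesgue_on_T_B[OF g]
  have "(\<integral>\<^sup>+z. g z \<partial>dV \<alpha>) = (\<integral>\<^sup>+z. ennreal (rho_diag z powr \<alpha>) * g z \<partial>lebesgue_on T_B)"
    unfolding dV_def by (rule nn_integral_density)
  also have "\<dots> = (\<integral>\<^sup>+z. ennreal (rho_diag z powr \<alpha>) * g z * indicator T_B z \<partial>lebesgue)"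
    by (rule nn_integral_restrict_space) simp
  also have "\<dots> = (\<integral>\<^sup>+z. ennreal (rho_diag z powr \<alpha>) * g z \<partial>vol_TB)"
    by (simp add: nn_integral_completion nn_integral_vol_TB)
  finally show ?thesis .
qed

lemma Lnorm_ext_eq:
  assumes [measurable]: "g \<in> borel_measurable TB_space"
  shows "Lnorm_ext p \<alpha> g = ennpowr (\<integral>\<^sup>+z. ennreal (rho_diag z powr \<alpha>) * ennpowr (g z) p \<partial>vol_TB) (1/p)"
  unfolding Lnorm_ext_def by (subst nn_integral_dV) auto

lemma Lnorm_eq:
  assumes [measurable]: "f \<in> borel_measurable TB_space"
  shows "Lnorm p \<alpha> f = ennpowr (\<integral>\<^sup>+z. ennreal (cmod (f z) powr p * rho_diag z powr \<alpha>) \<partial>vol_TB) (1/p)"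
  unfolding Lnorm_def by (subst Lnorm_ext_eq) (auto simp: ennpowr_ennreal ennreal_mult mult.commute)

lemma Lnorm_powr:
  assumes "f \<in> borel_measurable TB_space" "p > 0"
  shows "ennpowr (Lnorm p \<alpha> f) q = ennpowr (\<integral>\<^sup>+z. ennreal (cmod (f z) powr p * rho_diag z powr \<alpha>) \<partial>vol_TB) (q/p)"
  using assms by (simp add: Lnorm_eq ennpowr_ennpowr)

lemma Bergman_iff:
  "f \<in> Bergman p \<alpha> \<longleftrightarrow> holomorphic_multi f T_B \<and>
     (\<integral>\<^sup>+z. ennreal (cmod (f z) powr p * rho_diag z powr \<alpha>) \<partial>vol_TB) < \<infinity>"
proof (cases "holomorphic_multi f T_B")
  case True
  then have meas: "f \<in> borel_measurable TB_space" by (rule holomorphic_multi_measurable)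
  show ?thesis
    using True measurable_lebesgue_on_T_B[OF meas]
    by (simp add: Bergman_def Lp_def Lnorm_eq[OF meas] ennpowr_less_top[unfolded infinity_ennreal_def])
qed (simp add: Bergman_def)

subsection \<open>The Carleson embedding\<close>

text \<open>The mean value inequality bounds |F(w)|^p by rho(w)^(-N) times the local integral J(w).
  Its power q/p leaves one factor J(w), the others being bounded by the total integral. After
  Fubini, symmetry of the balls produces \<mu>(E(v)), whose assumed size cancels the power of rho.
  The bound is linear in k.\<close>

lemma carleson_embedding:
  fixes p q a :: real
  assumes p: "0 < p" "p \<le> q"
  obtains C where "C > 0"
    "\<And>\<mu> F k. sets \<mu> = sets TB_space \<Longrightarrow> sigma_finite_measure \<mu> \<Longrightarrow> holomorphic_multi F T_B \<Longrightarrow> k > 0 \<Longrightarrow>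
      (\<And>z. z \<in> T_B \<Longrightarrow> emeasure \<mu> (bergman_ball z) \<le> ennreal (k * rho_diag z powr ((real CARD('n) + 1 + a) * (q / p)))) \<Longrightarrow>
      (\<integral>\<^sup>+w. ennreal (cmod (F w) powr q) \<partial>\<mu>)
        \<le> ennreal (C * k) * ennpowr (\<integral>\<^sup>+w. ennreal (cmod (F w) powr p * rho_diag w powr a) \<partial>(vol_TB :: ('n::{finite,linorder}) cspace measure)) (q / p)"
proof -
  let ?V = "vol_TB :: 'n cspace measure"
  \<comment> \<open>Inside this proof \<open>N\<close> includes the weight exponent a.\<close>
  define N where "N = real CARD('n) + 1 + a"
  define r where "r = q / p"
  have r: "r \<ge> 1" using p by (simp add: r_def)
  obtain c where c: "c > 0" "\<And>f (x :: 'n cspace). holomorphic_multi f T_B \<Longrightarrow> x \<in> T_B \<Longrightarrow>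
      ennreal (cmod (f x) powr p) \<le> ennreal (c * rho_diag x powr - N) *
        (\<integral>\<^sup>+w. ennreal (cmod (f w) powr p * rho_diag w powr a) * indicator (bergman_ball x) w \<partial>?V)"
    unfolding N_def using bergman_mean_inequality[OF p(1), of a] by blast
  define C where "C = c powr r * 8 powr \<bar>N * r\<bar>"
  have C: "C > 0" using c by (simp add: C_def)
  have "(\<integral>\<^sup>+w. ennreal (cmod (F w) powr q) \<partial>\<mu>)
        \<le> ennreal (C * k) * ennpowr (\<integral>\<^sup>+w. ennreal (cmod (F w) powr p * rho_diag w powr a) \<partial>?V) r"
    if sets[measurable_cong]: "sets \<mu> = sets TB_space" and sf: "sigma_finite_measure \<mu>" and F: "holomorphic_multi F T_B" and k: "k > 0"
      and \<mu>: "\<And>z. z \<in> T_B \<Longrightarrow> emeasure \<mu> (bergman_ball z) \<le> ennreal (k * rho_diag z powr (N * r))"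
    for \<mu> :: "'n cspace measure" and F k
  proof -
    have space: "space \<mu> = T_B" using sets by (rule space_eq_T_B)
    have F_meas[measurable]: "F \<in> borel_measurable TB_space" using F by (rule holomorphic_multi_measurable)
    define h where "h w = ennreal (cmod (F w) powr p * rho_diag w powr a)" for w
    have h_meas[measurable]: "h \<in> borel_measurable TB_space" unfolding h_def by measurable
    show ?thesis
    proof (cases "(\<integral>\<^sup>+w. h w \<partial>?V)" rule: ennreal_infinity_cases)
      case 1
      then show ?thesis using C k by (simp add: h_def ennreal_mult_top)
    next
      case (2 i)
      define J where "J w = (\<integral>\<^sup>+v. h v * indicator (bergman_ball w) v \<partial>?V)" for w
      define K where "K w = c powr r * i powr (r - 1) * rho_diag w powr - (N * r)" for w :: "'n cspace"
      have pointwise: "ennreal (cmod (F w) powr q) \<le> ennreal (K w) * J w" if w: "w \<in> T_B" for w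
      proof -
        have rw: "rho_diag w > 0" using w by (simp add: T_B_iff)
        have "J w \<le> (\<integral>\<^sup>+v. h v \<partial>?V)"
          unfolding J_def by (rule nn_integral_mono) (auto simp: indicator_def)
        then have "J w \<le> ennreal i" by (simp add: 2)
        then obtain j where j: "J w = ennreal j" "0 \<le> j" "j \<le> i"
          using 2(2) by (cases "J w" rule: ennreal_infinity_cases) (auto simp: top_unique)
        have "ennreal (cmod (F w) powr p) \<le> ennreal (c * rho_diag w powr - N) * J w"
          using c(2)[OF F w] by (simp add: J_def h_def)
        then have le: "cmod (F w) powr p \<le> c * rho_diag w powr - N * j"
          using c(1) j by (simp add: ennreal_mult[symmetric])
        have "cmod (F w) powr q = (cmod (F w) powr p) powr r"
          using p by (simp add: powr_powr r_def)
        also have "\<dots> \<le> (c * rho_diag w powr - N * j) powr r"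
          using le r by (intro powr_mono2) auto
        also have "\<dots> = c powr r * rho_diag w powr - (N * r) * j powr r"
          using c(1) j rw by (simp add: powr_mult powr_powr)
        \<comment> \<open>This is where p <= q enters: the exponent r - 1 is nonnegative, so j^(r-1)
          may be replaced by i^(r-1).\<close>
        also have "\<dots> \<le> c powr r * rho_diag w powr - (N * r) * (i powr (r - 1) * j)"
        proof (cases "j = 0")
          case False
          then have "j powr r = j powr (r - 1) * j" using j by (simp add: powr_diff)
          also have "\<dots> \<le> i powr (r - 1) * j" using j r by (intro mult_right_mono powr_mono2) auto
          finally show ?thesis using c(1) by (intro mult_left_mono) auto
        qed simp
        also have "\<dots> = K w * j" by (simp add: K_def)
        finally show ?thesis using j c(1) by (simp add: ennreal_mult[symmetric] K_def ennreal_leI)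
      qed
      interpret \<mu>: sigma_finite_measure \<mu> by (rule sf)
      interpret V: sigma_finite_measure ?V by (rule sigma_finite_vol_TB)
      interpret P: pair_sigma_finite ?V \<mu> ..
      have K_meas[measurable]: "K \<in> borel_measurable TB_space" unfolding K_def by measurable
      have "(\<integral>\<^sup>+w. ennreal (cmod (F w) powr q) \<partial>\<mu>) \<le> (\<integral>\<^sup>+w. ennreal (K w) * J w \<partial>\<mu>)"
        by (rule nn_integral_mono) (simp add: space pointwise)
      also have "\<dots> = (\<integral>\<^sup>+w. (\<integral>\<^sup>+v. h v * (if v \<in> bergman_ball w then ennreal (K w) else 0) \<partial>?V) \<partial>\<mu>)"
      proof (rule nn_integral_cong)
        fix w
        have [measurable]: "(\<lambda>v. h v * indicator (bergman_ball w) v) \<in> borel_measurable TB_space"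
          by (intro borel_measurable_times_ennreal h_meas borel_measurable_indicator bergman_ball_sets)
        show "ennreal (K w) * J w = (\<integral>\<^sup>+v. h v * (if v \<in> bergman_ball w then ennreal (K w) else 0) \<partial>?V)"
          unfolding J_def
          by (subst nn_integral_cmult[symmetric]) (auto intro!: nn_integral_cong simp: indicator_def mult.commute)
      qed
      also have "\<dots> = (\<integral>\<^sup>+v. (\<integral>\<^sup>+w. h v * (if v \<in> bergman_ball w then ennreal (K w) else 0) \<partial>\<mu>) \<partial>?V)"
        by (rule P.Fubini') measurable
      also have "\<dots> \<le> (\<integral>\<^sup>+v. ennreal (C * k * i powr (r - 1)) * h v \<partial>?V)"
      proof (rule nn_integral_mono)
        fix v assume "v \<in> space ?V"
        then have v: "v \<in> T_B" by (simp add: space_vol_TB)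
        define L where "L = c powr r * i powr (r - 1) * (8 powr \<bar>N * r\<bar> * rho_diag v powr - (N * r))"
        have rv: "rho_diag v > 0" using v by (simp add: T_B_iff)
        have L: "L \<ge> 0" using c(1) by (simp add: L_def)
        have "(\<integral>\<^sup>+w. h v * (if v \<in> bergman_ball w then ennreal (K w) else 0) \<partial>\<mu>)
            \<le> (\<integral>\<^sup>+w. h v * ennreal L * indicator (bergman_ball v) w \<partial>\<mu>)"
        proof (rule nn_integral_mono)
          fix w assume "w \<in> space \<mu>"
          then have w: "w \<in> T_B" by (simp add: space)
          then have rw: "rho_diag w > 0" by (simp add: T_B_iff)
          have "K w \<le> L" if "w \<in> bergman_ball v"
          proof -
            have "rho_diag w powr - (N * r) \<le> 8 powr \<bar>- (N * r)\<bar> * rho_diag v powr - (N * r)"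
              using rv rw bergman_ball_rho_diag_le[OF v that] bergman_ball_rho_diag_ge[OF v that]
              by (intro powr_comparable) auto
            then show ?thesis unfolding K_def L_def using c(1) by (intro mult_left_mono) auto
          qed
          \<comment> \<open>Symmetry turns v in E(w), a condition for varying w, into w in E(v), a
            single set to be measured by \<mu>.\<close>
          then show "h v * (if v \<in> bergman_ball w then ennreal (K w) else 0) \<le> h v * ennreal L * indicator (bergman_ball v) w"
            using bergman_ball_sym[OF w, of v] v by (auto intro!: mult_left_mono ennreal_leI)
        qed
        also have "\<dots> = h v * ennreal L * emeasure \<mu> (bergman_ball v)"
          by (rule nn_integral_cmult_indicator) (simp add: sets bergman_ball_sets)
        also have "\<dots> \<le> h v * ennreal L * ennreal (k * rho_diag v powr (N * r))"
          by (intro mult_left_mono \<mu>[OF v]) simp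
        also have "\<dots> = ennreal (L * (k * rho_diag v powr (N * r))) * h v"
          using L k by (simp add: ennreal_mult mult_ac)
        also have "L * (k * rho_diag v powr (N * r)) = C * k * i powr (r - 1)"
          using rv by (simp add: L_def C_def powr_minus)
        finally show "(\<integral>\<^sup>+w. h v * (if v \<in> bergman_ball w then ennreal (K w) else 0) \<partial>\<mu>)
            \<le> ennreal (C * k * i powr (r - 1)) * h v" .
      qed
      also have "\<dots> = ennreal (C * k * i powr (r - 1)) * ennreal i"
        by (simp add: nn_integral_cmult 2)
      also have "\<dots> = ennreal (C * k * i powr r)"
      proof (cases "i = 0")
        case False
        then have "i powr (r - 1) * i = i powr r" using 2(2) by (simp add: powr_diff)
        then show ?thesis using C k 2(2) by (simp add: ennreal_mult[symmetric] mult.assoc)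
      qed simp
      also have "\<dots> = ennreal (C * k) * ennpowr (\<integral>\<^sup>+w. h w \<partial>?V) r"
        using C k 2 by (simp add: ennpowr_ennreal ennreal_mult)
      finally show ?thesis by (simp add: h_def)
    qed
  qed
  then show ?thesis using C that unfolding N_def r_def by blast
qed

subsection \<open>The kernel as a holomorphic function\<close>

lemma holomorphic_multi_const: "holomorphic_multi (\<lambda>_. c) S"
  unfolding holomorphic_multi_def by (auto intro!: exI[of _ "\<lambda>_. 0"])

lemma holomorphic_multi_add:
  assumes "holomorphic_multi f S" "holomorphic_multi g S"
  shows "holomorphic_multi (\<lambda>z. f z + g z) S"
  unfolding holomorphic_multi_def
proof
  fix z assume z: "z \<in> S"
  obtain D where D: "(f has_derivative D) (at z)" "\<And>c v. D (c *s v) = c * D v"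
    using assms(1) z unfolding holomorphic_multi_def by blast
  obtain D' where D': "(g has_derivative D') (at z)" "\<And>c v. D' (c *s v) = c * D' v"
    using assms(2) z unfolding holomorphic_multi_def by blast
  show "\<exists>D. ((\<lambda>z. f z + g z) has_derivative D) (at z) \<and> (\<forall>c v. D (c *s v) = c * D v)"
    using has_derivative_add[OF D(1) D'(1)] D(2) D'(2)
    by (intro exI[of _ "\<lambda>h. D h + D' h"]) (auto simp: algebra_simps)
qed

lemma holomorphic_multi_sum:
  "finite A \<Longrightarrow> (\<And>j. j \<in> A \<Longrightarrow> holomorphic_multi (f j) S) \<Longrightarrow> holomorphic_multi (\<lambda>z. \<Sum>j\<in>A. f j z) S"
  by (induction A rule: finite_induct) (auto intro: holomorphic_multi_const holomorphic_multi_add)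

lemma holomorphic_multi_nth: "holomorphic_multi (\<lambda>z. z $ j) S"
  unfolding holomorphic_multi_def
  by (auto intro!: exI[of _ "\<lambda>v. v $ j"] bounded_linear_imp_has_derivative bounded_linear_vec_nth)

lemma holomorphic_multi_rho: "holomorphic_multi (\<lambda>w. rho w z) S"
proof -
  have "(\<lambda>w. rho w z) = (\<lambda>w. 1/4 * ((\<Sum>j\<in>UNIV - {last_ix}. (w $ j + - cnj (z $ j)) ^ 2) + (- 2 * \<i>) * (w $ last_ix + - cnj (z $ last_ix))))"
    by (simp add: rho_def algebra_simps)
  then show ?thesis
    by (simp only:) (intro holomorphic_multi_mult holomorphic_multi_const holomorphic_multi_add
        holomorphic_multi_sum holomorphic_multi_power holomorphic_multi_nth finite_Diff finite)
qed

lemma holomorphic_multi_compose_field: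
  assumes f: "holomorphic_multi f S" and g: "\<And>z. z \<in> S \<Longrightarrow> \<exists>g'. (g has_field_derivative g') (at (f z))"
  shows "holomorphic_multi (\<lambda>z. g (f z)) S"
  unfolding holomorphic_multi_def
proof
  fix z assume z: "z \<in> S"
  obtain D where D: "(f has_derivative D) (at z)" "\<And>c v. D (c *s v) = c * D v"
    using f z unfolding holomorphic_multi_def by blast
  obtain g' where "(g has_derivative (*) g') (at (f z))"
    using g[OF z] unfolding has_field_derivative_def by blast
  from has_derivative_compose[OF D(1) this]
  show "\<exists>D. ((\<lambda>z. g (f z)) has_derivative D) (at z) \<and> (\<forall>c v. D (c *s v) = c * D v)"
    by (intro exI conjI) (auto simp: D(2))
qed

lemma holomorphic_multi_kernel:
  assumes z: "z \<in> T_B"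
  shows "holomorphic_multi (\<lambda>w. rho w z powr c) T_B"
proof (rule holomorphic_multi_compose_field[OF holomorphic_multi_rho])
  fix w :: "'a cspace" assume "w \<in> T_B"
  then have "Re (rho w z) > 0" using z by (rule Re_rho_pos)
  then have "rho w z \<notin> \<real>\<^sub>\<le>\<^sub>0" by (auto simp: complex_nonpos_Reals_iff)
  then show "\<exists>g'. ((\<lambda>x. x powr c) has_field_derivative g') (at (rho w z))"
    by (auto intro: has_field_derivative_powr)
qed

lemma cmod_powr_rho:
  assumes "z \<in> T_B" "w \<in> T_B"
  shows "cmod (rho z w powr complex_of_real c) = cmod (rho z w) powr c"
proof -
  have "rho z w \<noteq> 0" using cmod_rho_pos[OF assms] by auto
  then show ?thesis by (simp add: norm_powr_real_powr')
qed

subsection \<open>Boundedness of the Berezin-type operator\<close>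

text \<open>The kernel is rewritten with \<open>rho w z\<close>, which is holomorphic in w, in place
  of \<open>rho z w\<close>, which is antiholomorphic in w. The integrand becomes the modulus of one
  holomorphic function, to which the Carleson embedding applies.\<close>

lemma berezin_eq:
  fixes z :: "('n::{finite,linorder}) cspace"
  assumes sets: "sets \<mu> = sets TB_space" and z: "z \<in> T_B"
  shows "berezin \<mu> \<xi> f z = (\<integral>\<^sup>+w. ennreal (cmod (f w * rho w z powr complex_of_real (- (real CARD('n) + 1 + \<xi>)))) \<partial>\<mu>)"
  unfolding berezin_def
proof (rule nn_integral_cong)
  fix w assume "w \<in> space \<mu>"
  then have w: "w \<in> T_B" using sets_eq_imp_space_eq[OF sets] by (simp add: space_TB_space)
  show "ennreal (cmod (f w) / cmod (rho z w) powr (real CARD('n) + 1 + \<xi>))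
      = ennreal (cmod (f w * rho w z powr complex_of_real (- (real CARD('n) + 1 + \<xi>))))"
    unfolding norm_mult cmod_powr_rho[OF w z] cmod_rho_commute[of w z] powr_minus_divide by simp
qed

lemma holomorphic_multi_mult_kernel:
  assumes "holomorphic_multi f T_B" "z \<in> T_B"
  shows "holomorphic_multi (\<lambda>w. f w * rho w z powr c) T_B"
  using assms by (intro holomorphic_multi_mult holomorphic_multi_kernel)

lemma borel_measurable_berezin:
  assumes sets[measurable_cong]: "sets \<mu> = sets TB_space" and sf: "sigma_finite_measure \<mu>"
    and f: "holomorphic_multi f T_B"
  shows "berezin \<mu> \<xi> f \<in> borel_measurable TB_space"
proof -
  interpret sigma_finite_measure \<mu> by fact
  have [measurable]: "f \<in> borel_measurable TB_space" using f by (rule holomorphic_multi_measurable)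
  show ?thesis unfolding berezin_def by measurable
qed

text \<open>A common form for p1 <= 1 and p1 > 1. The two inequalities on e and \<sigma> make the
  later integration in z a convergent Forelli--Rudin integral, and the balance equation makes the
  resulting power of rho(v) equal to \<alpha>1. For p1 <= 1 the embedding from exponent p1 to 1 is
  enough; for p1 > 1 it is used with p = q = 1, followed by Jensen.\<close>

lemma berezin_pointwise:
  fixes p1 p2 \<alpha>1 \<alpha>2 \<xi> N s \<kappa> :: real
  assumes N: "N = real CARD('n) + 1" and s: "s = N + \<xi>"
    and \<kappa>: "\<kappa> = s + (N + \<alpha>1) / p1 - (N + \<alpha>2) / p2"
    and p: "0 < p1" "p1 \<le> p2" and \<alpha>2: "-1 < \<alpha>2"
    and cond: "s > (N - 1) * max 1 (1 / p2) + (1 + \<alpha>2) / p2"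
  obtains C e \<sigma> a where "C > 0" "\<alpha>2 + e * (p2 / p1) > -1" "\<sigma> * (p2 / p1) > N + \<alpha>2 + e * (p2 / p1)"
    "(a - \<alpha>1) * (p2 / p1) + N + \<alpha>2 + e * (p2 / p1) - \<sigma> * (p2 / p1) = 0"
    "\<And>\<mu> f k z. sets \<mu> = sets TB_space \<Longrightarrow> sigma_finite_measure \<mu> \<Longrightarrow> holomorphic_multi f T_B \<Longrightarrow> k > 0 \<Longrightarrow>
      (\<And>z. z \<in> T_B \<Longrightarrow> emeasure \<mu> (bergman_ball z) \<le> ennreal (k * rho_diag z powr \<kappa>)) \<Longrightarrow> z \<in> T_B \<Longrightarrow>
      ennpowr (berezin \<mu> \<xi> f z) p1 \<le> ennreal (C * k powr p1 * rho_diag z powr e) *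
        (\<integral>\<^sup>+v. ennreal (cmod (f v) powr p1 * cmod (rho z v) powr (- \<sigma>) * rho_diag v powr a) \<partial>(vol_TB :: ('n::{finite,linorder}) cspace measure))"
proof (cases "p1 \<le> 1")
  case True
  let ?V = "vol_TB :: 'n cspace measure"
  \<comment> \<open>Solves (N + a) / p1 = \<kappa>, so that the hypothesis on \<mu> is the ball
    condition of the embedding.\<close>
  let ?a = "p1 * \<kappa> - N"
  have p2: "p2 > 0" using p by simp
  have n1: "N - 1 \<ge> 1" using N by (simp add: Suc_leI)
  obtain C where C: "C > 0"
    "\<And>\<mu> F k. sets \<mu> = sets TB_space \<Longrightarrow> sigma_finite_measure \<mu> \<Longrightarrow> holomorphic_multi F T_B \<Longrightarrow> k > 0 \<Longrightarrow>
      (\<And>z. z \<in> T_B \<Longrightarrow> emeasure \<mu> (bergman_ball z) \<le> ennreal (k * rho_diag z powr ((N + ?a) * (1 / p1)))) \<Longrightarrow>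
      (\<integral>\<^sup>+w. ennreal (cmod (F w) powr 1) \<partial>\<mu>)
        \<le> ennreal (C * k) * ennpowr (\<integral>\<^sup>+w. ennreal (cmod (F w) powr p1 * rho_diag w powr ?a) \<partial>?V) (1 / p1)"
    unfolding N using carleson_embedding[OF p(1) True, of "p1 * \<kappa> - (real CARD('n) + 1)"] by blast
  have ka: "(N + ?a) * (1 / p1) = \<kappa>" using p by simp
  have big: "s * p2 > N + \<alpha>2"
  proof -
    have "(N - 1) * (1 / p2) \<le> (N - 1) * max 1 (1 / p2)" using n1 by (intro mult_left_mono) auto
    then have "s > (N - 1) / p2 + (1 + \<alpha>2) / p2" using cond by simp
    moreover have "(N - 1) / p2 + (1 + \<alpha>2) / p2 = (N + \<alpha>2) / p2"
      by (simp add: add_divide_distrib[symmetric])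
    ultimately show ?thesis using p2 by (simp add: pos_divide_less_eq)
  qed
  show ?thesis
  proof (rule that[of "C powr p1" 0 "s * p1" "?a"])
    show "C powr p1 > 0" using C by simp
    show "\<alpha>2 + 0 * (p2 / p1) > -1" using \<alpha>2 by simp
    show "s * p1 * (p2 / p1) > N + \<alpha>2 + 0 * (p2 / p1)" using p big by simp
    show "(?a - \<alpha>1) * (p2 / p1) + N + \<alpha>2 + 0 * (p2 / p1) - s * p1 * (p2 / p1) = 0"
      using p p2 unfolding \<kappa> by (simp add: field_simps)
    fix \<mu> :: "'n cspace measure" and f :: "'n cspace \<Rightarrow> complex" and k and z :: "'n cspace"
    assume sets: "sets \<mu> = sets TB_space" and sf: "sigma_finite_measure \<mu>" and f: "holomorphic_multi f T_B"
      and k: "k > 0" and \<mu>: "\<And>z. z \<in> T_B \<Longrightarrow> emeasure \<mu> (bergman_ball z) \<le> ennreal (k * rho_diag z powr \<kappa>)"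
      and z: "z \<in> T_B"
    define F where "F w = f w * rho w z powr complex_of_real (- s)" for w
    have F: "holomorphic_multi F T_B" unfolding F_def using f z by (rule holomorphic_multi_mult_kernel)
    define I where "I = (\<integral>\<^sup>+w. ennreal (cmod (F w) powr p1 * rho_diag w powr ?a) \<partial>?V)"
    have "berezin \<mu> \<xi> f z = (\<integral>\<^sup>+w. ennreal (cmod (F w) powr 1) \<partial>\<mu>)"
      unfolding berezin_eq[OF sets z] by (simp add: F_def s N)
    also have "\<dots> \<le> ennreal (C * k) * ennpowr I (1 / p1)"
      unfolding I_def by (rule C(2)[OF sets sf F k]) (simp only: ka \<mu>)
    finally have "ennpowr (berezin \<mu> \<xi> f z) p1 \<le> ennpowr (ennreal (C * k) * ennpowr I (1 / p1)) p1"
      using p(1) by (rule ennpowr_mono)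
    also have "\<dots> = ennreal (C powr p1 * k powr p1) * I"
      using C(1) k p by (subst ennpowr_cmult) (auto simp: ennpowr_ennpowr powr_mult)
    also have "I = (\<integral>\<^sup>+v. ennreal (cmod (f v) powr p1 * cmod (rho z v) powr (- (s * p1)) * rho_diag v powr ?a) \<partial>?V)"
      unfolding I_def
    proof (rule nn_integral_cong)
      fix v :: "'n cspace" assume "v \<in> space ?V"
      then have v: "v \<in> T_B" by (simp add: space_vol_TB)
      have "cmod (F v) powr p1 = cmod (f v) powr p1 * cmod (rho z v) powr (- (s * p1))"
        unfolding F_def norm_mult cmod_powr_rho[OF v z] cmod_rho_commute[of v z]
        by (simp add: powr_mult powr_powr)
      then show "ennreal (cmod (F v) powr p1 * rho_diag v powr ?a)
        = ennreal (cmod (f v) powr p1 * cmod (rho z v) powr (- (s * p1)) * rho_diag v powr ?a)" by simp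
    qed
    finally show "ennpowr (berezin \<mu> \<xi> f z) p1 \<le> ennreal (C powr p1 * k powr p1 * rho_diag z powr 0) *
        (\<integral>\<^sup>+v. ennreal (cmod (f v) powr p1 * cmod (rho z v) powr (- (s * p1)) * rho_diag v powr ?a) \<partial>?V)"
      using z by (simp add: T_B_iff)
  qed
next
  case False
  let ?V = "vol_TB :: 'n cspace measure"
  have p1: "p1 > 1" and p2: "p2 > 1" using p False by auto
  have n1: "N - 1 \<ge> 1" using N by (simp add: Suc_leI)
  define q where "q = p1 / (p1 - 1)"
  have q: "q > 0" "q * (p1 - 1) = p1" using p1 by (simp_all add: q_def)
  define \<theta> where "\<theta> = 1 - 1 / p1"
  have \<theta>: "\<theta> > 0" "\<theta> * q = 1" "\<theta> * p1 = p1 - 1" using p1 by (simp_all add: \<theta>_def q_def field_simps)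
  text \<open>In Jensen's inequality below the weight \<open>\<rho>(v)\<^bsup>bq\<^esup> |\<rho>(z,v)|\<^bsup>-tq\<^esup>\<close> is used, where \<open>q\<close> is the exponent
    conjugate to \<open>p\<^sub>1\<close>; \<open>b\<close> and \<open>t\<close> are midpoints of the intervals where all integrals converge.\<close>
  define X where "X = s - (N + \<alpha>2) / p2 - N * \<theta>"
  define b where "b = (- \<theta> + X) / 2"
  define t where "t = b + N * \<theta> + (1 + \<alpha>2) / (2 * p2)"
  \<comment> \<open>The interval for b is nonempty precisely by this inequality. It uses p1 <= p2 in
    the form 1/p2 + \<theta> <= 1, together with max(1, 1/p2) = 1.\<close>
  have gap: "s > (N + \<alpha>2) / p2 + (N - 1) * \<theta>"
  proof -
    have "1 / p2 \<le> 1 / p1" using p by (simp add: field_simps)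
    then have "(N - 1) * (1 / p2 + \<theta>) \<le> (N - 1) * 1"
      using n1 by (intro mult_left_mono) (auto simp: \<theta>_def)
    moreover have "max 1 (1 / p2) = 1" using p2 by simp
    moreover have "(N + \<alpha>2) / p2 = (N - 1) * (1 / p2) + (1 + \<alpha>2) / p2"
      by (simp add: add_divide_distrib[symmetric])
    ultimately show ?thesis using cond by (simp add: algebra_simps)
  qed
  have "- \<theta> < X" using gap by (simp add: X_def algebra_simps)
  then have b1: "b > - \<theta>" and "b < X" unfolding b_def by simp_all
  then have b2: "b < s - (N + \<alpha>2) / p2 - N * \<theta>" by (simp add: X_def)
  have half: "x / p2 = 2 * (x / (2 * p2))" for x by simp
  have pos: "(1 + \<alpha>2) / (2 * p2) > 0" using p2 \<alpha>2 by simp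
  have t1: "t > N * \<theta> + b" using pos unfolding t_def by linarith
  have t2: "t < (1 + \<alpha>2) / p2 + N * \<theta> + b" using pos half[of "1 + \<alpha>2"] unfolding t_def by linarith
  have bq: "b * q > -1"
  proof -
    have "- \<theta> * q < b * q" using b1 q by (intro mult_strict_right_mono) auto
    then show ?thesis using \<theta> by simp
  qed
  have tq: "t * q > N + b * q"
  proof -
    have "(N * \<theta> + b) * q < t * q" using t1 q by (intro mult_strict_right_mono) auto
    then show ?thesis using \<theta> by (simp add: algebra_simps)
  qed
  \<comment> \<open>These exponents are read off from the Jensen step: e is the power of rho(z) in
    \<open>A powr (p1 - 1)\<close>, while -\<sigma> and a are the powers of |rho(z,v)| and rho(v) in
    \<open>w v * g v powr p1\<close>.\<close>
  define e where "e = N * (p1 - 1) + (b - t) * p1"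
  define \<sigma> where "\<sigma> = p1 * (s - t)"
  define a where "a = p1 * (\<kappa> - N - b)"
  have er: "e * (p2 / p1) = p2 * (N * \<theta> + b - t)"
    using p1 by (simp add: e_def \<theta>_def field_simps)
  have sr: "\<sigma> * (p2 / p1) = p2 * (s - t)" using p1 by (simp add: \<sigma>_def)
  obtain C1 where C1: "C1 > 0"
    "\<And>\<mu> F k. sets \<mu> = sets TB_space \<Longrightarrow> sigma_finite_measure \<mu> \<Longrightarrow> holomorphic_multi F T_B \<Longrightarrow> k > 0 \<Longrightarrow>
      (\<And>z. z \<in> T_B \<Longrightarrow> emeasure \<mu> (bergman_ball z) \<le> ennreal (k * rho_diag z powr ((N + (\<kappa> - N)) * (1 / 1)))) \<Longrightarrow>
      (\<integral>\<^sup>+w. ennreal (cmod (F w) powr 1) \<partial>\<mu>)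
        \<le> ennreal (C1 * k) * ennpowr (\<integral>\<^sup>+w. ennreal (cmod (F w) powr 1 * rho_diag w powr (\<kappa> - N)) \<partial>?V) (1 / 1)"
    unfolding N using carleson_embedding[OF zero_less_one order_refl, of "\<kappa> - (real CARD('n) + 1)", where 'n='n] by blast
  have tq': "t * q > real CARD('n) + 1 + b * q" using tq N by simp
  obtain C2 where C2: "C2 > 0"
    "\<And>z. z \<in> T_B \<Longrightarrow> (\<integral>\<^sup>+w. ennreal (rho_diag w powr (b * q) * cmod (rho z w) powr (- (t * q))) \<partial>?V)
        \<le> ennreal (C2 * rho_diag z powr (N + b * q - t * q))"
    unfolding N using forelli_rudin[OF bq tq'] by blast
  have cancel: "p2 * (x / p2) = x" for x using p2 by simp
  show ?thesis
  proof (rule that[of "C1 powr p1 * C2 powr (p1 - 1)" e \<sigma> a])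
    show "C1 powr p1 * C2 powr (p1 - 1) > 0" using C1 C2 by simp
    show "\<alpha>2 + e * (p2 / p1) > -1"
    proof -
      have "p2 * t < p2 * ((1 + \<alpha>2) / p2 + N * \<theta> + b)" using t2 p2 by (intro mult_strict_left_mono) auto
      then have "p2 * t < (1 + \<alpha>2) + p2 * (N * \<theta>) + p2 * b" by (simp only: distrib_left cancel)
      then show ?thesis unfolding er by (simp add: algebra_simps)
    qed
    show "\<sigma> * (p2 / p1) > N + \<alpha>2 + e * (p2 / p1)"
    proof -
      have "p2 * b < p2 * (s - (N + \<alpha>2) / p2 - N * \<theta>)" using b2 p2 by (intro mult_strict_left_mono) auto
      then have "p2 * b < p2 * s - (N + \<alpha>2) - p2 * (N * \<theta>)" by (simp only: right_diff_distrib cancel)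
      then show ?thesis unfolding er sr by (simp add: algebra_simps)
    qed
    show "(a - \<alpha>1) * (p2 / p1) + N + \<alpha>2 + e * (p2 / p1) - \<sigma> * (p2 / p1) = 0"
      unfolding er sr using p1 p2 unfolding a_def \<kappa> \<theta>_def by (simp add: field_simps)
    fix \<mu> :: "'n cspace measure" and f :: "'n cspace \<Rightarrow> complex" and k and z :: "'n cspace"
    assume sets: "sets \<mu> = sets TB_space" and sf: "sigma_finite_measure \<mu>" and f: "holomorphic_multi f T_B"
      and k: "k > 0" and \<mu>: "\<And>z. z \<in> T_B \<Longrightarrow> emeasure \<mu> (bergman_ball z) \<le> ennreal (k * rho_diag z powr \<kappa>)"
      and z: "z \<in> T_B"
    have [measurable]: "f \<in> borel_measurable TB_space" using f by (rule holomorphic_multi_measurable)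
    have rz: "rho_diag z > 0" using z by (simp add: T_B_iff)
    define F where "F w = f w * rho w z powr complex_of_real (- s)" for w
    have F: "holomorphic_multi F T_B" unfolding F_def using f z by (rule holomorphic_multi_mult_kernel)
    \<comment> \<open>The integrand |f| |rho(z,.)|^(-s) rho^(\<kappa>-N) is split so that the weight
      has a Forelli--Rudin integral; Jensen with this weight amounts to a weighted Hoelder
      inequality.\<close>
    define w where "w v = rho_diag v powr (b * q) * cmod (rho z v) powr (- (t * q))" for v
    define g where "g v = cmod (f v) * rho_diag v powr (\<kappa> - N - b * q) * cmod (rho z v) powr (t * q - s)" for v
    define A where "A = C2 * rho_diag z powr (N + b * q - t * q)"
    have A: "A > 0" "(\<integral>\<^sup>+v. ennreal (w v) \<partial>?V) \<le> ennreal A"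
      using C2 z rz by (auto simp: A_def w_def)
    have meas[measurable]: "w \<in> borel_measurable ?V" "g \<in> borel_measurable ?V"
      unfolding w_def g_def by measurable
    have wg: "w v * g v = cmod (F v) powr 1 * rho_diag v powr (\<kappa> - N)"
      and wgp: "w v * g v powr p1 = cmod (f v) powr p1 * cmod (rho z v) powr (- \<sigma>) * rho_diag v powr a"
      if v: "v \<in> T_B" for v
    proof -
      define x where "x = rho_diag v"
      define y where "y = cmod (rho z v)"
      have x: "x > 0" and y: "y > 0" using v cmod_rho_pos[OF z v] by (simp_all add: T_B_iff x_def y_def)
      have "cmod (F v) = cmod (f v) * y powr (- s)"
        unfolding F_def norm_mult cmod_powr_rho[OF v z] cmod_rho_commute[of v z] y_def by simp
      moreover have "x powr (b * q) * x powr (\<kappa> - N - b * q) = x powr (\<kappa> - N)"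
        by (simp add: powr_add[symmetric])
      moreover have "y powr (- (t * q)) * y powr (t * q - s) = y powr (- s)"
        by (simp add: powr_add[symmetric])
      moreover have "w v * g v = cmod (f v) * (y powr (- (t * q)) * y powr (t * q - s)) * (x powr (b * q) * x powr (\<kappa> - N - b * q))"
        by (simp add: w_def g_def x_def y_def mult_ac)
      ultimately show "w v * g v = cmod (F v) powr 1 * rho_diag v powr (\<kappa> - N)"
        by (simp add: x_def)
      have "b * q + (\<kappa> - N - b * q) * p1 = p1 * (\<kappa> - N) - b * (q * (p1 - 1))" by (simp add: algebra_simps)
      then have 1: "b * q + (\<kappa> - N - b * q) * p1 = a" unfolding q(2) a_def by (simp add: algebra_simps)
      have "- (t * q) + (t * q - s) * p1 = t * (q * (p1 - 1)) - s * p1" by (simp add: algebra_simps)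
      then have 2: "- (t * q) + (t * q - s) * p1 = - \<sigma>" unfolding q(2) \<sigma>_def by (simp add: algebra_simps)
      have "w v * g v powr p1 = cmod (f v) powr p1 * (y powr (- (t * q)) * y powr ((t * q - s) * p1)) *
          (x powr (b * q) * x powr ((\<kappa> - N - b * q) * p1))"
        using x y by (simp add: w_def g_def x_def[symmetric] y_def[symmetric] powr_mult powr_powr mult_ac)
      then show "w v * g v powr p1 = cmod (f v) powr p1 * cmod (rho z v) powr (- \<sigma>) * rho_diag v powr a"
        unfolding powr_add[symmetric] 1 2 x_def y_def .
    qed
    define I where "I = (\<integral>\<^sup>+v. ennreal (w v * g v) \<partial>?V)"
    have "berezin \<mu> \<xi> f z = (\<integral>\<^sup>+w. ennreal (cmod (F w) powr 1) \<partial>\<mu>)"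
      unfolding berezin_eq[OF sets z] by (simp add: F_def s N)
    also have "\<dots> \<le> ennreal (C1 * k) * ennpowr (\<integral>\<^sup>+w. ennreal (cmod (F w) powr 1 * rho_diag w powr (\<kappa> - N)) \<partial>?V) (1 / 1)"
      by (rule C1(2)[OF sets sf F k]) (use \<mu> in simp)
    also have "(\<integral>\<^sup>+w. ennreal (cmod (F w) powr 1 * rho_diag w powr (\<kappa> - N)) \<partial>?V) = I"
      unfolding I_def by (rule nn_integral_cong) (simp only: space_vol_TB wg)
    finally have "ennpowr (berezin \<mu> \<xi> f z) p1 \<le> ennpowr (ennreal (C1 * k) * I) p1"
      using p(1) by (intro ennpowr_mono) (simp_all del: powr_one_gt_zero_iff)
    also have "\<dots> = ennreal (C1 powr p1 * k powr p1) * ennpowr I p1"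
      using C1(1) k p by (subst ennpowr_cmult) (auto simp: powr_mult)
    also have "ennpowr I p1 \<le> ennreal (A powr (p1 - 1)) * (\<integral>\<^sup>+v. ennreal (w v * g v powr p1) \<partial>?V)"
      unfolding I_def
      by (rule nn_integral_jensen_powr[OF meas]) (use A p1 in \<open>auto simp: w_def g_def\<close>)
    also have "(\<integral>\<^sup>+v. ennreal (w v * g v powr p1) \<partial>?V)
        = (\<integral>\<^sup>+v. ennreal (cmod (f v) powr p1 * cmod (rho z v) powr (- \<sigma>) * rho_diag v powr a) \<partial>?V)"
      by (rule nn_integral_cong) (simp only: space_vol_TB wgp)
    finally have "ennpowr (berezin \<mu> \<xi> f z) p1 \<le> ennreal (C1 powr p1 * k powr p1) * (ennreal (A powr (p1 - 1)) *
        (\<integral>\<^sup>+v. ennreal (cmod (f v) powr p1 * cmod (rho z v) powr (- \<sigma>) * rho_diag v powr a) \<partial>?V))"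
      by (simp add: mult_left_mono)
    also have "\<dots> = ennreal (C1 powr p1 * k powr p1 * A powr (p1 - 1)) *
        (\<integral>\<^sup>+v. ennreal (cmod (f v) powr p1 * cmod (rho z v) powr (- \<sigma>) * rho_diag v powr a) \<partial>?V)"
      by (simp add: ennreal_mult mult.assoc)
    also have "C1 powr p1 * k powr p1 * A powr (p1 - 1) = C1 powr p1 * C2 powr (p1 - 1) * k powr p1 * rho_diag z powr e"
    proof -
      have "(N + b * q - t * q) * (p1 - 1) = N * (p1 - 1) + (b - t) * (q * (p1 - 1))" by (simp add: algebra_simps)
      then have "(N + b * q - t * q) * (p1 - 1) = e" unfolding q(2) e_def .
      then show ?thesis using C2(1) rz by (simp add: A_def powr_mult powr_powr)
    qed
    finally show "ennpowr (berezin \<mu> \<xi> f z) p1 \<le> ennreal (C1 powr p1 * C2 powr (p1 - 1) * k powr p1 * rho_diag z powr e) *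
        (\<integral>\<^sup>+v. ennreal (cmod (f v) powr p1 * cmod (rho z v) powr (- \<sigma>) * rho_diag v powr a) \<partial>?V)" .
  qed
qed

text \<open>Jensen with exponent p2/p1 and weight |f|^p1 rho^\<alpha>1, of total mass
  \<open>Lnorm p1 \<alpha>1 f\<close> to the power p1, moves the exponent inside the integral over
  v. After Fubini, the integral over z is of Forelli--Rudin type.\<close>

lemma berezin_bound:
  fixes p1 p2 \<alpha>1 \<alpha>2 \<xi> N s \<kappa> :: real
  assumes N: "N = real CARD('n) + 1" and s: "s = N + \<xi>"
    and \<kappa>: "\<kappa> = s + (N + \<alpha>1) / p1 - (N + \<alpha>2) / p2"
    and p: "0 < p1" "p1 \<le> p2" and \<alpha>2: "-1 < \<alpha>2"
    and cond: "s > (N - 1) * max 1 (1 / p2) + (1 + \<alpha>2) / p2"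
  obtains C where "C > 0"
    "\<And>(\<mu> :: ('n::{finite,linorder}) cspace measure) f k. sets \<mu> = sets TB_space \<Longrightarrow> sigma_finite_measure \<mu> \<Longrightarrow> k > 0 \<Longrightarrow>
      (\<And>z. z \<in> T_B \<Longrightarrow> emeasure \<mu> (bergman_ball z) \<le> ennreal (k * rho_diag z powr \<kappa>)) \<Longrightarrow> f \<in> Bergman p1 \<alpha>1 \<Longrightarrow>
      Lnorm_ext p2 \<alpha>2 (berezin \<mu> \<xi> f) \<le> ennreal (C * k) * Lnorm p1 \<alpha>1 f"
proof -
  let ?V = "vol_TB :: 'n cspace measure"
  define r where "r = p2 / p1"
  have r: "r \<ge> 1" using p by (simp add: r_def)
  have p2: "p2 > 0" using p by simp
  obtain C1 e \<sigma> a where C1: "C1 > 0" "\<alpha>2 + e * r > -1" "\<sigma> * r > N + \<alpha>2 + e * r"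
    "(a - \<alpha>1) * r + N + \<alpha>2 + e * r - \<sigma> * r = 0"
    "\<And>\<mu> f k z. sets \<mu> = sets TB_space \<Longrightarrow> sigma_finite_measure \<mu> \<Longrightarrow> holomorphic_multi f T_B \<Longrightarrow> k > 0 \<Longrightarrow>
      (\<And>z. z \<in> T_B \<Longrightarrow> emeasure \<mu> (bergman_ball z) \<le> ennreal (k * rho_diag z powr \<kappa>)) \<Longrightarrow> z \<in> T_B \<Longrightarrow>
      ennpowr (berezin \<mu> \<xi> f z) p1 \<le> ennreal (C1 * k powr p1 * rho_diag z powr e) *
        (\<integral>\<^sup>+v. ennreal (cmod (f v) powr p1 * cmod (rho z v) powr (- \<sigma>) * rho_diag v powr a) \<partial>?V)"
    unfolding r_def using berezin_pointwise[OF N s \<kappa> p \<alpha>2 cond] by blast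
  have \<sigma>r: "\<sigma> * r > real CARD('n) + 1 + (\<alpha>2 + e * r)" using C1(3) N by (simp add: add.assoc)
  obtain C2 where C2: "C2 > 0"
    "\<And>z. z \<in> T_B \<Longrightarrow> (\<integral>\<^sup>+w. ennreal (rho_diag w powr (\<alpha>2 + e * r) * cmod (rho z w) powr (- (\<sigma> * r))) \<partial>?V)
        \<le> ennreal (C2 * rho_diag z powr (N + (\<alpha>2 + e * r) - \<sigma> * r))"
    unfolding N using forelli_rudin[OF C1(2) \<sigma>r] by blast
  define C where "C = (C1 powr r * C2) powr (1 / p2)"
  have C: "C > 0" using C1 C2 by (simp add: C_def)
  have "Lnorm_ext p2 \<alpha>2 (berezin \<mu> \<xi> f) \<le> ennreal (C * k) * Lnorm p1 \<alpha>1 f"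
    if sets[measurable_cong]: "sets \<mu> = sets TB_space" and sf: "sigma_finite_measure \<mu>" and k: "k > 0"
      and \<mu>: "\<And>z. z \<in> T_B \<Longrightarrow> emeasure \<mu> (bergman_ball z) \<le> ennreal (k * rho_diag z powr \<kappa>)"
      and f: "f \<in> Bergman p1 \<alpha>1"
    for \<mu> :: "'n cspace measure" and f k
  proof -
    have hol: "holomorphic_multi f T_B" using f by (simp add: Bergman_iff)
    have f_meas[measurable]: "f \<in> borel_measurable TB_space" using hol by (rule holomorphic_multi_measurable)
    have B_meas[measurable]: "berezin \<mu> \<xi> f \<in> borel_measurable TB_space"
      by (rule borel_measurable_berezin[OF sets sf hol])
    define w where "w v = cmod (f v) powr p1 * rho_diag v powr \<alpha>1" for v
    have w_meas[measurable]: "w \<in> borel_measurable TB_space" unfolding w_def by measurable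
    have w0: "w v \<ge> 0" for v by (simp add: w_def)
    have "(\<integral>\<^sup>+v. ennreal (w v) \<partial>?V) < \<infinity>" using f by (simp add: Bergman_iff w_def)
    then obtain i where i: "(\<integral>\<^sup>+v. ennreal (w v) \<partial>?V) = ennreal i" "i \<ge> 0"
      by (cases "(\<integral>\<^sup>+v. ennreal (w v) \<partial>?V)" rule: ennreal_infinity_cases) auto
    \<comment> \<open>Jensen requires a positive bound on the mass. The substitute 1 is harmless:
      \<open>A powr (r - 1) * i = i powr r\<close> also holds for i = 0.\<close>
    define A where "A = (if i = 0 then 1 else i)"
    have A: "A > 0" "i \<le> A" using i by (auto simp: A_def)
    define D where "D = (C1 * k powr p1) powr r * A powr (r - 1)"
    have D: "D \<ge> 0" by (simp add: D_def)
    define g where "g z v = cmod (rho z v) powr (- \<sigma>) * rho_diag v powr (a - \<alpha>1)" for z v :: "'n cspace"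
    define h where "h z v = rho_diag z powr (\<alpha>2 + e * r) * cmod (rho v z) powr (- (\<sigma> * r))" for z v :: "'n cspace"
    define u where "u v = w v * rho_diag v powr ((a - \<alpha>1) * r)" for v
    have u_meas[measurable]: "u \<in> borel_measurable TB_space" unfolding u_def by measurable
    have u0: "u v \<ge> 0" for v using w0 by (simp add: u_def)
    have pw: "ennreal (rho_diag z powr \<alpha>2) * ennpowr (berezin \<mu> \<xi> f z) p2
        \<le> ennreal D * (\<integral>\<^sup>+v. ennreal (u v) * ennreal (h z v) \<partial>?V)" if z: "z \<in> T_B" for z
    proof -
      have rz: "rho_diag z > 0" using z by (simp add: T_B_iff)
      have g_meas[measurable]: "g z \<in> borel_measurable ?V" unfolding g_def by measurable
      have eq1: "(\<integral>\<^sup>+v. ennreal (cmod (f v) powr p1 * cmod (rho z v) powr (- \<sigma>) * rho_diag v powr a) \<partial>?V)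
          = (\<integral>\<^sup>+v. ennreal (w v * g z v) \<partial>?V)"
      proof (rule nn_integral_cong)
        fix v :: "'n cspace" assume "v \<in> space ?V"
        then have "rho_diag v > 0" by (simp add: space_vol_TB T_B_iff)
        then have "rho_diag v powr a = rho_diag v powr \<alpha>1 * rho_diag v powr (a - \<alpha>1)" by (simp flip: powr_add)
        then show "ennreal (cmod (f v) powr p1 * cmod (rho z v) powr (- \<sigma>) * rho_diag v powr a) = ennreal (w v * g z v)"
          by (simp add: w_def g_def mult_ac)
      qed
      have "ennpowr (berezin \<mu> \<xi> f z) p2 = ennpowr (ennpowr (berezin \<mu> \<xi> f z) p1) r"
        using p by (simp add: ennpowr_ennpowr r_def)
      also have "\<dots> \<le> ennpowr (ennreal (C1 * k powr p1 * rho_diag z powr e) * (\<integral>\<^sup>+v. ennreal (w v * g z v) \<partial>?V)) r"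
        using C1(5)[OF sets sf hol k \<mu> z] r unfolding eq1 by (intro ennpowr_mono) auto
      also have "\<dots> = ennreal ((C1 * k powr p1 * rho_diag z powr e) powr r) * ennpowr (\<integral>\<^sup>+v. ennreal (w v * g z v) \<partial>?V) r"
        using C1(1) k rz by (intro ennpowr_cmult) auto
      also have "ennpowr (\<integral>\<^sup>+v. ennreal (w v * g z v) \<partial>?V) r
          \<le> ennreal (A powr (r - 1)) * (\<integral>\<^sup>+v. ennreal (w v * g z v powr r) \<partial>?V)"
        by (rule nn_integral_jensen_powr[OF _ g_meas]) (use w0 r A i in \<open>auto simp: g_def intro: ennreal_leI\<close>)
      finally have "ennreal (rho_diag z powr \<alpha>2) * ennpowr (berezin \<mu> \<xi> f z) p2
          \<le> ennreal (rho_diag z powr \<alpha>2) * (ennreal ((C1 * k powr p1 * rho_diag z powr e) powr r) *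
            (ennreal (A powr (r - 1)) * (\<integral>\<^sup>+v. ennreal (w v * g z v powr r) \<partial>?V)))"
        by (simp add: mult_left_mono)
      also have "\<dots> = ennreal (rho_diag z powr \<alpha>2 * ((C1 * k powr p1 * rho_diag z powr e) powr r * A powr (r - 1))) *
           (\<integral>\<^sup>+v. ennreal (w v * g z v powr r) \<partial>?V)"
        by (rule ennreal_mult3) auto
      also have "rho_diag z powr \<alpha>2 * ((C1 * k powr p1 * rho_diag z powr e) powr r * A powr (r - 1))
          = D * rho_diag z powr (\<alpha>2 + e * r)"
        using C1(1) k rz by (simp add: D_def powr_mult powr_powr powr_add)
      also have "ennreal (D * rho_diag z powr (\<alpha>2 + e * r)) * (\<integral>\<^sup>+v. ennreal (w v * g z v powr r) \<partial>?V)
          = ennreal D * (\<integral>\<^sup>+v. ennreal (u v) * ennreal (h z v) \<partial>?V)"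
      proof -
        have "(\<integral>\<^sup>+v. ennreal (u v) * ennreal (h z v) \<partial>?V)
            = (\<integral>\<^sup>+v. ennreal (rho_diag z powr (\<alpha>2 + e * r)) * ennreal (w v * g z v powr r) \<partial>?V)"
        proof (rule nn_integral_cong)
          fix v :: "'n cspace" assume "v \<in> space ?V"
          then have v: "v \<in> T_B" by (simp add: space_vol_TB)
          have "g z v powr r = cmod (rho v z) powr (- (\<sigma> * r)) * rho_diag v powr ((a - \<alpha>1) * r)"
            unfolding g_def cmod_rho_commute[of z v] by (simp add: powr_mult powr_powr)
          then have "u v * h z v = rho_diag z powr (\<alpha>2 + e * r) * (w v * g z v powr r)"
            by (simp add: u_def h_def mult_ac)
          then show "ennreal (u v) * ennreal (h z v) = ennreal (rho_diag z powr (\<alpha>2 + e * r)) * ennreal (w v * g z v powr r)"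
            using u0 w0 by (simp add: ennreal_mult[symmetric] h_def)
        qed
        also have "\<dots> = ennreal (rho_diag z powr (\<alpha>2 + e * r)) * (\<integral>\<^sup>+v. ennreal (w v * g z v powr r) \<partial>?V)"
          by (rule nn_integral_cmult) measurable
        finally show ?thesis using D by (simp add: ennreal_mult mult.assoc)
      qed
      finally show ?thesis .
    qed
    interpret V: sigma_finite_measure ?V by (rule sigma_finite_vol_TB)
    interpret P: pair_sigma_finite ?V ?V ..
    have "(\<integral>\<^sup>+z. ennreal (rho_diag z powr \<alpha>2) * ennpowr (berezin \<mu> \<xi> f z) p2 \<partial>?V)
        \<le> (\<integral>\<^sup>+z. ennreal D * (\<integral>\<^sup>+v. ennreal (u v) * ennreal (h z v) \<partial>?V) \<partial>?V)"
      by (rule nn_integral_mono) (simp add: space_vol_TB pw)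
    also have "\<dots> = ennreal D * (\<integral>\<^sup>+z. (\<integral>\<^sup>+v. ennreal (u v) * ennreal (h z v) \<partial>?V) \<partial>?V)"
      unfolding h_def by (rule nn_integral_cmult) measurable
    also have "(\<integral>\<^sup>+z. (\<integral>\<^sup>+v. ennreal (u v) * ennreal (h z v) \<partial>?V) \<partial>?V)
        = (\<integral>\<^sup>+v. (\<integral>\<^sup>+z. ennreal (u v) * ennreal (h z v) \<partial>?V) \<partial>?V)"
      unfolding h_def by (rule P.Fubini') measurable
    also have "\<dots> \<le> (\<integral>\<^sup>+v. ennreal C2 * ennreal (w v) \<partial>?V)"
    proof (rule nn_integral_mono)
      fix v :: "'n cspace" assume "v \<in> space ?V"
      then have v: "v \<in> T_B" by (simp add: space_vol_TB)
      then have rv: "rho_diag v > 0" by (simp add: T_B_iff)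
      have "(\<integral>\<^sup>+z. ennreal (u v) * ennreal (h z v) \<partial>?V) = ennreal (u v) * (\<integral>\<^sup>+z. ennreal (h z v) \<partial>?V)"
        unfolding h_def by (rule nn_integral_cmult) measurable
      also have "\<dots> \<le> ennreal (u v) * ennreal (C2 * rho_diag v powr (N + (\<alpha>2 + e * r) - \<sigma> * r))"
        unfolding h_def by (intro mult_left_mono C2(2)[OF v]) simp
      also have "\<dots> = ennreal (C2 * (w v * (rho_diag v powr ((a - \<alpha>1) * r) * rho_diag v powr (N + (\<alpha>2 + e * r) - \<sigma> * r))))"
        using u0[of v] C2(1) by (simp add: u_def ennreal_mult[symmetric] mult_ac)
      \<comment> \<open>The balance equation from \<open>berezin_pointwise\<close>: all powers of
        rho(v) beyond the weight \<alpha>1 cancel.\<close>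
      also have "rho_diag v powr ((a - \<alpha>1) * r) * rho_diag v powr (N + (\<alpha>2 + e * r) - \<sigma> * r) = 1"
      proof -
        have "(a - \<alpha>1) * r + (N + (\<alpha>2 + e * r) - \<sigma> * r) = 0" using C1(4) by linarith
        then show ?thesis using rv by (simp flip: powr_add)
      qed
      finally show "(\<integral>\<^sup>+z. ennreal (u v) * ennreal (h z v) \<partial>?V) \<le> ennreal C2 * ennreal (w v)"
        using C2(1) w0 by (simp add: ennreal_mult)
    qed
    also have "\<dots> = ennreal C2 * ennreal i"
      by (simp add: nn_integral_cmult i)
    finally have "(\<integral>\<^sup>+z. ennreal (rho_diag z powr \<alpha>2) * ennpowr (berezin \<mu> \<xi> f z) p2 \<partial>?V)
        \<le> ennreal D * (ennreal C2 * ennreal i)" by (simp add: mult_left_mono)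
    also have "\<dots> = ennreal (C1 powr r * C2 * k powr p2 * i powr r)"
    proof -
      have "A powr (r - 1) * i = i powr r"
        using i r by (cases "i = 0") (auto simp: A_def powr_diff)
      moreover have "(C1 * k powr p1) powr r = C1 powr r * k powr p2"
        using C1(1) k p by (simp add: powr_mult powr_powr r_def)
      ultimately have "D * (C2 * i) = C1 powr r * C2 * k powr p2 * i powr r"
        unfolding D_def by (simp add: mult_ac)
      then show ?thesis using D C2(1) i by (simp add: ennreal_mult[symmetric])
    qed
    finally have "Lnorm_ext p2 \<alpha>2 (berezin \<mu> \<xi> f) \<le> ennpowr (ennreal (C1 powr r * C2 * k powr p2 * i powr r)) (1 / p2)"
      unfolding Lnorm_ext_eq[OF B_meas] using p2 by (intro ennpowr_mono) auto
    also have "\<dots> = ennreal ((C1 powr r * C2 * k powr p2 * i powr r) powr (1 / p2))"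
      using C2(1) by (intro ennpowr_ennreal) auto
    also have "(C1 powr r * C2 * k powr p2 * i powr r) powr (1 / p2) = C * k * i powr (1 / p1)"
    proof -
      have "r * (1 / p2) = 1 / p1" using p p2 by (simp add: r_def)
      then show ?thesis using C1(1) C2(1) k i p2 by (simp add: C_def powr_mult powr_powr)
    qed
    also have "ennreal (C * k * i powr (1 / p1)) = ennreal (C * k) * Lnorm p1 \<alpha>1 f"
      unfolding Lnorm_eq[OF f_meas] using C k i by (simp add: w_def[symmetric] ennpowr_ennreal ennreal_mult)
    finally show ?thesis .
  qed
  then show ?thesis using C that by blast
qed

subsection \<open>The Toeplitz operator\<close>

lemma Lnorm_toeplitz_le:
  fixes \<mu> :: "('n::{finite,linorder}) cspace measure"
  assumes sets: "sets \<mu> = sets TB_space" and p: "p > 0"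
  shows "Lnorm p \<alpha> (toeplitz \<mu> \<xi> f) \<le> Lnorm_ext p \<alpha> (berezin \<mu> \<xi> f)"
proof -
  have space: "space \<mu> = T_B" using sets by (rule space_eq_T_B)
  let ?s = "real CARD('n) + 1 + \<xi>"
  have le: "ennreal (cmod (toeplitz \<mu> \<xi> f z)) \<le> berezin \<mu> \<xi> f z" if z: "z \<in> T_B" for z
  proof (cases "integrable \<mu> (\<lambda>w. f w / rho z w powr complex_of_real ?s)")
    case True
    have "ennreal (cmod (toeplitz \<mu> \<xi> f z)) \<le> (\<integral>\<^sup>+w. ennreal (cmod (f w / rho z w powr complex_of_real ?s)) \<partial>\<mu>)"
      unfolding toeplitz_def by (rule integral_norm_bound_ennreal[OF True])
    also have "\<dots> = berezin \<mu> \<xi> f z"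
      unfolding berezin_def
      by (rule nn_integral_cong) (simp only: space norm_divide cmod_powr_rho[OF z])
    finally show ?thesis .
  next
    \<comment> \<open>A nonintegrable integrand gives \<open>toeplitz\<close> the default value 0,
      which lies below every value of \<open>berezin\<close>.\<close>
    case False
    then show ?thesis by (simp add: toeplitz_def not_integrable_integral_eq)
  qed
  have "(\<integral>\<^sup>+z. ennpowr (ennreal (cmod (toeplitz \<mu> \<xi> f z))) p \<partial>dV \<alpha>) \<le> (\<integral>\<^sup>+z. ennpowr (berezin \<mu> \<xi> f z) p \<partial>dV \<alpha>)"
    using p by (intro nn_integral_mono ennpowr_mono le) (simp_all add: dV_def space_restrict_space)
  then show ?thesis unfolding Lnorm_def Lnorm_ext_def using p by (intro ennpowr_mono) auto
qed

lemma emeasure_vol_TB_bergman_ball_pos: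
  assumes z: "z \<in> T_B" shows "emeasure vol_TB (bergman_ball z) > 0"
proof -
  obtain e where e: "e > 0" "ball z e \<subseteq> bergman_ball z"
    using open_bergman_ball[of z] center_in_bergman_ball[OF z] open_contains_ball by blast
  have "0 < measure lborel (ball z e)" using e(1) by (rule measure_lborel_ball_pos)
  then have "0 < emeasure lborel (ball z e)"
    by (metis emeasure_eq_ennreal_measure ennreal_0 ennreal_less_zero_iff measure_eq_emeasure_eq_ennreal
        measure_zero_top not_gr_zero order_less_irrefl zero_less_measure_iff)
  also have "\<dots> \<le> emeasure lborel (bergman_ball z)"
    using e(2) open_bergman_ball[of z] by (intro emeasure_mono) auto
  also have "\<dots> = emeasure vol_TB (bergman_ball z)"
    unfolding vol_TB_def using bergman_ball_subset by (intro emeasure_restrict_space[symmetric]) auto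
  finally show ?thesis .
qed

text \<open>By the comparability of \<open>\<rho>(z,\<cdot>)\<close> on Bergman balls, an infinite value of \<open>B f\<close> at one point would
  spread to a set of positive volume.\<close>

lemma berezin_finite:
  fixes \<mu> :: "('n::{finite,linorder}) cspace measure"
  assumes sets: "sets \<mu> = sets TB_space" and p: "p > 0" and \<xi>: "\<xi> > -1"
    and meas: "berezin \<mu> \<xi> f \<in> borel_measurable TB_space" and f: "f \<in> borel_measurable TB_space"
    and fin: "Lnorm_ext p \<alpha> (berezin \<mu> \<xi> f) < \<infinity>" and z: "z \<in> T_B"
  shows "berezin \<mu> \<xi> f z < \<infinity>"
proof (rule ccontr)
  note [measurable_cong] = sets and [measurable] = meas f
  have space: "space \<mu> = T_B" using sets by (rule space_eq_T_B)
  let ?s = "real CARD('n) + 1 + \<xi>"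
  have s: "?s > 0" using \<xi> by simp
  assume "\<not> berezin \<mu> \<xi> f z < \<infinity>"
  then have top: "berezin \<mu> \<xi> f z = \<infinity>" by (simp add: less_top[symmetric])
  have inf: "berezin \<mu> \<xi> f w = \<infinity>" if w: "w \<in> bergman_ball z" for w
  proof -
    have wT: "w \<in> T_B" using w bergman_ball_subset by blast
    have "berezin \<mu> \<xi> f z \<le> (\<integral>\<^sup>+v. ennreal (20 powr ?s) * ennreal (cmod (f v) / cmod (rho w v) powr ?s) \<partial>\<mu>)"
      unfolding berezin_def
    proof (rule nn_integral_mono)
      fix v assume "v \<in> space \<mu>"
      then have v: "v \<in> T_B" by (simp add: space)
      have pos: "cmod (rho z v) > 0" "cmod (rho w v) > 0" using cmod_rho_pos z wT v by auto
      have "cmod (rho w v) powr ?s \<le> (20 * cmod (rho z v)) powr ?s"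
        using bergman_ball_rho_le[OF z w v] s by (intro powr_mono2) auto
      then have "cmod (rho w v) powr ?s \<le> 20 powr ?s * cmod (rho z v) powr ?s" by (simp add: powr_mult)
      then have "1 / cmod (rho z v) powr ?s \<le> 20 powr ?s * (1 / cmod (rho w v) powr ?s)"
        using pos by (simp add: field_simps)
      then have "cmod (f v) * (1 / cmod (rho z v) powr ?s) \<le> cmod (f v) * (20 powr ?s * (1 / cmod (rho w v) powr ?s))"
        by (rule mult_left_mono) simp
      then show "ennreal (cmod (f v) / cmod (rho z v) powr ?s) \<le> ennreal (20 powr ?s) * ennreal (cmod (f v) / cmod (rho w v) powr ?s)"
        by (simp add: ennreal_mult[symmetric] mult.commute ennreal_leI)
    qed
    also have "\<dots> = ennreal (20 powr ?s) * berezin \<mu> \<xi> f w"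
      unfolding berezin_def by (rule nn_integral_cmult) measurable
    finally have "ennreal (20 powr ?s) * berezin \<mu> \<xi> f w = top" using top by (simp add: top_unique)
    then show ?thesis by (simp add: ennreal_mult_eq_top_iff)
  qed
  have "(\<integral>\<^sup>+w. ennreal (rho_diag w powr \<alpha>) * ennpowr (berezin \<mu> \<xi> f w) p \<partial>vol_TB) < \<infinity>"
    using fin unfolding Lnorm_ext_eq[OF meas] ennpowr_less_top .
  moreover have "(\<integral>\<^sup>+w. \<infinity> * indicator (bergman_ball z) w \<partial>vol_TB)
      \<le> (\<integral>\<^sup>+w. ennreal (rho_diag w powr \<alpha>) * ennpowr (berezin \<mu> \<xi> f w) p \<partial>vol_TB)"
  proof (rule nn_integral_mono)
    fix w assume "w \<in> space (vol_TB :: 'n cspace measure)"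
    then have "rho_diag w > 0" by (simp add: space_vol_TB T_B_iff)
    then show "\<infinity> * indicator (bergman_ball z) w \<le> ennreal (rho_diag w powr \<alpha>) * ennpowr (berezin \<mu> \<xi> f w) p"
      by (cases "w \<in> bergman_ball z") (auto simp: inf ennreal_mult_top)
  qed
  moreover have "(\<integral>\<^sup>+w. \<infinity> * indicator (bergman_ball z) w \<partial>vol_TB) = \<infinity> * emeasure vol_TB (bergman_ball z)"
    by (rule nn_integral_cmult_indicator) (simp add: sets_vol_TB)
  moreover have "\<infinity> * emeasure vol_TB (bergman_ball z) = (\<infinity>::ennreal)"
    using emeasure_vol_TB_bergman_ball_pos[OF z] by (simp add: ennreal_top_mult)
  ultimately show False by (simp add: top_unique)
qed

lemma toeplitz_integrable:
  fixes \<mu> :: "('n::{finite,linorder}) cspace measure"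
  assumes sets: "sets \<mu> = sets TB_space" and f: "f \<in> borel_measurable TB_space"
    and z: "z \<in> T_B" and fin: "berezin \<mu> \<xi> f z < \<infinity>"
  shows "integrable \<mu> (\<lambda>w. f w / rho z w powr complex_of_real (real CARD('n) + 1 + \<xi>))"
proof (rule integrableI_bounded)
  note [measurable_cong] = sets and [measurable] = f
  have space: "space \<mu> = T_B" using sets by (rule space_eq_T_B)
  show "(\<lambda>w. f w / rho z w powr complex_of_real (real CARD('n) + 1 + \<xi>)) \<in> borel_measurable \<mu>"
    by measurable
  have "(\<integral>\<^sup>+w. ennreal (cmod (f w / rho z w powr complex_of_real (real CARD('n) + 1 + \<xi>))) \<partial>\<mu>) = berezin \<mu> \<xi> f z"
    unfolding berezin_def
    by (rule nn_integral_cong) (simp only: space norm_divide cmod_powr_rho[OF z])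
  then show "(\<integral>\<^sup>+w. ennreal (cmod (f w / rho z w powr complex_of_real (real CARD('n) + 1 + \<xi>))) \<partial>\<mu>) < \<infinity>"
    using fin by simp
qed

section \<open>Holomorphy of the Toeplitz transform by differentiation under the integral\<close>

lemma powr_second_order:
  fixes c :: complex
  obtains C where "C > 0" "\<And>q. cmod (q - 1) \<le> 1/2 \<Longrightarrow> cmod (q powr c - 1 - c * (q - 1)) \<le> C * (cmod (q - 1))\<^sup>2"
proof -
  \<comment> \<open>This disc is compact and stays in Re > 0, off the branch cut, so the second
    derivative of the power is bounded on it. The estimate is meant for q = rho(z+v,w) / rho(z,w)
    and will be uniform in w.\<close>
  let ?S = "cball (1::complex) (1/2)"
  define F where "F i q = (if i = 0 then q powr c else if i = 1 then c * q powr (c - 1) else c * ((c - 1) * q powr (c - 2)))" for i :: nat and q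
  have nonpos: "q \<notin> \<real>\<^sub>\<le>\<^sub>0" if "q \<in> ?S" for q
  proof -
    have "cmod (1 - q) \<le> 1/2" using that by (simp add: dist_norm)
    then have "Re (1 - q) \<le> 1/2" using complex_Re_le_cmod[of "1 - q"] by linarith
    then show ?thesis by (auto simp: complex_nonpos_Reals_iff)
  qed
  have "continuous_on ?S (\<lambda>q. q powr (c - 2))"
    using DERIV_isCont[OF has_field_derivative_powr[OF nonpos]] by (intro continuous_at_imp_continuous_on) blast
  then have "continuous_on ?S (F 2)"
    unfolding F_def by (simp add: continuous_on_mult_left)
  then have "bounded (F 2 ` ?S)" by (intro compact_imp_bounded compact_continuous_image) auto
  then obtain B where B: "B > 0" "\<And>q. q \<in> ?S \<Longrightarrow> cmod (F 2 q) \<le> B"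
    unfolding bounded_pos by auto
  have d0: "((\<lambda>q. q powr c) has_field_derivative c * q powr (c - 1)) (at q within ?S)" if "q \<in> ?S" for q
    using has_field_derivative_powr[OF nonpos[OF that]] by (rule has_field_derivative_at_within)
  have d1: "((\<lambda>q. c * q powr (c - 1)) has_field_derivative c * ((c - 1) * q powr (c - 2))) (at q within ?S)" if "q \<in> ?S" for q
  proof -
    have "((\<lambda>q. q powr (c - 1)) has_field_derivative (c - 1) * q powr (c - 1 - 1)) (at q within ?S)"
      using has_field_derivative_powr[OF nonpos[OF that]] by (rule has_field_derivative_at_within)
    moreover have "c - 1 - 1 = c - 2" by simp
    ultimately show ?thesis by (metis DERIV_cmult)
  qed
  have "cmod (q powr c - 1 - c * (q - 1)) \<le> B * (cmod (q - 1))\<^sup>2" if q: "cmod (q - 1) \<le> 1/2" for q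
  proof -
    have qS: "q \<in> ?S" using q by (simp add: dist_norm norm_minus_commute)
    have "cmod (F 0 q - (\<Sum>i\<le>1. F i 1 * (q - 1) ^ i / fact i)) \<le> B * cmod (q - 1) ^ Suc 1 / fact 1"
    proof (rule complex_Taylor[where S="?S"])
      show "(F i has_field_derivative F (Suc i) x) (at x within ?S)" if "x \<in> ?S" "i \<le> 1" for i x
      proof (cases "i = 0")
        case True then show ?thesis using d0[OF that(1)] by (simp add: F_def[abs_def])
      next
        case False
        then have "i = 1" using that by simp
        then show ?thesis using d1[OF that(1)] by (simp add: F_def[abs_def])
      qed
      show "cmod (F (Suc 1) x) \<le> B" if "x \<in> ?S" for x
        using B(2)[OF that] by (simp add: numeral_2_eq_2)
    qed (use qS in auto)
    then show ?thesis by (simp add: F_def power2_eq_square algebra_simps)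
  qed
  then show ?thesis using B(1) that by blast
qed

lemma powr_mult_Re_pos:
  fixes x y c :: complex
  assumes "Re x > 0" "Re y > 0"
  shows "(x * y) powr c = x powr c * y powr c"
proof -
  have nz: "x \<noteq> 0" "y \<noteq> 0" using assms by auto
  have "\<bar>Im (Ln x)\<bar> < pi/2" "\<bar>Im (Ln y)\<bar> < pi/2" using Re_Ln_pos_lt nz assms by auto
  then have "Ln (x * y) = Ln x + Ln y" using nz by (intro Ln_times_simple) auto
  then show ?thesis using nz by (simp add: powr_def exp_add algebra_simps)
qed

lemma sum_norm_power2_le: "(\<Sum>j\<in>A. (cmod (v $ j))\<^sup>2) \<le> (norm v)\<^sup>2" for v :: "complex ^ 'n"
proof -
  have "(\<Sum>j\<in>A. (cmod (v $ j))\<^sup>2) \<le> (\<Sum>j\<in>UNIV. (cmod (v $ j))\<^sup>2)" by (rule sum_mono2) auto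
  also have "\<dots> = (norm v)\<^sup>2" by (simp add: norm_vec_def L2_set_def sum_nonneg)
  finally show ?thesis .
qed

text \<open>The derivative of \<open>rho\<close> in its first argument, in direction v. Since
  \<open>rho\<close> is quadratic, the remainder in \<open>rho_add\<close> is exact and depends
  neither on z nor on w.\<close>

definition rho_lin :: "('n::{finite,linorder}) cspace \<Rightarrow> 'n cspace \<Rightarrow> 'n cspace \<Rightarrow> complex" where
  "rho_lin z w v = 1/2 * (\<Sum>j\<in>UNIV - {last_ix}. v $ j * (z $ j - cnj (w $ j))) - \<i>/2 * v $ last_ix"

lemma rho_add: "rho (z + v) w = rho z w + rho_lin z w v + 1/4 * (\<Sum>j\<in>UNIV - {last_ix}. (v $ j)\<^sup>2)"
proof -
  have "(\<Sum>j\<in>UNIV - {last_ix}. ((z + v) $ j - cnj (w $ j))\<^sup>2)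
      = (\<Sum>j\<in>UNIV - {last_ix}. (z $ j - cnj (w $ j))\<^sup>2) + 2 * (\<Sum>j\<in>UNIV - {last_ix}. v $ j * (z $ j - cnj (w $ j)))
        + (\<Sum>j\<in>UNIV - {last_ix}. (v $ j)\<^sup>2)"
    unfolding sum_distrib_left sum.distrib[symmetric]
    by (rule sum.cong) (simp_all add: power2_eq_square algebra_simps)
  then show ?thesis unfolding rho_def rho_lin_def by (simp add: algebra_simps)
qed

lemma rho_lin_add: "rho_lin z w (u + v) = rho_lin z w u + rho_lin z w v"
  by (simp add: rho_lin_def sum.distrib distrib_left distrib_right)

lemma rho_lin_cmult: "rho_lin z w (c *s v) = c * rho_lin z w v"
  by (simp add: rho_lin_def sum_distrib_left right_diff_distrib mult_ac)

lemma measurable_rho_lin: "(\<lambda>w. rho_lin z w v) \<in> borel_measurable TB_space"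
  unfolding rho_lin_def by (intro measurable_continuous_TB_space continuous_intros)

text \<open>The point is uniformity in w: the derivative grows linearly in w', but |z' - w'|^2 <= 4
  |rho(z,w)|, and terms independent of w are absorbed by rho(z) <= 2 |rho(z,w)|. This gives M = 2 +
  (a + 1) / r.\<close>

lemma rho_lin_bound:
  fixes z :: "('n::{finite,linorder}) cspace"
  assumes z: "z \<in> T_B"
  obtains M where "M > 0" "\<And>w v. w \<in> T_B \<Longrightarrow> cmod (rho_lin z w v) \<le> M * norm v * cmod (rho z w)"
proof -
  let ?S = "UNIV - {last_ix::'n}"
  define a where "a = (\<Sum>j\<in>?S. 2 * \<bar>Im (z $ j)\<bar> + 1)"
  have a: "a \<ge> 0" unfolding a_def by (intro sum_nonneg) auto
  define r where "r = rho_diag z"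
  have r: "r > 0" using z by (simp add: r_def T_B_iff)
  define M where "M = 2 + (a + 1) / r"
  have M: "M > 0" using a r by (simp add: M_def add_pos_nonneg)
  have "cmod (rho_lin z w v) \<le> M * norm v * cmod (rho z w)" if w: "w \<in> T_B" for w v
  proof -
    define y where "y = cmod (rho z w)"
    have y: "r \<le> 2 * y" using rho_diag_le[OF z w] by (simp add: r_def y_def)
    have sq: "(\<Sum>j\<in>?S. (cmod (z $ j - w $ j))\<^sup>2) \<le> 4 * y"
    proof -
      have "4 * Re (rho z w) = (\<Sum>j\<in>?S. (cmod (z $ j - w $ j))\<^sup>2) + 2 * rho_diag z + 2 * rho_diag w"
        by (simp add: Re_rho)
      then show ?thesis using complex_Re_le_cmod[of "rho z w"] z w unfolding T_B_iff y_def by linarith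
    qed
    have summand: "cmod (z $ j - cnj (w $ j)) \<le> (2 * \<bar>Im (z $ j)\<bar> + 1) + (cmod (z $ j - w $ j))\<^sup>2" for j
    proof -
      have "z $ j - cnj (w $ j) = (z $ j - cnj (z $ j)) + cnj (z $ j - w $ j)" by simp
      then have "cmod (z $ j - cnj (w $ j)) \<le> cmod (z $ j - cnj (z $ j)) + cmod (z $ j - w $ j)"
        by (metis complex_mod_cnj norm_triangle_ineq)
      moreover have "cmod (z $ j - cnj (z $ j)) = 2 * \<bar>Im (z $ j)\<bar>"
        by (simp add: complex_diff_cnj norm_mult)
      moreover have "x \<le> 1 + x\<^sup>2" for x :: real
        using zero_le_power2[of "x - 1/2"] by (simp add: power2_eq_square algebra_simps)
      ultimately show ?thesis by (smt (verit))
    qed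
    have "(\<Sum>j\<in>?S. cmod (z $ j - cnj (w $ j))) \<le> a + (\<Sum>j\<in>?S. (cmod (z $ j - w $ j))\<^sup>2)"
      unfolding a_def sum.distrib[symmetric] by (rule sum_mono) (rule summand)
    then have l1: "(\<Sum>j\<in>?S. cmod (z $ j - cnj (w $ j))) \<le> a + 4 * y" using sq by linarith
    have "cmod (\<Sum>j\<in>?S. v $ j * (z $ j - cnj (w $ j))) \<le> (\<Sum>j\<in>?S. norm v * cmod (z $ j - cnj (w $ j)))"
      by (rule sum_norm_le) (simp add: norm_mult mult_right_mono Finite_Cartesian_Product.norm_nth_le)
    also have "\<dots> = norm v * (\<Sum>j\<in>?S. cmod (z $ j - cnj (w $ j)))" by (rule sum_distrib_left[symmetric])
    also have "\<dots> \<le> norm v * (a + 4 * y)" by (intro mult_left_mono l1) simp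
    finally have l2: "cmod (\<Sum>j\<in>?S. v $ j * (z $ j - cnj (w $ j))) \<le> norm v * (a + 4 * y)" .
    have "cmod (rho_lin z w v) \<le> cmod (1/2 * (\<Sum>j\<in>?S. v $ j * (z $ j - cnj (w $ j)))) + cmod (\<i>/2 * v $ last_ix)"
      unfolding rho_lin_def by (rule norm_triangle_ineq4)
    also have "\<dots> = 1/2 * cmod (\<Sum>j\<in>?S. v $ j * (z $ j - cnj (w $ j))) + 1/2 * cmod (v $ last_ix)"
      by (simp add: norm_mult norm_divide)
    also have "\<dots> \<le> 1/2 * (norm v * (a + 4 * y)) + 1/2 * norm v"
      using l2 Finite_Cartesian_Product.norm_nth_le[of v last_ix] by linarith
    also have "\<dots> = norm v * ((a + 1) / 2 + 2 * y)" by (simp add: algebra_simps)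
    also have "\<dots> \<le> norm v * (M * y)"
    proof (rule mult_left_mono)
      have "(a + 1) * r \<le> (a + 1) * (2 * y)" using a y by (intro mult_left_mono) auto
      then have "(a + 1) / 2 \<le> (a + 1) / r * y" using r by (simp add: field_simps)
      then show "(a + 1) / 2 + 2 * y \<le> M * y" unfolding M_def distrib_right by linarith
    qed simp
    finally show ?thesis by (simp add: y_def mult_ac)
  qed
  then show ?thesis using M that by blast
qed

lemma has_derivative_of_quadratic_remainder:
  fixes F :: "'a::real_normed_vector \<Rightarrow> 'b::real_normed_vector"
  assumes D: "bounded_linear D" and d: "d > 0"
    and rem: "\<And>v. norm v < d \<Longrightarrow> norm (F (z + v) - F z - D v) \<le> K * (norm v)\<^sup>2"
  shows "(F has_derivative D) (at z)"
  unfolding has_derivative_at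
proof (intro conjI D)
  have "\<forall>\<^sub>F v in at 0. norm (norm (F (z + v) - F z - D v) / norm v) \<le> K * norm v"
    unfolding eventually_at
  proof (intro exI[of _ d] conjI d ballI impI)
    fix v :: 'a assume v: "v \<noteq> 0 \<and> dist v 0 < d"
    then have "norm (F (z + v) - F z - D v) / norm v \<le> K * (norm v)\<^sup>2 / norm v"
      by (intro divide_right_mono rem) auto
    then show "norm (norm (F (z + v) - F z - D v) / norm v) \<le> K * norm v"
      using v by (simp add: power2_eq_square)
  qed
  moreover have "((\<lambda>v. K * norm v) \<longlongrightarrow> 0) (at (0::'a))"
    by (auto intro!: tendsto_eq_intros)
  ultimately show "(\<lambda>v. norm (F (z + v) - F z - D v) / norm v) \<midarrow>0\<rightarrow> 0"
    by (rule Lim_null_comparison)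
qed

text \<open>Relative to the integrand at z, the first-order term is O(|v|) and the remainder is
  O(|v|^2), uniformly in w. Integrability at the single point z therefore dominates every term in
  the difference quotient.\<close>

lemma holomorphic_multi_toeplitz:
  fixes \<mu> :: "('n::{finite,linorder}) cspace measure"
  assumes sets: "sets \<mu> = sets TB_space" and f: "f \<in> borel_measurable TB_space"
    and int: "\<And>z. z \<in> T_B \<Longrightarrow> integrable \<mu> (\<lambda>w. f w / rho z w powr complex_of_real (real CARD('n) + 1 + \<xi>))"
  shows "holomorphic_multi (toeplitz \<mu> \<xi> f) T_B"
  unfolding holomorphic_multi_def
proof
  note [measurable_cong] = sets and [measurable] = f
  have space: "space \<mu> = T_B" using sets by (rule space_eq_T_B)
  define s where "s = complex_of_real (real CARD('n) + 1 + \<xi>)"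
  fix z :: "'n cspace" assume z: "z \<in> T_B"
  define r where "r = rho_diag z"
  have r: "r > 0" using z by (simp add: r_def T_B_iff)
  obtain M0 where M0: "M0 > 0" "\<And>w v. w \<in> T_B \<Longrightarrow> cmod (rho_lin z w v) \<le> M0 * norm v * cmod (rho z w)"
    using rho_lin_bound[OF z] by blast
  define M where "M = M0 + 1 / r"
  have M: "M > 0" "M \<ge> M0" "M \<ge> 1 / r" using M0(1) r by (simp_all add: M_def add_pos_pos)
  obtain C where C: "C > 0" "\<And>q. cmod (q - 1) \<le> 1/2 \<Longrightarrow> cmod (q powr (- s) - 1 - (- s) * (q - 1)) \<le> C * (cmod (q - 1))\<^sup>2"
    using powr_second_order[of "- s"] by blast
  define k where "k w = f w / rho z w powr s" for w
  have k_int: "integrable \<mu> k" unfolding k_def[abs_def] s_def by (rule int[OF z])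
  \<comment> \<open>The derivative of the kernel divided by the kernel, that is, its logarithmic
    derivative.\<close>
  define A where "A w v = - s * (rho_lin z w v / rho z w)" for w v
  have [measurable]: "(\<lambda>w. A w v) \<in> borel_measurable TB_space" for v
    unfolding A_def using measurable_rho_lin[of z v] by measurable
  have A_bound: "cmod (A w v) \<le> cmod s * (M * norm v)" if w: "w \<in> T_B" for w v
  proof -
    have pos: "cmod (rho z w) > 0" using cmod_rho_pos[OF z w] .
    have "M0 * norm v * cmod (rho z w) \<le> M * norm v * cmod (rho z w)"
      using M by (intro mult_right_mono) auto
    with M0(2)[OF w, of v] have "cmod (rho_lin z w v) \<le> M * norm v * cmod (rho z w)" by linarith
    then have "cmod (rho_lin z w v / rho z w) \<le> M * norm v" using pos by (simp add: norm_divide field_simps)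
    then show ?thesis unfolding A_def norm_mult norm_minus_cancel by (intro mult_left_mono) auto
  qed
  have kA_int: "integrable \<mu> (\<lambda>w. k w * A w v)" for v
  proof (rule Bochner_Integration.integrable_bound)
    show "integrable \<mu> (\<lambda>w. (cmod s * (M * norm v)) *\<^sub>R k w)" using k_int by simp
    show "(\<lambda>w. k w * A w v) \<in> borel_measurable \<mu>" using k_int by measurable
    show "AE w in \<mu>. cmod (k w * A w v) \<le> norm ((cmod s * (M * norm v)) *\<^sub>R k w)"
    proof (rule AE_I2)
      fix w assume "w \<in> space \<mu>"
      then have "cmod (A w v) * cmod (k w) \<le> cmod s * (M * norm v) * cmod (k w)"
        using A_bound[of w v] by (intro mult_right_mono) (auto simp: space)
      then show "cmod (k w * A w v) \<le> norm ((cmod s * (M * norm v)) *\<^sub>R k w)"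
        using M by (simp add: norm_mult mult.commute)
    qed
  qed
  define D where "D v = (LINT w|\<mu>. k w * A w v)" for v
  define G where "G = (LINT w|\<mu>. cmod (k w))"
  have norm_int: "cmod (LINT w|\<mu>. g w) \<le> c * G" if g: "integrable \<mu> g" and le: "\<And>w. w \<in> T_B \<Longrightarrow> cmod (g w) \<le> c * cmod (k w)" for g c
  proof -
    have "cmod (LINT w|\<mu>. g w) \<le> (LINT w|\<mu>. cmod (g w))" by (rule integral_norm_bound)
    also have "\<dots> \<le> (LINT w|\<mu>. c * cmod (k w))"
      using g k_int le by (intro integral_mono) (auto simp: space)
    also have "\<dots> = c * G" by (simp add: G_def)
    finally show ?thesis .
  qed
  have D_smult: "D (c *s v) = c * D v" for c v
  proof -
    have "k w * A w (c *s v) = c * (k w * A w v)" for w by (simp add: A_def rho_lin_cmult)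
    then show ?thesis unfolding D_def by (simp only: integral_mult_right_zero)
  qed
  have D_lin: "bounded_linear D"
  proof (rule bounded_linear_intro[where K="cmod s * M * G"])
    fix u v :: "'n cspace"
    have "A w (u + v) = A w u + A w v" for w
      by (simp add: A_def rho_lin_add add_divide_distrib ring_distribs)
    then have "k w * A w (u + v) = k w * A w u + k w * A w v" for w
      by (simp add: distrib_left)
    then show "D (u + v) = D u + D v" by (simp add: D_def Bochner_Integration.integral_add kA_int)
    show "D (c *\<^sub>R v) = c *\<^sub>R D v" for c
      by (simp add: scaleR_eq_of_real_vec D_smult scaleR_conv_of_real[of c "D v"])
    have "cmod (D v) \<le> cmod s * (M * norm v) * G"
      unfolding D_def
    proof (rule norm_int[OF kA_int])
      fix w :: "'n cspace" assume "w \<in> T_B"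
      then have "cmod (A w v) * cmod (k w) \<le> cmod s * (M * norm v) * cmod (k w)"
        by (intro mult_right_mono A_bound) auto
      then show "cmod (k w * A w v) \<le> cmod s * (M * norm v) * cmod (k w)" by (simp add: norm_mult mult.commute)
    qed
    then show "norm (D v) \<le> norm v * (cmod s * M * G)" by (simp add: mult_ac)
  qed
  obtain d0 where d0: "d0 > 0" "ball z d0 \<subseteq> T_B" using open_T_B z open_contains_ball by blast
  \<comment> \<open>For |v| < d the point z + v stays in the domain, |v|^2 <= |v|, and M |v| <= 1/4;
    the last two give |q - 1| <= 2 M |v| <= 1/2, as the Taylor estimate requires.\<close>
  define d where "d = min d0 (min 1 (1 / (4 * M)))"
  have d: "d > 0" "d \<le> d0" "d \<le> 1" "d \<le> 1 / (4 * M)" using d0 M by (auto simp: d_def)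
  define K where "K = C * (4 * M\<^sup>2) + cmod s * M"
  have "(toeplitz \<mu> \<xi> f has_derivative D) (at z)"
  proof (rule has_derivative_of_quadratic_remainder[OF D_lin d(1)])
    fix v :: "'n cspace" assume v: "norm v < d"
    define Q where "Q = 1/4 * (\<Sum>j\<in>UNIV - {last_ix}. (v $ j)\<^sup>2)"
    have Q: "cmod Q \<le> (norm v)\<^sup>2 / 4"
    proof -
      have "cmod (\<Sum>j\<in>UNIV - {last_ix}. (v $ j)\<^sup>2) \<le> (\<Sum>j\<in>UNIV - {last_ix}. (cmod (v $ j))\<^sup>2)"
        by (rule sum_norm_le) (simp add: norm_power)
      then show ?thesis using sum_norm_power2_le[of v "UNIV - {last_ix}"] by (simp add: Q_def norm_mult norm_divide)
    qed
    have zv: "z + v \<in> T_B" using v d d0 by (auto simp: dist_norm)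
    have k'_int: "integrable \<mu> (\<lambda>w. f w / rho (z + v) w powr s)" using int[OF zv] by (simp add: s_def)
    have "toeplitz \<mu> \<xi> f (z + v) - toeplitz \<mu> \<xi> f z - D v
        = (LINT w|\<mu>. f w / rho (z + v) w powr s - k w - k w * A w v)"
    proof -
      have T1: "toeplitz \<mu> \<xi> f (z + v) = (LINT w|\<mu>. f w / rho (z + v) w powr s)"
        unfolding toeplitz_def s_def by (rule refl)
      have T0: "toeplitz \<mu> \<xi> f z = (LINT w|\<mu>. k w)"
        unfolding toeplitz_def k_def s_def by (rule refl)
      show ?thesis unfolding T1 T0 D_def using k'_int k_int kA_int[of v] by simp
    qed
    also have "cmod \<dots> \<le> K * (norm v)\<^sup>2 * G"
    proof (rule norm_int)
      show "integrable \<mu> (\<lambda>w. f w / rho (z + v) w powr s - k w - k w * A w v)"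
        using k'_int k_int kA_int[of v] by simp
      fix w :: "'n cspace" assume w: "w \<in> T_B"
      define x where "x = rho z w"
      define L where "L = rho_lin z w v"
      \<comment> \<open>The kernel at z + v is the kernel at z times q^(-s). The principal powers
        multiply because both x and q have positive real part.\<close>
      define q where "q = rho (z + v) w / x"
      have x: "Re x > 0" "x \<noteq> 0" "cmod x > 0" using Re_rho_pos[OF z w] by (auto simp: x_def)
      have q1: "q - 1 = L / x + Q / x"
      proof -
        have "rho (z + v) w - x = L + Q" using rho_add[of z v w] by (simp add: x_def L_def Q_def)
        then have "(rho (z + v) w - x) / x = L / x + Q / x" by (simp add: add_divide_distrib)
        then show ?thesis using x by (simp add: q_def diff_divide_distrib)
      qed
      have "r \<le> 2 * cmod x" using rho_diag_le[OF z w] by (simp add: x_def r_def)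
      then have "1 / cmod x \<le> 2 / r" using x r by (simp add: field_simps)
      then have "cmod (Q / x) \<le> (norm v)\<^sup>2 / 4 * (2 / r)"
        unfolding norm_divide using mult_mono[OF Q, of "1 / cmod x" "2 / r"] by simp
      also have "\<dots> \<le> (norm v)\<^sup>2 * M"
      proof -
        have "(norm v)\<^sup>2 * (1 / r) \<le> (norm v)\<^sup>2 * M" by (intro mult_left_mono M(3)) simp
        moreover have "(norm v)\<^sup>2 / 4 * (2 / r) \<le> (norm v)\<^sup>2 * (1 / r)" using r by (simp add: field_simps)
        ultimately show ?thesis by linarith
      qed
      finally have Qx: "cmod (Q / x) \<le> M * (norm v)\<^sup>2" by (simp add: mult.commute)
      have "(norm v)\<^sup>2 \<le> norm v" using v d by (simp add: power2_eq_square mult_left_le)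
      then have "M * (norm v)\<^sup>2 \<le> M * norm v" using M by simp
      moreover have "cmod (L / x) \<le> M * norm v"
      proof -
        have "cmod L \<le> M0 * norm v * cmod x" using M0(2)[OF w] by (simp add: L_def x_def)
        also have "\<dots> \<le> M * norm v * cmod x" using M by (intro mult_right_mono) auto
        finally show ?thesis using x by (simp add: norm_divide field_simps)
      qed
      ultimately have q2: "cmod (q - 1) \<le> 2 * M * norm v"
        unfolding q1 using Qx norm_triangle_ineq[of "L / x" "Q / x"] by linarith
      have "M * norm v \<le> M * (1 / (4 * M))" using v d M by (intro mult_left_mono) auto
      then have "M * norm v \<le> 1/4" using M by simp
      then have q3: "cmod (q - 1) \<le> 1/2" using q2 by linarith
      then have "Re (1 - q) \<le> 1/2" using complex_Re_le_cmod[of "1 - q"] by (simp add: norm_minus_commute)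
      then have Rq: "Re q > 0" by simp
      have "rho (z + v) w powr (- s) = x powr (- s) * q powr (- s)"
        using powr_mult_Re_pos[OF x(1) Rq, of "- s"] x by (simp add: q_def)
      then have "f w / rho (z + v) w powr s = k w * q powr (- s)"
        by (simp add: k_def x_def powr_minus divide_inverse mult.assoc)
      then have eq: "f w / rho (z + v) w powr s - k w - k w * A w v
          = k w * ((q powr (- s) - 1 - (- s) * (q - 1)) - s * (Q / x))"
        by (simp add: q1 A_def L_def x_def algebra_simps)
      have "(cmod (q - 1))\<^sup>2 \<le> (2 * M * norm v)\<^sup>2" using q2 by (intro power_mono) auto
      then have "C * (cmod (q - 1))\<^sup>2 \<le> C * (2 * M * norm v)\<^sup>2" using C(1) by simp
      then have "cmod (q powr (- s) - 1 - (- s) * (q - 1)) \<le> C * (2 * M * norm v)\<^sup>2"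
        using C(2)[OF q3] by linarith
      moreover have "cmod (s * (Q / x)) \<le> cmod s * (M * (norm v)\<^sup>2)"
        unfolding norm_mult by (intro mult_left_mono Qx) simp
      ultimately have "cmod ((q powr (- s) - 1 - (- s) * (q - 1)) - s * (Q / x)) \<le> C * (2 * M * norm v)\<^sup>2 + cmod s * (M * (norm v)\<^sup>2)"
        using norm_triangle_ineq4[of "q powr (- s) - 1 - (- s) * (q - 1)" "s * (Q / x)"] by linarith
      also have "\<dots> = K * (norm v)\<^sup>2" by (simp add: K_def power2_eq_square algebra_simps)
      finally show "cmod (f w / rho (z + v) w powr s - k w - k w * A w v) \<le> K * (norm v)\<^sup>2 * cmod (k w)"
        unfolding eq norm_mult by (subst mult.commute) (rule mult_right_mono, auto)
    qed
    finally show "norm (toeplitz \<mu> \<xi> f (z + v) - toeplitz \<mu> \<xi> f z - D v) \<le> K * G * (norm v)\<^sup>2"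
      by (simp add: mult_ac)
  qed
  then show "\<exists>D. (toeplitz \<mu> \<xi> f has_derivative D) (at z) \<and> (\<forall>c v. D (c *s v) = c * D v)"
    using D_smult by blast
qed

subsection \<open>Test functions\<close>

lemma kernel_norm:
  fixes p \<alpha> s :: real
  assumes p: "p > 0" and \<alpha>: "\<alpha> > -1" and s: "s * p > real CARD('n) + 1 + \<alpha>"
  obtains C where "C > 0" "\<And>z :: ('n::{finite,linorder}) cspace. z \<in> T_B \<Longrightarrow>
      (\<lambda>w. rho w z powr complex_of_real (- s)) \<in> Bergman p \<alpha> \<and>
      Lnorm p \<alpha> (\<lambda>w. rho w z powr complex_of_real (- s)) \<le> ennreal (C * rho_diag z powr ((real CARD('n) + 1 + \<alpha>) / p - s))"
proof -
  obtain C where C: "C > 0" "\<And>z. z \<in> T_B \<Longrightarrow> (\<integral>\<^sup>+w. ennreal (rho_diag w powr \<alpha> * cmod (rho z w) powr (- (s * p))) \<partial>(vol_TB :: 'n cspace measure))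
        \<le> ennreal (C * rho_diag z powr (real CARD('n) + 1 + \<alpha> - s * p))"
    using forelli_rudin[OF \<alpha> s] by blast
  have "(\<lambda>w. rho w z powr complex_of_real (- s)) \<in> Bergman p \<alpha> \<and>
      Lnorm p \<alpha> (\<lambda>w. rho w z powr complex_of_real (- s)) \<le> ennreal (C powr (1/p) * rho_diag z powr ((real CARD('n) + 1 + \<alpha>) / p - s))"
    if z: "z \<in> T_B" for z :: "'n cspace"
  proof -
    let ?f = "\<lambda>w. rho w z powr complex_of_real (- s)"
    have hol: "holomorphic_multi ?f T_B" using z by (rule holomorphic_multi_kernel)
    have "(\<integral>\<^sup>+w. ennreal (cmod (?f w) powr p * rho_diag w powr \<alpha>) \<partial>vol_TB)
        = (\<integral>\<^sup>+w. ennreal (rho_diag w powr \<alpha> * cmod (rho z w) powr (- (s * p))) \<partial>vol_TB)"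
    proof (rule nn_integral_cong)
      fix w assume "w \<in> space (vol_TB :: 'n cspace measure)"
      then have w: "w \<in> T_B" by (simp add: space_vol_TB)
      show "ennreal (cmod (?f w) powr p * rho_diag w powr \<alpha>) = ennreal (rho_diag w powr \<alpha> * cmod (rho z w) powr (- (s * p)))"
        unfolding cmod_powr_rho[OF w z] cmod_rho_commute[of w z] by (simp add: powr_powr mult.commute)
    qed
    also have "\<dots> \<le> ennreal (C * rho_diag z powr (real CARD('n) + 1 + \<alpha> - s * p))" by (rule C(2)[OF z])
    finally have le: "(\<integral>\<^sup>+w. ennreal (cmod (?f w) powr p * rho_diag w powr \<alpha>) \<partial>vol_TB) \<le> ennreal (C * rho_diag z powr (real CARD('n) + 1 + \<alpha> - s * p))" .
    have "?f \<in> Bergman p \<alpha>"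
      unfolding Bergman_iff using hol le_less_trans[OF le] by simp
    moreover have "Lnorm p \<alpha> ?f \<le> ennpowr (ennreal (C * rho_diag z powr (real CARD('n) + 1 + \<alpha> - s * p))) (1/p)"
      unfolding Lnorm_eq[OF holomorphic_multi_measurable[OF hol]] using p by (intro ennpowr_mono le) simp
    moreover have "ennpowr (ennreal (C * rho_diag z powr (real CARD('n) + 1 + \<alpha> - s * p))) (1/p)
        = ennreal (C powr (1/p) * rho_diag z powr ((real CARD('n) + 1 + \<alpha>) / p - s))"
    proof -
      have "(real CARD('n) + 1 + \<alpha> - s * p) * (1 / p) = (real CARD('n) + 1 + \<alpha>) / p - s"
        using p by (simp add: diff_divide_distrib)
      then show ?thesis using C(1) by (simp add: ennpowr_ennreal powr_mult powr_powr del: times_divide_eq_right mult_1_right)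
    qed
    ultimately show ?thesis by simp
  qed
  then show ?thesis using C(1) that[of "C powr (1/p)"] by simp
qed

text \<open>In the mean value inequality the Bergman ball is enlarged to the whole domain and a p-th
  root is taken.\<close>

lemma Bergman_growth:
  fixes p \<alpha> :: real
  assumes p: "p > 0"
  obtains C where "C > 0" "\<And>g (z :: ('n::{finite,linorder}) cspace). holomorphic_multi g T_B \<Longrightarrow> z \<in> T_B \<Longrightarrow>
      ennreal (cmod (g z)) \<le> ennreal (C * rho_diag z powr (- ((real CARD('n) + 1 + \<alpha>) / p))) * Lnorm p \<alpha> g"
proof -
  obtain C where C: "C > 0" "\<And>f (a :: 'n cspace). holomorphic_multi f T_B \<Longrightarrow> a \<in> T_B \<Longrightarrow>
      ennreal (cmod (f a) powr p) \<le> ennreal (C * rho_diag a powr - (real CARD('n) + 1 + \<alpha>)) *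
        (\<integral>\<^sup>+w. ennreal (cmod (f w) powr p * rho_diag w powr \<alpha>) * indicator (bergman_ball a) w \<partial>vol_TB)"
    using bergman_mean_inequality[OF p, of \<alpha>] by blast
  have "ennreal (cmod (g z)) \<le> ennreal (C powr (1/p) * rho_diag z powr (- ((real CARD('n) + 1 + \<alpha>) / p))) * Lnorm p \<alpha> g"
    if g: "holomorphic_multi g T_B" and z: "z \<in> T_B" for g and z :: "'n cspace"
  proof -
    have r: "rho_diag z > 0" using z by (simp add: T_B_iff)
    define I where "I = (\<integral>\<^sup>+w. ennreal (cmod (g w) powr p * rho_diag w powr \<alpha>) \<partial>(vol_TB :: 'n cspace measure))"
    have "(\<integral>\<^sup>+w. ennreal (cmod (g w) powr p * rho_diag w powr \<alpha>) * indicator (bergman_ball z) w \<partial>vol_TB) \<le> I" (is "?J \<le> I")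
      unfolding I_def by (rule nn_integral_mono) (auto simp: indicator_def)
    then have "ennreal (cmod (g z) powr p) \<le> ennreal (C * rho_diag z powr - (real CARD('n) + 1 + \<alpha>)) * I"
      using order_trans[OF C(2)[OF g z] mult_left_mono[of ?J I]] by simp
    then have "ennpowr (ennreal (cmod (g z) powr p)) (1/p) \<le> ennpowr (ennreal (C * rho_diag z powr - (real CARD('n) + 1 + \<alpha>)) * I) (1/p)"
      using p by (intro ennpowr_mono) auto
    moreover have "ennpowr (ennreal (cmod (g z) powr p)) (1/p) = ennreal (cmod (g z))"
      using p by (simp add: ennpowr_ennreal powr_powr)
    moreover have "ennpowr (ennreal (C * rho_diag z powr - (real CARD('n) + 1 + \<alpha>)) * I) (1/p)
        = ennreal ((C * rho_diag z powr - (real CARD('n) + 1 + \<alpha>)) powr (1/p)) * Lnorm p \<alpha> g"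
      unfolding Lnorm_eq[OF holomorphic_multi_measurable[OF g]] I_def using C(1) r by (intro ennpowr_cmult) auto
    moreover have "(C * rho_diag z powr - (real CARD('n) + 1 + \<alpha>)) powr (1/p)
        = C powr (1/p) * rho_diag z powr (- ((real CARD('n) + 1 + \<alpha>) / p))"
    proof -
      have "- x * (1 / p) = - (x / p)" for x by simp
      from this[of "real CARD('n) + 1 + \<alpha>"] show ?thesis using C(1) r by (simp only: powr_mult powr_powr powr_ge_zero less_imp_le)
    qed
    ultimately show ?thesis by simp
  qed
  then show ?thesis using C(1) that[of "C powr (1/p)"] by simp
qed

lemma bergman_ball_rho_center_le:
  assumes z: "z \<in> T_B" and w: "w \<in> bergman_ball z"
  shows "cmod (rho z w) \<le> 4 * rho_diag z"
proof (rule power2_le_imp_le)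
  have pos: "rho_diag z > 0" using z by (simp add: T_B_iff)
  then have "2 * rho_diag z * rho_diag w \<le> 2 * rho_diag z * (8 * rho_diag z)"
    using bergman_ball_rho_diag_le[OF z w] by (intro mult_left_mono) auto
  moreover have "(cmod (rho z w))\<^sup>2 < 2 * rho_diag z * rho_diag w" using w by (simp add: bergman_ball_def)
  moreover have "2 * rho_diag z * (8 * rho_diag z) = (4 * rho_diag z)\<^sup>2" by (simp add: power2_eq_square)
  ultimately show "(cmod (rho z w))\<^sup>2 \<le> (4 * rho_diag z)\<^sup>2" by linarith
  show "0 \<le> 4 * rho_diag z" using pos by simp
qed

text \<open>A Chebyshev argument: on E(z) the kernel |rho(z,w)|^(-\<sigma>) is at least (4
  rho(z))^(-\<sigma>).\<close>

lemma kernel_bergman_ball_lower: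
  fixes z :: "('n::{finite,linorder}) cspace"
  assumes sets: "sets \<mu> = sets TB_space" and z: "z \<in> T_B" and \<sigma>: "\<sigma> > 0"
  shows "emeasure \<mu> (bergman_ball z) \<le> ennreal ((4 * rho_diag z) powr \<sigma>) * (\<integral>\<^sup>+w. ennreal (cmod (rho z w) powr (- \<sigma>)) \<partial>\<mu>)"
proof -
  note [measurable_cong] = sets
  have r: "rho_diag z > 0" using z by (simp add: T_B_iff)
  have "emeasure \<mu> (bergman_ball z) = (\<integral>\<^sup>+w. indicator (bergman_ball z) w \<partial>\<mu>)"
    by (rule nn_integral_indicator[symmetric]) (simp add: sets)
  also have "\<dots> \<le> (\<integral>\<^sup>+w. ennreal ((4 * rho_diag z) powr \<sigma>) * ennreal (cmod (rho z w) powr (- \<sigma>)) \<partial>\<mu>)"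
  proof (rule nn_integral_mono)
    fix w
    show "indicator (bergman_ball z) w \<le> ennreal ((4 * rho_diag z) powr \<sigma>) * ennreal (cmod (rho z w) powr (- \<sigma>))"
    proof (cases "w \<in> bergman_ball z")
      case True
      then have pos: "cmod (rho z w) > 0" using cmod_rho_pos[OF z] bergman_ball_subset by blast
      have "cmod (rho z w) powr \<sigma> \<le> (4 * rho_diag z) powr \<sigma>"
        using bergman_ball_rho_center_le[OF z True] \<sigma> by (intro powr_mono2) auto
      then have "1 \<le> (4 * rho_diag z) powr \<sigma> * cmod (rho z w) powr (- \<sigma>)"
        using pos by (simp add: powr_minus field_simps)
      then show ?thesis using True by (simp add: ennreal_mult[symmetric] del: ennreal_1 flip: ennreal_1)
    qed simp
  qed
  also have "\<dots> = ennreal ((4 * rho_diag z) powr \<sigma>) * (\<integral>\<^sup>+w. ennreal (cmod (rho z w) powr (- \<sigma>)) \<partial>\<mu>)"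
    by (rule nn_integral_cmult) measurable
  finally show ?thesis .
qed

text \<open>With the test function \<open>f\<^sub>z = \<rho>(\<cdot>, z)\<^bsup>-s\<^esup>\<close>, where \<open>s = n + 1 + \<xi>\<close>, the integrand of \<open>T f\<^sub>z(z)\<close> is
  the nonnegative function \<open>|\<rho>(z, w)|\<^bsup>-2s\<^esup>\<close>.\<close>

lemma toeplitz_lower:
  fixes p1 p2 \<alpha>1 \<alpha>2 \<xi> N s \<kappa> :: real
  assumes N: "N = real CARD('n) + 1" and s: "s = N + \<xi>"
    and \<kappa>: "\<kappa> = s + (N + \<alpha>1) / p1 - (N + \<alpha>2) / p2"
    and p: "0 < p1" "0 < p2" and \<alpha>1: "-1 < \<alpha>1" and \<xi>: "-1 < \<xi>"
    and cond: "s * p1 > N + \<alpha>1"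
  obtains C where "C > 0"
    "\<And>(\<mu> :: ('n::{finite,linorder}) cspace measure) c. sets \<mu> = sets TB_space \<Longrightarrow> toeplitz_bounded \<mu> \<xi> p1 \<alpha>1 p2 \<alpha>2 \<Longrightarrow> c \<ge> 0 \<Longrightarrow>
      (\<And>f. f \<in> Bergman p1 \<alpha>1 \<Longrightarrow> Lnorm p2 \<alpha>2 (toeplitz \<mu> \<xi> f) \<le> ennreal c * Lnorm p1 \<alpha>1 f) \<Longrightarrow>
      (\<And>z. z \<in> T_B \<Longrightarrow> emeasure \<mu> (bergman_ball z) \<le> ennreal (C * c * rho_diag z powr \<kappa>))"
proof -
  have cond': "s * p1 > real CARD('n) + 1 + \<alpha>1" using cond N by simp
  obtain C1 where C1: "C1 > 0" "\<And>z :: 'n cspace. z \<in> T_B \<Longrightarrow>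
      (\<lambda>w. rho w z powr complex_of_real (- s)) \<in> Bergman p1 \<alpha>1 \<and>
      Lnorm p1 \<alpha>1 (\<lambda>w. rho w z powr complex_of_real (- s)) \<le> ennreal (C1 * rho_diag z powr ((N + \<alpha>1) / p1 - s))"
    unfolding N using kernel_norm[OF p(1) \<alpha>1 cond'] by blast
  obtain C2 where C2: "C2 > 0" "\<And>g (z :: 'n cspace). holomorphic_multi g T_B \<Longrightarrow> z \<in> T_B \<Longrightarrow>
      ennreal (cmod (g z)) \<le> ennreal (C2 * rho_diag z powr (- ((N + \<alpha>2) / p2))) * Lnorm p2 \<alpha>2 g"
    unfolding N using Bergman_growth[OF p(2), of \<alpha>2] by blast
  have s0: "s > 0" using \<xi> s N by simp
  define C where "C = 4 powr (2 * s) * C2 * C1"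
  have C: "C > 0" using C1 C2 by (simp add: C_def)
  have "emeasure \<mu> (bergman_ball z) \<le> ennreal (C * c * rho_diag z powr \<kappa>)"
    if sets: "sets \<mu> = sets TB_space" and T: "toeplitz_bounded \<mu> \<xi> p1 \<alpha>1 p2 \<alpha>2" and c: "c \<ge> 0"
      and bd: "\<And>f. f \<in> Bergman p1 \<alpha>1 \<Longrightarrow> Lnorm p2 \<alpha>2 (toeplitz \<mu> \<xi> f) \<le> ennreal c * Lnorm p1 \<alpha>1 f"
      and z: "z \<in> T_B" for \<mu> :: "'n cspace measure" and c z
  proof -
    note [measurable_cong] = sets
    have space: "space \<mu> = T_B" using sets by (rule space_eq_T_B)
    have r: "rho_diag z > 0" using z by (simp add: T_B_iff)
    have sN: "real CARD('n) + 1 + \<xi> = s" using s N by simp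
    define f where "f w = rho w z powr complex_of_real (- s)" for w
    have f: "f \<in> Bergman p1 \<alpha>1" "Lnorm p1 \<alpha>1 f \<le> ennreal (C1 * rho_diag z powr ((N + \<alpha>1) / p1 - s))"
      using C1(2)[OF z] by (simp_all add: f_def[abs_def])
    have int: "integrable \<mu> (\<lambda>w. f w / rho z w powr complex_of_real s)"
      using T f(1) z unfolding toeplitz_bounded_def sN by blast
    have Tf: "holomorphic_multi (toeplitz \<mu> \<xi> f) T_B"
      using T f(1) unfolding toeplitz_bounded_def bounded_op_def by (auto simp: Bergman_iff)
    \<comment> \<open>\<open>rho w z\<close> is the conjugate of \<open>rho z w\<close>, and in Re >
      0 the principal power commutes with conjugation, so the two kernel factors combine to 1 /
      |rho(z,w)^s|^2.\<close>
    have kernel: "f w / rho z w powr complex_of_real s = complex_of_real (cmod (rho z w) powr (- (2 * s)))" if w: "w \<in> T_B" for w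
    proof -
      have Re: "Re (rho z w) > 0" using z w by (rule Re_rho_pos)
      have "f w = inverse (cnj (rho z w) powr complex_of_real s)"
        by (simp add: f_def rho_cnj powr_minus)
      also have "cnj (rho z w) powr complex_of_real s = cnj (rho z w powr complex_of_real s)"
        using cnj_powr[of "rho z w" "complex_of_real s"] Re by simp
      finally have "f w / rho z w powr complex_of_real s = inverse (rho z w powr complex_of_real s * cnj (rho z w powr complex_of_real s))"
        by (simp add: field_simps)
      also have "\<dots> = inverse (complex_of_real ((cmod (rho z w) powr s)\<^sup>2))"
        by (simp add: complex_norm_square[symmetric] cmod_powr_rho[OF z w])
      also have "\<dots> = complex_of_real (inverse ((cmod (rho z w) powr s)\<^sup>2))" by simp
      also have "inverse ((cmod (rho z w) powr s)\<^sup>2) = cmod (rho z w) powr (- (2 * s))"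
        by (simp add: powr_minus power2_eq_square powr_add[symmetric])
      finally show ?thesis .
    qed
    have int': "integrable \<mu> (\<lambda>w. complex_of_real (cmod (rho z w) powr (- (2 * s))))"
      using int by (subst (asm) Bochner_Integration.integrable_cong[OF refl kernel]) (simp_all add: space)
    then have int'': "integrable \<mu> (\<lambda>w. cmod (rho z w) powr (- (2 * s)))"
      using integrable_norm[OF int'] by simp
    have "toeplitz \<mu> \<xi> f z = (LINT w|\<mu>. complex_of_real (cmod (rho z w) powr (- (2 * s))))"
      unfolding toeplitz_def sN by (rule Bochner_Integration.integral_cong) (simp_all add: space kernel)
    also have "\<dots> = complex_of_real (LINT w|\<mu>. cmod (rho z w) powr (- (2 * s)))"
      by (rule integral_complex_of_real)
    finally have "ennreal (cmod (toeplitz \<mu> \<xi> f z)) = ennreal (LINT w|\<mu>. cmod (rho z w) powr (- (2 * s)))"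
      by (simp add: integral_nonneg_AE)
    also have "\<dots> = (\<integral>\<^sup>+w. ennreal (cmod (rho z w) powr (- (2 * s))) \<partial>\<mu>)"
      using int'' by (intro nn_integral_eq_integral[symmetric]) auto
    finally have Tz: "(\<integral>\<^sup>+w. ennreal (cmod (rho z w) powr (- (2 * s))) \<partial>\<mu>) = ennreal (cmod (toeplitz \<mu> \<xi> f z))" by simp
    have "ennreal (cmod (toeplitz \<mu> \<xi> f z))
        \<le> ennreal (C2 * rho_diag z powr (- ((N + \<alpha>2) / p2))) * Lnorm p2 \<alpha>2 (toeplitz \<mu> \<xi> f)"
      by (rule C2(2)[OF Tf z])
    also have "\<dots> \<le> ennreal (C2 * rho_diag z powr (- ((N + \<alpha>2) / p2))) *
        (ennreal c * ennreal (C1 * rho_diag z powr ((N + \<alpha>1) / p1 - s)))"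
      using order_trans[OF bd[OF f(1)] mult_left_mono[OF f(2)]] by (intro mult_left_mono) auto
    finally have Tle: "ennreal (cmod (toeplitz \<mu> \<xi> f z)) \<le> ennreal (C2 * rho_diag z powr (- ((N + \<alpha>2) / p2))) *
        (ennreal c * ennreal (C1 * rho_diag z powr ((N + \<alpha>1) / p1 - s)))" .
    have "emeasure \<mu> (bergman_ball z) \<le> ennreal ((4 * rho_diag z) powr (2 * s)) * ennreal (cmod (toeplitz \<mu> \<xi> f z))"
      using kernel_bergman_ball_lower[OF sets z, of "2 * s"] s0 unfolding Tz by simp
    also have "\<dots> \<le> ennreal ((4 * rho_diag z) powr (2 * s)) *
        (ennreal (C2 * rho_diag z powr (- ((N + \<alpha>2) / p2))) * (ennreal c * ennreal (C1 * rho_diag z powr ((N + \<alpha>1) / p1 - s))))"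
      by (rule mult_left_mono[OF Tle]) simp
    also have "\<dots> = ennreal ((4 * rho_diag z) powr (2 * s) *
        ((C2 * rho_diag z powr (- ((N + \<alpha>2) / p2))) * (c * (C1 * rho_diag z powr ((N + \<alpha>1) / p1 - s)))))"
      using C1(1) C2(1) c by (simp add: ennreal_mult)
    also have "(4 * rho_diag z) powr (2 * s) *
        ((C2 * rho_diag z powr (- ((N + \<alpha>2) / p2))) * (c * (C1 * rho_diag z powr ((N + \<alpha>1) / p1 - s))))
        = C * c * (rho_diag z powr (2 * s) * rho_diag z powr (- ((N + \<alpha>2) / p2)) * rho_diag z powr ((N + \<alpha>1) / p1 - s))"
      using r by (simp add: C_def powr_mult mult_ac)
    \<comment> \<open>The powers come from the ball estimate, the growth of A^p2 functions and the
      norm of the test function; their sum is \<kappa>.\<close>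
    also have "rho_diag z powr (2 * s) * rho_diag z powr (- ((N + \<alpha>2) / p2)) * rho_diag z powr ((N + \<alpha>1) / p1 - s) = rho_diag z powr \<kappa>"
      unfolding powr_add[symmetric] \<kappa> by (simp add: algebra_simps)
    finally show ?thesis .
  qed
  then show ?thesis using C that by blast
qed

subsection \<open>Carleson measures\<close>

lemma M_plus_sets: "\<mu> \<in> M_plus \<Longrightarrow> sets \<mu> = sets TB_space"
  by (simp add: M_plus_def borel_measure_TB_def TB_space_def)

text \<open>The sublevel sets of |rho(.,base_pt)| exhaust the domain and have finite measure by
  Chebyshev applied to the integral that defines \<open>M_plus\<close>.\<close>

lemma M_plus_sigma_finite:
  fixes \<mu> :: "('n::{finite,linorder}) cspace measure"
  assumes \<mu>: "\<mu> \<in> M_plus"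
  shows "sigma_finite_measure \<mu>"
proof
  have sets: "sets \<mu> = sets TB_space" using \<mu> by (rule M_plus_sets)
  note [measurable_cong] = sets
  have space: "space \<mu> = T_B" using sets by (rule space_eq_T_B)
  obtain t where t: "t > 0" "(\<integral>\<^sup>+z. ennreal (cmod (rho z base_pt) powr (- t)) \<partial>\<mu>) < \<infinity>"
    using \<mu> by (auto simp: M_plus_def)
  define A where "A k = {z \<in> space \<mu>. cmod (rho z base_pt) \<le> real k}" for k
  have A_sets: "A k \<in> sets \<mu>" for k unfolding A_def by measurable
  have A_fin: "emeasure \<mu> (A k) < \<infinity>" for k
  proof -
    have "emeasure \<mu> (A k) = (\<integral>\<^sup>+z. indicator (A k) z \<partial>\<mu>)" using A_sets by simp
    also have "\<dots> \<le> (\<integral>\<^sup>+z. ennreal (real k powr t) * ennreal (cmod (rho z base_pt) powr (- t)) \<partial>\<mu>)"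
    proof (rule nn_integral_mono)
      fix z assume "z \<in> space \<mu>"
      then have pos: "cmod (rho z base_pt) > 0" using cmod_rho_pos[of z base_pt] by (simp add: space)
      show "indicator (A k) z \<le> ennreal (real k powr t) * ennreal (cmod (rho z base_pt) powr (- t))"
      proof (cases "z \<in> A k")
        case True
        then have "cmod (rho z base_pt) powr t \<le> real k powr t"
          using t by (intro powr_mono2) (auto simp: A_def)
        then have "1 \<le> real k powr t * cmod (rho z base_pt) powr (- t)"
          using pos by (simp add: powr_minus field_simps)
        then show ?thesis using True by (simp add: ennreal_mult[symmetric] del: ennreal_1 flip: ennreal_1)
      qed simp
    qed
    also have "\<dots> = ennreal (real k powr t) * (\<integral>\<^sup>+z. ennreal (cmod (rho z base_pt) powr (- t)) \<partial>\<mu>)"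
      by (rule nn_integral_cmult) measurable
    also have "\<dots> < \<infinity>" using t by (simp add: ennreal_mult_less_top)
    finally show ?thesis .
  qed
  have "(\<Union>k. A k) = space \<mu>" using real_arch_simple by (auto simp: A_def)
  then show "\<exists>A. countable A \<and> A \<subseteq> sets \<mu> \<and> \<Union>A = space \<mu> \<and> (\<forall>a\<in>A. emeasure \<mu> a \<noteq> \<infinity>)"
    using A_sets A_fin by (intro exI[of _ "range A"]) (auto simp: less_top)
qed

lemma Lnorm_cmult:
  assumes f[measurable]: "f \<in> borel_measurable TB_space" and a: "a > 0" and p: "p > 0"
  shows "Lnorm p \<alpha> (\<lambda>w. complex_of_real a * f w) = ennreal a * Lnorm p \<alpha> f"
proof -
  have "(\<integral>\<^sup>+z. ennreal (cmod (complex_of_real a * f z) powr p * rho_diag z powr \<alpha>) \<partial>vol_TB)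
      = (\<integral>\<^sup>+z. ennreal (a powr p) * ennreal (cmod (f z) powr p * rho_diag z powr \<alpha>) \<partial>vol_TB)"
    using a by (intro nn_integral_cong) (simp add: norm_mult powr_mult ennreal_mult[symmetric] mult_ac)
  also have "\<dots> = ennreal (a powr p) * (\<integral>\<^sup>+z. ennreal (cmod (f z) powr p * rho_diag z powr \<alpha>) \<partial>vol_TB)"
    by (rule nn_integral_cmult) measurable
  finally show ?thesis
    using a p by (simp add: Lnorm_eq ennpowr_cmult powr_powr)
qed

text \<open>Tests the norm on normalized kernels of a sufficiently large order \<sigma>. Apart from
  the constant, the power of rho(z) obtained depends on p and q only through q/p.\<close>

lemma carleson_norm_lower:
  fixes p q \<gamma> :: real
  assumes p: "p > 0" and q: "q > 0" and \<gamma>: "\<gamma> > -1"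
  obtains C where "C > 0" "\<And>(\<mu> :: ('n::{finite,linorder}) cspace measure) z. sets \<mu> = sets TB_space \<Longrightarrow> z \<in> T_B \<Longrightarrow>
      emeasure \<mu> (bergman_ball z) \<le> ennreal (C * rho_diag z powr ((real CARD('n) + 1 + \<gamma>) * (q / p))) * carleson_norm p q \<gamma> \<mu>"
proof -
  define N where "N = real CARD('n) + 1"
  \<comment> \<open>The kernel lies in the Bergman space once \<sigma> p > N + \<gamma>; adding 1
    makes the inequality strict, and \<sigma> cancels in the final exponent.\<close>
  define \<sigma> where "\<sigma> = (N + \<gamma>) / p + 1"
  have \<sigma>: "\<sigma> > 0" using p \<gamma> by (simp add: \<sigma>_def N_def add_nonneg_pos)
  have "(N + \<gamma>) / p * p = N + \<gamma>" using p by simp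
  then have \<sigma>p: "\<sigma> * p > real CARD('n) + 1 + \<gamma>" using p unfolding \<sigma>_def distrib_right N_def by linarith
  obtain C1 where C1: "C1 > 0" "\<And>z :: 'n cspace. z \<in> T_B \<Longrightarrow>
      (\<lambda>w. rho w z powr complex_of_real (- \<sigma>)) \<in> Bergman p \<gamma> \<and>
      Lnorm p \<gamma> (\<lambda>w. rho w z powr complex_of_real (- \<sigma>)) \<le> ennreal (C1 * rho_diag z powr ((N + \<gamma>) / p - \<sigma>))"
    unfolding N_def using kernel_norm[OF p \<gamma> \<sigma>p] by blast
  define C where "C = 4 powr (\<sigma> * q) * C1 powr q"
  have C: "C > 0" using C1 by (simp add: C_def)
  have "emeasure \<mu> (bergman_ball z) \<le> ennreal (C * rho_diag z powr ((N + \<gamma>) * (q / p))) * carleson_norm p q \<gamma> \<mu>"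
    if sets: "sets \<mu> = sets TB_space" and z: "z \<in> T_B" for \<mu> :: "'n cspace measure" and z
  proof -
    note [measurable_cong] = sets
    have space: "space \<mu> = T_B" using sets by (rule space_eq_T_B)
    have r: "rho_diag z > 0" using z by (simp add: T_B_iff)
    \<comment> \<open>Dividing by this upper bound, instead of by the norm itself, already gives
      norm at most 1 and keeps the power of rho(z) explicit.\<close>
    define b where "b = C1 * rho_diag z powr ((N + \<gamma>) / p - \<sigma>)"
    have b: "b > 0" using C1 r by (simp add: b_def)
    define f where "f w = rho w z powr complex_of_real (- \<sigma>)" for w
    define g where "g w = complex_of_real (1 / b) * f w" for w
    have f: "holomorphic_multi f T_B" unfolding f_def[abs_def] using z by (rule holomorphic_multi_kernel)
    have g: "holomorphic_multi g T_B" unfolding g_def[abs_def] using f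
      by (intro holomorphic_multi_mult holomorphic_multi_const)
    have "Lnorm p \<gamma> g = ennreal (1 / b) * Lnorm p \<gamma> f"
      unfolding g_def[abs_def] using b p by (intro Lnorm_cmult holomorphic_multi_measurable f) auto
    also have "\<dots> \<le> ennreal (1 / b) * ennreal b"
      using C1(2)[OF z] by (intro mult_left_mono) (auto simp: f_def[abs_def] b_def)
    also have "\<dots> = 1" using b by (simp flip: ennreal_mult)
    finally have g_le: "Lnorm p \<gamma> g \<le> 1" .
    have meas: "g \<in> borel_measurable TB_space" using g by (rule holomorphic_multi_measurable)
    have "Lnorm p \<gamma> g < \<infinity>" using g_le by (rule le_less_trans) simp
    then have "g \<in> Bergman p \<gamma>"
      using g measurable_lebesgue_on_T_B[OF meas] by (simp add: Bergman_def Lp_def)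
    with g_le have le: "(\<integral>\<^sup>+w. ennreal (cmod (g w) powr q) \<partial>\<mu>) \<le> carleson_norm p q \<gamma> \<mu>"
      unfolding carleson_norm_def by (intro SUP_upper) simp
    have "(\<integral>\<^sup>+w. ennreal (cmod (rho z w) powr (- (\<sigma> * q))) \<partial>\<mu>)
        = (\<integral>\<^sup>+w. ennreal (b powr q) * ennreal (cmod (g w) powr q) \<partial>\<mu>)"
    proof (rule nn_integral_cong)
      fix w assume "w \<in> space \<mu>"
      then have w: "w \<in> T_B" by (simp add: space)
      have "cmod (g w) = 1 / b * cmod (rho z w) powr (- \<sigma>)"
        unfolding g_def f_def norm_mult cmod_powr_rho[OF w z] cmod_rho_commute[of w z] norm_of_real using b by simp
      then have "b powr q * cmod (g w) powr q = cmod (rho z w) powr (- (\<sigma> * q))"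
        using b by (simp add: powr_mult powr_divide powr_powr)
      then show "ennreal (cmod (rho z w) powr (- (\<sigma> * q))) = ennreal (b powr q) * ennreal (cmod (g w) powr q)"
        by (simp add: ennreal_mult[symmetric])
    qed
    also have "\<dots> = ennreal (b powr q) * (\<integral>\<^sup>+w. ennreal (cmod (g w) powr q) \<partial>\<mu>)"
      using meas by (intro nn_integral_cmult) simp
    finally have int: "(\<integral>\<^sup>+w. ennreal (cmod (rho z w) powr (- (\<sigma> * q))) \<partial>\<mu>)
        = ennreal (b powr q) * (\<integral>\<^sup>+w. ennreal (cmod (g w) powr q) \<partial>\<mu>)" .
    have "emeasure \<mu> (bergman_ball z) \<le> ennreal ((4 * rho_diag z) powr (\<sigma> * q)) *
        (ennreal (b powr q) * (\<integral>\<^sup>+w. ennreal (cmod (g w) powr q) \<partial>\<mu>))"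
      using kernel_bergman_ball_lower[OF sets z, of "\<sigma> * q"] \<sigma> q unfolding int by simp
    also have "\<dots> \<le> ennreal ((4 * rho_diag z) powr (\<sigma> * q)) * (ennreal (b powr q) * carleson_norm p q \<gamma> \<mu>)"
      by (intro mult_left_mono le) auto
    also have "\<dots> = ennreal ((4 * rho_diag z) powr (\<sigma> * q) * b powr q) * carleson_norm p q \<gamma> \<mu>"
      by (simp add: ennreal_mult mult.assoc)
    also have "(4 * rho_diag z) powr (\<sigma> * q) * b powr q = C * rho_diag z powr ((N + \<gamma>) * (q / p))"
    proof -
      have e: "\<sigma> * q + ((N + \<gamma>) / p - \<sigma>) * q = (N + \<gamma>) * (q / p)" by (simp add: algebra_simps)
      have "(4 * rho_diag z) powr (\<sigma> * q) * b powr q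
          = C * (rho_diag z powr (\<sigma> * q) * rho_diag z powr (((N + \<gamma>) / p - \<sigma>) * q))"
        using C1(1) r by (simp add: C_def b_def powr_mult powr_powr mult_ac)
      then show ?thesis unfolding powr_add[symmetric] e .
    qed
    finally show ?thesis .
  qed
  then show ?thesis using C that unfolding N_def by blast
qed

lemma ennpowr_one [simp]: "ennpowr 1 p = 1"
  using ennpowr_ennreal[of 1 p] by simp

lemma carleson_norm_upper:
  fixes p q \<gamma> :: real
  assumes p: "0 < p" "p \<le> q"
  obtains C where "C > 0" "\<And>(\<mu> :: ('n::{finite,linorder}) cspace measure) k. sets \<mu> = sets TB_space \<Longrightarrow> sigma_finite_measure \<mu> \<Longrightarrow> k > 0 \<Longrightarrow>
      (\<And>z. z \<in> T_B \<Longrightarrow> emeasure \<mu> (bergman_ball z) \<le> ennreal (k * rho_diag z powr ((real CARD('n) + 1 + \<gamma>) * (q / p)))) \<Longrightarrow>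
      (\<forall>f\<in>Bergman p \<gamma>. (\<integral>\<^sup>+w. ennreal (cmod (f w) powr q) \<partial>\<mu>) \<le> ennreal (C * k) * ennpowr (Lnorm p \<gamma> f) q) \<and>
      carleson_norm p q \<gamma> \<mu> \<le> ennreal (C * k)"
proof -
  obtain C where C: "C > 0" "\<And>(\<mu> :: 'n cspace measure) F k. sets \<mu> = sets TB_space \<Longrightarrow> sigma_finite_measure \<mu> \<Longrightarrow> holomorphic_multi F T_B \<Longrightarrow> k > 0 \<Longrightarrow>
      (\<And>z. z \<in> T_B \<Longrightarrow> emeasure \<mu> (bergman_ball z) \<le> ennreal (k * rho_diag z powr ((real CARD('n) + 1 + \<gamma>) * (q / p)))) \<Longrightarrow>
      (\<integral>\<^sup>+w. ennreal (cmod (F w) powr q) \<partial>\<mu>)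
        \<le> ennreal (C * k) * ennpowr (\<integral>\<^sup>+w. ennreal (cmod (F w) powr p * rho_diag w powr \<gamma>) \<partial>vol_TB) (q / p)"
    using carleson_embedding[OF p, of \<gamma>] by blast
  have "(\<forall>f\<in>Bergman p \<gamma>. (\<integral>\<^sup>+w. ennreal (cmod (f w) powr q) \<partial>\<mu>) \<le> ennreal (C * k) * ennpowr (Lnorm p \<gamma> f) q) \<and>
      carleson_norm p q \<gamma> \<mu> \<le> ennreal (C * k)"
    if sets: "sets \<mu> = sets TB_space" and sf: "sigma_finite_measure \<mu>" and k: "k > 0"
      and \<mu>: "\<And>z. z \<in> T_B \<Longrightarrow> emeasure \<mu> (bergman_ball z) \<le> ennreal (k * rho_diag z powr ((real CARD('n) + 1 + \<gamma>) * (q / p)))"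
    for \<mu> :: "'n cspace measure" and k
  proof (rule conjI)
    show 1: "\<forall>f\<in>Bergman p \<gamma>. (\<integral>\<^sup>+w. ennreal (cmod (f w) powr q) \<partial>\<mu>) \<le> ennreal (C * k) * ennpowr (Lnorm p \<gamma> f) q"
    proof
      fix f :: "'n cspace \<Rightarrow> complex" assume "f \<in> Bergman p \<gamma>"
      then have f: "holomorphic_multi f T_B" by (simp add: Bergman_iff)
      show "(\<integral>\<^sup>+w. ennreal (cmod (f w) powr q) \<partial>\<mu>) \<le> ennreal (C * k) * ennpowr (Lnorm p \<gamma> f) q"
        unfolding Lnorm_powr[OF holomorphic_multi_measurable[OF f] p(1)]
        by (rule C(2)[OF sets sf f k \<mu>])
    qed
    show "carleson_norm p q \<gamma> \<mu> \<le> ennreal (C * k)"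
      unfolding carleson_norm_def
    proof (rule SUP_least)
      fix f :: "'n cspace \<Rightarrow> complex" assume "f \<in> {f \<in> Bergman p \<gamma>. Lnorm p \<gamma> f \<le> 1}"
      then have f: "f \<in> Bergman p \<gamma>" "Lnorm p \<gamma> f \<le> 1" by auto
      have "ennpowr (Lnorm p \<gamma> f) q \<le> 1"
        using ennpowr_mono[OF f(2), of q] p by simp
      from mult_left_mono[OF this, of "ennreal (C * k)"] bspec[OF 1 f(1)]
      show "(\<integral>\<^sup>+w. ennreal (cmod (f w) powr q) \<partial>\<mu>) \<le> ennreal (C * k)" by simp
    qed
  qed
  then show ?thesis using C(1) that by blast
qed

subsection \<open>The equivalences\<close>

text \<open>A finite norm of the Berezin-type transform forces finiteness at every point. This gives
  absolute convergence of the Toeplitz integral, hence holomorphy; the norm bound then follows by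
  domination.\<close>

lemma toeplitz_bounded_of_berezin_bounded:
  fixes \<mu> :: "('n::{finite,linorder}) cspace measure"
  assumes sets: "sets \<mu> = sets TB_space" and sf: "sigma_finite_measure \<mu>"
    and p2: "p2 > 0" and \<xi>: "\<xi> > -1" and B: "berezin_bounded \<mu> \<xi> p1 \<alpha>1 p2 \<alpha>2"
  shows "toeplitz_bounded \<mu> \<xi> p1 \<alpha>1 p2 \<alpha>2"
proof -
  obtain C where C: "C \<ge> 0" "\<And>f. f \<in> Bergman p1 \<alpha>1 \<Longrightarrow> Lnorm_ext p2 \<alpha>2 (berezin \<mu> \<xi> f) \<le> ennreal C * Lnorm p1 \<alpha>1 f"
    and Lp: "\<And>f. f \<in> Bergman p1 \<alpha>1 \<Longrightarrow> berezin \<mu> \<xi> f \<in> Lp_ext p2 \<alpha>2"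
    using B unfolding berezin_bounded_def bounded_op_def by blast
  have int: "integrable \<mu> (\<lambda>w. f w / rho z w powr complex_of_real (real CARD('n) + 1 + \<xi>))"
    if f: "f \<in> Bergman p1 \<alpha>1" and z: "z \<in> T_B" for f z
  proof -
    have hol: "holomorphic_multi f T_B" using f by (simp add: Bergman_iff)
    have fin: "Lnorm_ext p2 \<alpha>2 (berezin \<mu> \<xi> f) < \<infinity>" using Lp[OF f] by (simp add: Lp_ext_def)
    show ?thesis
      by (intro toeplitz_integrable[OF sets _ z] berezin_finite[OF sets p2 \<xi> _ _ fin z]
          borel_measurable_berezin[OF sets sf hol] holomorphic_multi_measurable[OF hol])
  qed
  have le: "Lnorm p2 \<alpha>2 (toeplitz \<mu> \<xi> f) \<le> Lnorm_ext p2 \<alpha>2 (berezin \<mu> \<xi> f)" for f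
    by (rule Lnorm_toeplitz_le[OF sets p2])
  have T: "toeplitz \<mu> \<xi> f \<in> Bergman p2 \<alpha>2" if f: "f \<in> Bergman p1 \<alpha>1" for f
  proof -
    have hol: "holomorphic_multi f T_B" using f by (simp add: Bergman_iff)
    have Tf: "holomorphic_multi (toeplitz \<mu> \<xi> f) T_B"
      by (rule holomorphic_multi_toeplitz[OF sets holomorphic_multi_measurable[OF hol] int[OF f]])
    have "Lnorm p2 \<alpha>2 (toeplitz \<mu> \<xi> f) < \<infinity>"
      using Lp[OF f] le_less_trans[OF le[of f]] by (simp add: Lp_ext_def)
    then show ?thesis
      using Tf measurable_lebesgue_on_T_B[OF holomorphic_multi_measurable[OF Tf]] by (simp add: Bergman_def Lp_def)
  qed
  show ?thesis
    unfolding toeplitz_bounded_def bounded_op_def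
    using int T C(1) order_trans[OF le C(2)] by blast
qed

lemma berezin_bounded_of_bound:
  fixes \<mu> :: "('n::{finite,linorder}) cspace measure"
  assumes sets: "sets \<mu> = sets TB_space" and sf: "sigma_finite_measure \<mu>" and c: "c \<ge> 0"
    and bd: "\<And>f. f \<in> Bergman p1 \<alpha>1 \<Longrightarrow> Lnorm_ext p2 \<alpha>2 (berezin \<mu> \<xi> f) \<le> ennreal c * Lnorm p1 \<alpha>1 f"
  shows "berezin_bounded \<mu> \<xi> p1 \<alpha>1 p2 \<alpha>2"
proof -
  have "berezin \<mu> \<xi> f \<in> Lp_ext p2 \<alpha>2" if f: "f \<in> Bergman p1 \<alpha>1" for f
  proof -
    have hol: "holomorphic_multi f T_B" using f by (simp add: Bergman_iff)
    have "Lnorm p1 \<alpha>1 f < \<infinity>" using f by (simp add: Bergman_def Lp_def)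
    then have "ennreal c * Lnorm p1 \<alpha>1 f < \<infinity>" by (simp add: ennreal_mult_less_top)
    then show ?thesis
      using le_less_trans[OF bd[OF f]] measurable_lebesgue_on_T_B[OF borel_measurable_berezin[OF sets sf hol]]
      by (simp add: Lp_ext_def)
  qed
  then show ?thesis unfolding berezin_bounded_def bounded_op_def using bd c by blast
qed

text \<open>An operator norm is an infimum, so admissible constants are at hand for every t above
  it; moreover the estimates in terms of the ball condition need a positive constant, while the norm
  may be 0.\<close>

lemma ennreal_le_of_forall_gt:
  assumes "\<And>t. t > \<tau> \<Longrightarrow> x \<le> ennreal (C * t)" and C: "C > 0" and \<tau>: "\<tau> \<ge> 0"
  shows "x \<le> ennreal C * ennreal \<tau>"
proof -
  have "x \<le> ennreal (C * (\<tau> + 1))" by (rule assms(1)) simp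
  then obtain r where r: "x = ennreal r" "r \<ge> 0"
    by (cases x rule: ennreal_infinity_cases) (auto simp: top_unique)
  have "r / C \<le> \<tau>"
  proof (rule dense_ge)
    fix t assume t: "\<tau> < t"
    then have "r \<le> C * t" using assms(1)[OF t] r C \<tau> by simp
    then show "r / C \<le> t" using C by (simp add: field_simps)
  qed
  then have "r \<le> C * \<tau>" using C by (simp add: field_simps)
  then show ?thesis using r C \<tau> by (simp add: ennreal_mult[symmetric] ennreal_leI)
qed

lemma op_norm_le: "(\<And>f. f \<in> X \<Longrightarrow> normY (S f) \<le> C * normX f) \<Longrightarrow> op_norm X normX normY S \<le> C"
  unfolding op_norm_def by (rule Inf_lower) simp

lemma op_norm_less:
  assumes "op_norm X normX normY S < t" "f \<in> X"
  shows "normY (S f) \<le> t * normX f"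
proof -
  obtain c where c: "\<forall>f\<in>X. normY (S f) \<le> c * normX f" "c < t"
    using assms(1) unfolding op_norm_def Inf_less_iff by auto
  then have "normY (S f) \<le> c * normX f" using assms(2) by blast
  also have "\<dots> \<le> t * normX f" using c(2) by (intro mult_right_mono) auto
  finally show ?thesis .
qed

theorem theorem5p1:
  fixes p1 p2 \<alpha>1 \<alpha>2 \<xi> lam \<gamma> :: real
  assumes "0 < p1" "p1 \<le> p2"
    and "-1 < \<alpha>1" "-1 < \<alpha>2" "-1 < \<xi>"
    and "real CARD('n) + 1 + \<xi> > real CARD('n) * max 1 (1 / p1) + (1 + \<alpha>1) / p1"
    and "real CARD('n) + 1 + \<xi> > real CARD('n) * max 1 (1 / p2) + (1 + \<alpha>2) / p2"
    and "lam = 1 + 1 / p1 - 1 / p2"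
    and "\<gamma> = 1 / lam * (\<xi> + \<alpha>1 / p1 - \<alpha>2 / p2)"
  shows "(\<forall>\<mu> \<in> (M_plus :: ('n::{finite,linorder}) cspace measure set).
            (berezin_bounded \<mu> \<xi> p1 \<alpha>1 p2 \<alpha>2 \<longleftrightarrow> toeplitz_bounded \<mu> \<xi> p1 \<alpha>1 p2 \<alpha>2) \<and>
            (toeplitz_bounded \<mu> \<xi> p1 \<alpha>1 p2 \<alpha>2 \<longleftrightarrow> carleson lam \<gamma> \<mu>)) \<and>
         (\<forall>p q. p > 0 \<and> q > 0 \<and> q / p = lam \<longrightarrow>
            (\<exists>C>0. \<forall>\<mu> \<in> (M_plus :: ('n::{finite,linorder}) cspace measure set). carleson lam \<gamma> \<mu> \<longrightarrow>
               comparable C (berezin_norm \<mu> \<xi> p1 \<alpha>1 p2 \<alpha>2) (toeplitz_norm \<mu> \<xi> p1 \<alpha>1 p2 \<alpha>2) \<and>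
               comparable C (toeplitz_norm \<mu> \<xi> p1 \<alpha>1 p2 \<alpha>2) (carleson_norm p q \<gamma> \<mu>)))"
proof -
  define N where "N = real CARD('n) + 1"
  define s where "s = N + \<xi>"
  define \<kappa> where "\<kappa> = s + (N + \<alpha>1) / p1 - (N + \<alpha>2) / p2"
  have p2: "p2 > 0" using assms(1,2) by simp
  have N1: "N - 1 \<ge> 1" by (simp add: N_def Suc_leI)
  have lam: "lam \<ge> 1"
  proof -
    have "1 / p2 \<le> 1 / p1" using assms(1,2) by (simp add: field_simps)
    then show ?thesis using assms(8) by simp
  qed
  have lam_\<gamma>: "lam * \<gamma> = \<xi> + \<alpha>1 / p1 - \<alpha>2 / p2" using lam unfolding assms(9) by simp
  \<comment> \<open>The ball condition of the Carleson embedding, of exponent (N + \<gamma>) q/p,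
    coincides with the one of the Berezin bound; this is what determines \<gamma>.\<close>
  have \<kappa>_eq: "(N + \<gamma>) * lam = \<kappa>"
  proof -
    have "(N + \<gamma>) * lam = N * lam + lam * \<gamma>" by (simp add: algebra_simps)
    also have "\<dots> = \<kappa>"
      unfolding lam_\<gamma> unfolding assms(8) \<kappa>_def s_def by (simp add: algebra_simps add_divide_distrib)
    finally show ?thesis .
  qed
  have cond1: "s * p1 > N + \<alpha>1"
  proof -
    have "(N - 1) * (1 / p1) \<le> (N - 1) * max 1 (1 / p1)" using N1 by (intro mult_left_mono) auto
    then have "s > (N - 1) / p1 + (1 + \<alpha>1) / p1" using assms(6) by (simp add: s_def N_def)
    moreover have "(N - 1) / p1 + (1 + \<alpha>1) / p1 = (N + \<alpha>1) / p1"
      by (simp add: add_divide_distrib[symmetric])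
    ultimately show ?thesis using assms(1) by (simp add: pos_divide_less_eq)
  qed
  have cond2: "s > (N - 1) * max 1 (1 / p2) + (1 + \<alpha>2) / p2"
    using assms(7) by (simp add: s_def N_def)
  \<comment> \<open>The inequality for i = 2 gives \<xi> + 1 > (1 + \<alpha>2)/p2, and (1 +
    \<alpha>1)/p1 is positive. The bound is needed for kernels to lie in the spaces with weight
    \<gamma>.\<close>
  have \<gamma>: "\<gamma> > -1"
  proof -
    have "(N - 1) * 1 \<le> (N - 1) * max 1 (1 / p2)" using N1 by (intro mult_left_mono) auto
    then have "\<xi> + 1 > (1 + \<alpha>2) / p2" using cond2 by (simp add: s_def)
    moreover have "(1 + \<alpha>1) / p1 > 0" using assms(1,3) by simp
    ultimately have "\<xi> + 1 + (1 + \<alpha>1) / p1 - (1 + \<alpha>2) / p2 > 0" by linarith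
    moreover have "lam * (1 + \<gamma>) = \<xi> + 1 + (1 + \<alpha>1) / p1 - (1 + \<alpha>2) / p2"
      unfolding distrib_left lam_\<gamma> unfolding assms(8) by (simp add: add_divide_distrib)
    ultimately have "lam * (1 + \<gamma>) > 0" by simp
    then show ?thesis using lam by (simp add: zero_less_mult_iff)
  qed
  \<comment> \<open>The geometric condition through which all implications pass. Its constant k
    stays explicit so that the norm estimates can be linear in k.\<close>
  define G where "G k \<mu> \<longleftrightarrow> (\<forall>z\<in>T_B. emeasure \<mu> (bergman_ball z) \<le> ennreal (k * rho_diag z powr \<kappa>))"
    for k and \<mu> :: "'n cspace measure"
  have G_mono: "G k' \<mu>" if "G k \<mu>" "k \<le> k'" for k k' and \<mu> :: "'n cspace measure"
    unfolding G_def
  proof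
    fix z :: "'n cspace" assume "z \<in> T_B"
    then have "emeasure \<mu> (bergman_ball z) \<le> ennreal (k * rho_diag z powr \<kappa>)" using that(1) by (simp add: G_def)
    also have "\<dots> \<le> ennreal (k' * rho_diag z powr \<kappa>)" using that(2) by (intro ennreal_leI mult_right_mono) auto
    finally show "emeasure \<mu> (bergman_ball z) \<le> ennreal (k' * rho_diag z powr \<kappa>)" .
  qed
  obtain CB where CB0: "CB > 0" "\<And>(\<mu> :: 'n cspace measure) f k. sets \<mu> = sets TB_space \<Longrightarrow> sigma_finite_measure \<mu> \<Longrightarrow> k > 0 \<Longrightarrow>
      (\<And>z. z \<in> T_B \<Longrightarrow> emeasure \<mu> (bergman_ball z) \<le> ennreal (k * rho_diag z powr \<kappa>)) \<Longrightarrow> f \<in> Bergman p1 \<alpha>1 \<Longrightarrow>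
      Lnorm_ext p2 \<alpha>2 (berezin \<mu> \<xi> f) \<le> ennreal (CB * k) * Lnorm p1 \<alpha>1 f"
    using berezin_bound[OF N_def s_def \<kappa>_def assms(1,2,4) cond2] by blast
  have CB1: "Lnorm_ext p2 \<alpha>2 (berezin \<mu> \<xi> f) \<le> ennreal (CB * k) * Lnorm p1 \<alpha>1 f"
    if "sets \<mu> = sets TB_space" "sigma_finite_measure \<mu>" "k > 0" "G k \<mu>" "f \<in> Bergman p1 \<alpha>1" for \<mu> f k
    by (rule CB0(2)[OF that(1-3) _ that(5)]) (use that(4) in \<open>simp add: G_def\<close>)
  note CB = CB0(1) CB1
  obtain CT where CT0: "CT > 0" "\<And>(\<mu> :: 'n cspace measure) c z. sets \<mu> = sets TB_space \<Longrightarrow> toeplitz_bounded \<mu> \<xi> p1 \<alpha>1 p2 \<alpha>2 \<Longrightarrow> c \<ge> 0 \<Longrightarrow>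
      (\<And>f. f \<in> Bergman p1 \<alpha>1 \<Longrightarrow> Lnorm p2 \<alpha>2 (toeplitz \<mu> \<xi> f) \<le> ennreal c * Lnorm p1 \<alpha>1 f) \<Longrightarrow>
      z \<in> T_B \<Longrightarrow> emeasure \<mu> (bergman_ball z) \<le> ennreal (CT * c * rho_diag z powr \<kappa>)"
    using toeplitz_lower[OF N_def s_def \<kappa>_def assms(1) p2 assms(3,5) cond1] by blast
  have CT1: "G (CT * c) \<mu>"
    if "sets \<mu> = sets TB_space" "toeplitz_bounded \<mu> \<xi> p1 \<alpha>1 p2 \<alpha>2" "c \<ge> 0"
      "\<And>f. f \<in> Bergman p1 \<alpha>1 \<Longrightarrow> Lnorm p2 \<alpha>2 (toeplitz \<mu> \<xi> f) \<le> ennreal c * Lnorm p1 \<alpha>1 f" for \<mu> c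
    unfolding G_def using CT0(2)[OF that] by simp
  note CT = CT0(1) CT1
  have upper: "\<exists>C>0. \<forall>\<mu> k. sets \<mu> = sets TB_space \<longrightarrow> sigma_finite_measure \<mu> \<longrightarrow> k > 0 \<longrightarrow> G k \<mu> \<longrightarrow>
      (\<forall>f\<in>Bergman p \<gamma>. (\<integral>\<^sup>+w. ennreal (cmod (f w) powr q) \<partial>\<mu>) \<le> ennreal (C * k) * ennpowr (Lnorm p \<gamma> f) q) \<and>
      carleson_norm p q \<gamma> \<mu> \<le> ennreal (C * k)" if pq: "p > 0" "q > 0" "q / p = lam" for p q
  proof -
    have "p \<le> q" using pq lam by (simp add: pos_le_divide_eq flip: pq(3))
    from carleson_norm_upper[OF pq(1) this, of \<gamma>, where 'n='n] show ?thesis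
      unfolding G_def pq(3) \<kappa>_eq[symmetric] N_def by metis
  qed
  have lower: "\<exists>C>0. \<forall>\<mu> c. sets \<mu> = sets TB_space \<longrightarrow> c \<ge> 0 \<longrightarrow> carleson_norm p q \<gamma> \<mu> \<le> ennreal c \<longrightarrow> G (C * c) \<mu>"
    if pq: "p > 0" "q > 0" "q / p = lam" for p q
  proof -
    obtain C where C: "C > 0" "\<And>(\<mu> :: 'n cspace measure) z. sets \<mu> = sets TB_space \<Longrightarrow> z \<in> T_B \<Longrightarrow>
      emeasure \<mu> (bergman_ball z) \<le> ennreal (C * rho_diag z powr \<kappa>) * carleson_norm p q \<gamma> \<mu>"
      unfolding \<kappa>_eq[symmetric] N_def pq(3)[symmetric] using carleson_norm_lower[OF pq(1,2) \<gamma>] by blast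
    have "G (C * c) \<mu>" if "sets \<mu> = sets TB_space" "c \<ge> 0" "carleson_norm p q \<gamma> \<mu> \<le> ennreal c" for \<mu> c
      unfolding G_def
    proof
      fix z :: "'n cspace" assume z: "z \<in> T_B"
      have "emeasure \<mu> (bergman_ball z) \<le> ennreal (C * rho_diag z powr \<kappa>) * ennreal c"
        by (rule order_trans[OF C(2)[OF that(1) z] mult_left_mono[OF that(3)]]) simp
      also have "\<dots> = ennreal (C * c * rho_diag z powr \<kappa>)"
        using C(1) that(2) by (simp add: ennreal_mult[symmetric] mult_ac)
      finally show "emeasure \<mu> (bergman_ball z) \<le> ennreal (C * c * rho_diag z powr \<kappa>)" .
    qed
    then show ?thesis using C(1) by blast
  qed
  have G_berezin: "berezin_bounded \<mu> \<xi> p1 \<alpha>1 p2 \<alpha>2" if "\<mu> \<in> M_plus" "G k \<mu>" "k > 0" for \<mu> k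
    using berezin_bounded_of_bound[OF M_plus_sets[OF that(1)] M_plus_sigma_finite[OF that(1)] _
        CB(2)[OF M_plus_sets[OF that(1)] M_plus_sigma_finite[OF that(1)] that(3,2)]] CB(1) that(3) by simp
  have berezin_toeplitz: "toeplitz_bounded \<mu> \<xi> p1 \<alpha>1 p2 \<alpha>2" if "\<mu> \<in> M_plus" "berezin_bounded \<mu> \<xi> p1 \<alpha>1 p2 \<alpha>2" for \<mu> :: "'n cspace measure"
    using toeplitz_bounded_of_berezin_bounded[OF M_plus_sets M_plus_sigma_finite p2 assms(5)] that by blast
  have toeplitz_G: "\<exists>k>0. G k \<mu>" if \<mu>: "\<mu> \<in> M_plus" and T: "toeplitz_bounded \<mu> \<xi> p1 \<alpha>1 p2 \<alpha>2" for \<mu>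
  proof -
    obtain c where c: "c \<ge> 0" "\<And>f. f \<in> Bergman p1 \<alpha>1 \<Longrightarrow> Lnorm p2 \<alpha>2 (toeplitz \<mu> \<xi> f) \<le> ennreal c * Lnorm p1 \<alpha>1 f"
      using T unfolding toeplitz_bounded_def bounded_op_def by blast
    have "G (CT * c) \<mu>" by (rule CT(2)[OF M_plus_sets[OF \<mu>] T c])
    \<comment> \<open>The bound c may be 0, whereas the implications starting from \<open>G\<close>
      ask for a positive constant.\<close>
    then have "G (CT * c + 1) \<mu>" by (rule G_mono) simp
    moreover have "CT * c + 1 > 0" using CT(1) c(1) by (simp add: add_nonneg_pos)
    ultimately show ?thesis by blast
  qed
  have G_carleson: "carleson lam \<gamma> \<mu>" if \<mu>: "\<mu> \<in> M_plus" and G: "G k \<mu>" "k > 0" for \<mu> k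
    unfolding carleson_def
  proof (intro conjI allI impI)
    show "borel_measure_TB \<mu>" using \<mu> by (simp add: M_plus_def)
    fix p q :: real assume pq: "0 < p \<and> 0 < q \<and> q / p = lam"
    then obtain C where C: "C > 0" "\<forall>\<mu> k. sets \<mu> = sets TB_space \<longrightarrow> sigma_finite_measure \<mu> \<longrightarrow> k > 0 \<longrightarrow> G k \<mu> \<longrightarrow>
      (\<forall>f\<in>Bergman p \<gamma>. (\<integral>\<^sup>+w. ennreal (cmod (f w) powr q) \<partial>\<mu>) \<le> ennreal (C * k) * ennpowr (Lnorm p \<gamma> f) q) \<and>
      carleson_norm p q \<gamma> \<mu> \<le> ennreal (C * k)"
      using upper[of p q] by blast
    have "\<forall>f\<in>Bergman p \<gamma>. (\<integral>\<^sup>+w. ennreal (cmod (f w) powr q) \<partial>\<mu>) \<le> ennreal (C * k) * ennpowr (Lnorm p \<gamma> f) q"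
      using C(2)[rule_format, OF M_plus_sets[OF \<mu>] M_plus_sigma_finite[OF \<mu>] G(2,1)] by simp
    with C(1) show "\<exists>C>0. \<forall>f\<in>Bergman p \<gamma>. (\<integral>\<^sup>+z. ennreal (cmod (f z) powr q) \<partial>\<mu>) \<le> ennreal C * ennpowr (Lnorm p \<gamma> f) q"
      using G(2) by (intro exI[of _ "C * k"]) simp
  qed
  have carleson_G: "\<exists>k>0. G k \<mu>" if \<mu>: "\<mu> \<in> M_plus" and car: "carleson lam \<gamma> \<mu>" for \<mu>
  proof -
    \<comment> \<open>One pair with q/p = \<lambda> is enough to recover the ball condition; p = 1,
      q = \<lambda> is the simplest.\<close>
    have pq: "0 < (1::real)" "0 < lam" "lam / 1 = lam" using lam by auto
    obtain c where c: "c > 0" "\<forall>f\<in>Bergman 1 \<gamma>. (\<integral>\<^sup>+z. ennreal (cmod (f z) powr lam) \<partial>\<mu>) \<le> ennreal c * ennpowr (Lnorm 1 \<gamma> f) lam"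
      using car pq unfolding carleson_def by blast
    have "carleson_norm 1 lam \<gamma> \<mu> \<le> ennreal c"
      unfolding carleson_norm_def
    proof (rule SUP_least)
      fix f :: "'n cspace \<Rightarrow> complex" assume "f \<in> {f \<in> Bergman 1 \<gamma>. Lnorm 1 \<gamma> f \<le> 1}"
      then have f: "f \<in> Bergman 1 \<gamma>" "Lnorm 1 \<gamma> f \<le> 1" by auto
      have "ennpowr (Lnorm 1 \<gamma> f) lam \<le> 1"
        using ennpowr_mono[OF f(2), of lam] pq by simp
      from mult_left_mono[OF this, of "ennreal c"] bspec[OF c(2) f(1)]
      show "(\<integral>\<^sup>+z. ennreal (cmod (f z) powr lam) \<partial>\<mu>) \<le> ennreal c" by simp
    qed
    moreover obtain C where "C > 0" "\<forall>\<mu> c. sets \<mu> = sets TB_space \<longrightarrow> c \<ge> 0 \<longrightarrow> carleson_norm 1 lam \<gamma> \<mu> \<le> ennreal c \<longrightarrow> G (C * c) \<mu>"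
      using lower[OF pq] by blast
    ultimately have "G (C * c) \<mu>" "C * c > 0" using M_plus_sets[OF \<mu>] c(1) by auto
    then show ?thesis by blast
  qed
  have norm_T_le_B: "toeplitz_norm \<mu> \<xi> p1 \<alpha>1 p2 \<alpha>2 \<le> berezin_norm \<mu> \<xi> p1 \<alpha>1 p2 \<alpha>2" if "\<mu> \<in> M_plus" for \<mu> :: "'n cspace measure"
    unfolding toeplitz_norm_def berezin_norm_def op_norm_def
    by (rule Inf_superset_mono) (use order_trans[OF Lnorm_toeplitz_le[OF M_plus_sets[OF that] p2]] in auto)
  have norm_B_le: "berezin_norm \<mu> \<xi> p1 \<alpha>1 p2 \<alpha>2 \<le> ennreal (CB * k)" if "\<mu> \<in> M_plus" "G k \<mu>" "k > 0" for \<mu> k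
    unfolding berezin_norm_def
    by (rule op_norm_le) (rule CB(2)[OF M_plus_sets[OF that(1)] M_plus_sigma_finite[OF that(1)] that(3,2)])
  have norms: "\<exists>C>0. \<forall>\<mu> \<in> (M_plus :: 'n cspace measure set). carleson lam \<gamma> \<mu> \<longrightarrow>
               comparable C (berezin_norm \<mu> \<xi> p1 \<alpha>1 p2 \<alpha>2) (toeplitz_norm \<mu> \<xi> p1 \<alpha>1 p2 \<alpha>2) \<and>
               comparable C (toeplitz_norm \<mu> \<xi> p1 \<alpha>1 p2 \<alpha>2) (carleson_norm p q \<gamma> \<mu>)"
    if pq: "p > 0" "q > 0" "q / p = lam" for p q
  proof -
    obtain CU where CU0: "CU > 0" "\<forall>\<mu> k. sets \<mu> = sets TB_space \<longrightarrow> sigma_finite_measure \<mu> \<longrightarrow> k > 0 \<longrightarrow> G k \<mu> \<longrightarrow>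
        (\<forall>f\<in>Bergman p \<gamma>. (\<integral>\<^sup>+w. ennreal (cmod (f w) powr q) \<partial>\<mu>) \<le> ennreal (CU * k) * ennpowr (Lnorm p \<gamma> f) q) \<and>
        carleson_norm p q \<gamma> \<mu> \<le> ennreal (CU * k)"
      using upper[OF pq] by blast
    have CU1: "carleson_norm p q \<gamma> \<mu> \<le> ennreal (CU * k)"
      if "sets \<mu> = sets TB_space" "sigma_finite_measure \<mu>" "k > 0" "G k \<mu>" for \<mu> k
      using CU0(2)[rule_format, OF that] by simp
    note CU = CU0(1) CU1
    obtain CL where CL: "CL > 0" "\<And>\<mu> c. sets \<mu> = sets TB_space \<Longrightarrow> c \<ge> 0 \<Longrightarrow> carleson_norm p q \<gamma> \<mu> \<le> ennreal c \<Longrightarrow> G (CL * c) \<mu>"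
      using lower[OF pq] by blast
    \<comment> \<open>One summand for each comparison between the norms b, t, c of the Berezin-type
      operator, the Toeplitz operator and \<mu>: t <= b, b <= CB CT t, c <= CU CT t, and t <= b <=
      CB CL c.\<close>
    define C where "C = 1 + CB * CT + CU * CT + CB * CL"
    have pos: "CB * CT > 0" "CU * CT > 0" "CB * CL > 0" using CB CT CU CL by auto
    have C: "C > 0" "1 \<le> C" "CB * CT \<le> C" "CU * CT \<le> C" "CB * CL \<le> C"
      using pos unfolding C_def by (linarith+)
    have weaken: "x \<le> ennreal C * y" if "x \<le> ennreal c * y" "c \<le> C" for x y c
      by (rule order_trans[OF that(1) mult_right_mono[OF ennreal_leI[OF that(2)]]]) simp
    have "comparable C (berezin_norm \<mu> \<xi> p1 \<alpha>1 p2 \<alpha>2) (toeplitz_norm \<mu> \<xi> p1 \<alpha>1 p2 \<alpha>2) \<and>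
               comparable C (toeplitz_norm \<mu> \<xi> p1 \<alpha>1 p2 \<alpha>2) (carleson_norm p q \<gamma> \<mu>)"
      if \<mu>: "\<mu> \<in> M_plus" and car: "carleson lam \<gamma> \<mu>" for \<mu> :: "'n cspace measure"
    proof -
      let ?b = "berezin_norm \<mu> \<xi> p1 \<alpha>1 p2 \<alpha>2" and ?t = "toeplitz_norm \<mu> \<xi> p1 \<alpha>1 p2 \<alpha>2" and ?c = "carleson_norm p q \<gamma> \<mu>"
      have sets: "sets \<mu> = sets TB_space" and sf: "sigma_finite_measure \<mu>"
        using M_plus_sets[OF \<mu>] M_plus_sigma_finite[OF \<mu>] by auto
      obtain k where k: "k > 0" "G k \<mu>" using carleson_G[OF \<mu> car] by blast
      have T: "toeplitz_bounded \<mu> \<xi> p1 \<alpha>1 p2 \<alpha>2" using berezin_toeplitz[OF \<mu>] G_berezin[OF \<mu> k(2,1)] by blast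
      have tb: "?t \<le> ?b" by (rule norm_T_le_B[OF \<mu>])
      have "?t \<le> ennreal (CB * k)" using tb norm_B_le[OF \<mu> k(2,1)] by (rule order_trans)
      then obtain t where t: "?t = ennreal t" "t \<ge> 0"
        by (cases ?t rule: ennreal_infinity_cases) (auto simp: top_unique)
      have "?c \<le> ennreal (CU * k)" by (rule CU(2)[OF sets sf k])
      then obtain c where c: "?c = ennreal c" "c \<ge> 0"
        by (cases ?c rule: ennreal_infinity_cases) (auto simp: top_unique)
      \<comment> \<open>Each u above the Toeplitz norm is an admissible bound and is positive, so
        the ball condition holds with constant CT u; letting u tend to t is left to
        \<open>ennreal_le_of_forall_gt\<close>.\<close>
      have GT: "G (CT * u) \<mu>" "CT * u > 0" if u: "u > t" for u
      proof -
        show "CT * u > 0" using u t CT(1) by simp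
        have lt: "op_norm (Bergman p1 \<alpha>1) (Lnorm p1 \<alpha>1) (Lnorm p2 \<alpha>2) (toeplitz \<mu> \<xi>) < ennreal u"
          using t u unfolding toeplitz_norm_def by (simp add: ennreal_lessI)
        show "G (CT * u) \<mu>"
          by (rule CT(2)[OF sets T]) (use u t op_norm_less[OF lt] in auto)
      qed
      have "?b \<le> ennreal (CB * CT) * ennreal t"
        by (rule ennreal_le_of_forall_gt) (use norm_B_le[OF \<mu> GT] pos t in \<open>auto simp: mult.assoc\<close>)
      moreover have "?c \<le> ennreal (CU * CT) * ennreal t"
        by (rule ennreal_le_of_forall_gt) (use CU(2)[OF sets sf GT(2,1)] pos t in \<open>auto simp: mult.assoc\<close>)
      moreover have "?t \<le> ennreal (CB * CL) * ennreal c"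
      proof (rule ennreal_le_of_forall_gt)
        fix u assume u: "u > c"
        then have "?c \<le> ennreal u" using c by (simp add: ennreal_leI)
        then have "G (CL * u) \<mu>" using u c by (intro CL(2)[OF sets]) auto
        moreover have "CL * u > 0" using u c CL(1) by simp
        ultimately have "?b \<le> ennreal (CB * (CL * u))" by (rule norm_B_le[OF \<mu>])
        then show "?t \<le> ennreal (CB * CL * u)" using tb by (simp add: mult.assoc)
      qed (use pos c in auto)
      moreover have "?t \<le> ennreal 1 * ?b" using tb by simp
      ultimately show ?thesis
        unfolding comparable_def using weaken C t c by metis
    qed
    then show ?thesis using C(1) by blast
  qed
  show ?thesis
    using G_berezin berezin_toeplitz toeplitz_G G_carleson carleson_G norms by blast
qed

end
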